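(* Assume the hypotheses of Theorem 3 with $q=1$, with true parameters $(\alpha_1^*,\dots,\alpha_p^* )$ satisfying $-c\le\alpha_j^*\le c$ for some constant $c>0$. Suppose the initial transports are drawn from the stationary distribution of Theorem 3 and $\{T_i\}_{i=1}^n$ are generated from $T_i=\alpha_p^*\odot T_{i-p}\oplus\cdots\oplus\alpha_1^*\odot T_{i-1}\oplus\varepsilon_i$, and that all $T_i$ are strictly increasing, differentiable and bi-Lipschitz with a common Lipschitz constant $K$. Let $$L_n(\alpha_1,\dots,\alpha_p)=\frac1{n-p}\sum_{i=p+1}^n\int_{\mathcal{S}}\big(T_i(x)-\alpha_p\odot T_{i-p}\oplus\cdots\oplus\alpha_1\odot T_{i-1}(x)\big)^2dx$$ and $\widetilde{\boldsymbol\alpha}=(\widetilde\alpha_1,\dots,\widetilde\alpha_p)\in\arg\min_{-c\le\alpha_1,\dots,\alpha_p\le c}L_n(\alpha_1,\dots,\alpha_p)$. Then $\Delta(\widetilde{\boldsymbol\alpha},\boldsymbol\alpha^* )\to0$ in probability as $n\to\infty$, where $$\Delta(\boldsymbol\alpha,\boldsymbol\alpha^* )=\int_{\mathcal{S}}E\Big[\big(\alpha_p\odot T_1\oplus\cdots\oplus\alpha_1\odot T_p(x)-\alpha^*_p\odot T_1\oplus\cdots\oplus\alpha^*_1\odot T_p(x)\big)^2\Big]dx$$ (the expectation taken with respect to the stationary sequence, with $\boldsymbol\alpha$ held fixed at $\widetilde{\boldsymbol\alpha}$).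
   Context: $\mathcal{S}=[s_1,s_2]$; $\mathcal{T}$ = non-decreasing maps $\mathcal{S}\to\mathcal{S}$ fixing $s_1,s_2$; $d_1(S,T)=\int_{\mathcal{S}}|S-T|$, product metric $d_1(\mathbf S,\mathbf R)=(\sum_j d_1^2(S_j,R_j))^{1/2}$ on $\mathcal{T}^p$; $T^{-1}(y)=\inf\{x:T(x)\ge y\}$. $T_1\oplus T_2:=T_2\circ T_1$; scalar multiplication $\odot$: for $0<\alpha\le1$, $\alpha\odot T(x)=x+\alpha(T(x)-x)$; $0\odot T=\mathrm{id}$; for $-1\le\alpha<0$, $\alpha\odot T(x)=x+\alpha(x-T^{-1}(x))$; for $|\alpha|>1$, $b=\lfloor|\alpha|\rfloor$, $a=|\alpha|-b$, $\alpha\odot T=(a\odot T)\circ T^{\circ b}$ if $\alpha>1$, $(a\odot T^{-1})\circ(T^{-1})^{\circ b}$ if $\alpha<-1$. Random distortion map: random element $\varepsilon\in\mathcal{T}$ with $E[\varepsilon(x)]=x$. The hypothesis of Theorem 3 with $q=1$: with $\Upsilon_\varepsilon(\mathbf S)=(S_2,\dots,S_p,\alpha_p^*\odot S_1\oplus\cdots\oplus\alpha_1^*\odot S_p\oplus\varepsilon)$ and $\widetilde\Upsilon_{i,m}=\Upsilon_{\varepsilon_i}\circ\cdots\circ\Upsilon_{\varepsilon_{i-m+1}}$ for i.i.d. distortion maps $\varepsilon_i$, there exist $\eta>0,\mathbf S_0,C>0,r\in(0,1)$ with $E[d_1^\eta(\widetilde\Upsilon_{i,m}(\mathbf S_0),\widetilde\Upsilon_{i,m}(\mathbf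 R))]\le Cr^md_1^\eta(\mathbf S_0,\mathbf R)$ for all $\mathbf R,m$. *)

theory Defs
  imports "HOL-Probability.Probability"
begin

definition Tset :: "real \<Rightarrow> real \<Rightarrow> (real \<Rightarrow> real) set" where
  "Tset s1 s2 = {T. mono_on {s1..s2} T \<and> T s1 = s1 \<and> T s2 = s2 \<and>
                    (\<forall>x. x \<notin> {s1..s2} \<longrightarrow> T x = x)}"

definition tinv :: "real \<Rightarrow> real \<Rightarrow> (real \<Rightarrow> real) \<Rightarrow> real \<Rightarrow> real" where
  "tinv s1 s2 T = (\<lambda>y. if s1 \<le> y \<and> y \<le> s2 then Inf {x. s1 \<le> x \<and> x \<le> s2 \<and> y \<le> T x} else y)"

definition oplus :: "(real \<Rightarrow> real) \<Rightarrow> (real \<Rightarrow> real) \<Rightarrow> real \<Rightarrow> real" where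
  "oplus T1 T2 = T2 \<circ> T1"

definition posmul :: "real \<Rightarrow> (real \<Rightarrow> real) \<Rightarrow> real \<Rightarrow> real" where
  "posmul a T = (\<lambda>x. x + a * (T x - x))"

definition smult :: "real \<Rightarrow> real \<Rightarrow> real \<Rightarrow> (real \<Rightarrow> real) \<Rightarrow> real \<Rightarrow> real" where
  "smult s1 s2 \<alpha> T =
     (if 0 \<le> \<alpha> \<and> \<alpha> \<le> 1 then posmul \<alpha> T
      else if -1 \<le> \<alpha> \<and> \<alpha> < 0 then (\<lambda>x. x + \<alpha> * (x - tinv s1 s2 T x))
      else if 1 < \<alpha> then posmul (\<alpha> - of_int \<lfloor>\<alpha>\<rfloor>) T \<circ> (T ^^ nat \<lfloor>\<alpha>\<rfloor>)
      else posmul (\<bar>\<alpha>\<bar> - of_int \<lfloor>\<bar>\<alpha>\<bar>\<rfloor>) (tinv s1 s2 T) \<circ> (tinv s1 s2 T ^^ nat \<lfloor>\<bar>\<alpha>\<bar>\<rfloor>))"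

text \<open>ar_comp s1 s2 a U k = a_k (.) U_k (+) ... (+) a_1 (.) U_1
   = (a_1 (.) U_1) o ... o (a_k (.) U_k).  With U j = T_{i-j} and k = p this is
   a_p (.) T_{i-p} (+) ... (+) a_1 (.) T_{i-1}.\<close>
primrec ar_comp :: "real \<Rightarrow> real \<Rightarrow> (nat \<Rightarrow> real) \<Rightarrow> (nat \<Rightarrow> real \<Rightarrow> real) \<Rightarrow> nat \<Rightarrow> real \<Rightarrow> real" where
  "ar_comp s1 s2 a U 0 = id"
| "ar_comp s1 s2 a U (Suc k) = oplus (smult s1 s2 (a (Suc k)) (U (Suc k))) (ar_comp s1 s2 a U k)"

definition d1 :: "real \<Rightarrow> real \<Rightarrow> (real \<Rightarrow> real) \<Rightarrow> (real \<Rightarrow> real) \<Rightarrow> real" where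
  "d1 s1 s2 S T = (LINT x:{s1..s2}|lborel. \<bar>S x - T x\<bar>)"

definition d1p :: "real \<Rightarrow> real \<Rightarrow> nat \<Rightarrow> (nat \<Rightarrow> real \<Rightarrow> real) \<Rightarrow> (nat \<Rightarrow> real \<Rightarrow> real) \<Rightarrow> real" where
  "d1p s1 s2 p S R = sqrt (\<Sum>j\<in>{1..p}. (d1 s1 s2 (S j) (R j))\<^sup>2)"

text \<open>Upsilon_eps(S_1,...,S_p) = (S_2,...,S_p, a_p (.) S_1 (+) ... (+) a_1 (.) S_p (+) eps).\<close>
definition upsilon :: "real \<Rightarrow> real \<Rightarrow> nat \<Rightarrow> (nat \<Rightarrow> real) \<Rightarrow> (real \<Rightarrow> real) \<Rightarrow>
    (nat \<Rightarrow> real \<Rightarrow> real) \<Rightarrow> nat \<Rightarrow> real \<Rightarrow> real" where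
  "upsilon s1 s2 p a e S = (\<lambda>j. if 1 \<le> j \<and> j < p then S (Suc j)
        else if j = p then oplus (ar_comp s1 s2 a (\<lambda>k. S (p + 1 - k)) p) e
        else S j)"

text \<open>upsilon_iter ... e i m = Upsilon_{e i} o ... o Upsilon_{e (i-m+1)}.\<close>
primrec upsilon_iter :: "real \<Rightarrow> real \<Rightarrow> nat \<Rightarrow> (nat \<Rightarrow> real) \<Rightarrow> (nat \<Rightarrow> real \<Rightarrow> real) \<Rightarrow>
    nat \<Rightarrow> nat \<Rightarrow> (nat \<Rightarrow> real \<Rightarrow> real) \<Rightarrow> nat \<Rightarrow> real \<Rightarrow> real" where
  "upsilon_iter s1 s2 p a e i 0 S = S"
| "upsilon_iter s1 s2 p a e i (Suc m) S = upsilon s1 s2 p a (e i) (upsilon_iter s1 s2 p a e (i - 1) m S)"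

definition FN :: "(real \<Rightarrow> real) measure" where
  "FN = PiM UNIV (\<lambda>_. borel)"

definition Ln :: "real \<Rightarrow> real \<Rightarrow> nat \<Rightarrow> nat \<Rightarrow> (nat \<Rightarrow> real \<Rightarrow> real) \<Rightarrow> (nat \<Rightarrow> real) \<Rightarrow> real" where
  "Ln s1 s2 p n T a = (1 / real (n - p)) *
     (\<Sum>i\<in>{p+1..n}. LINT x:{s1..s2}|lborel. (T i x - ar_comp s1 s2 a (\<lambda>j. T (i - j)) p x)\<^sup>2)"

end

theory Submission
  imports Defs
begin

text \<open>The innovations have conditional mean \<open>id\<close>, so the discrepancy \<open>\<Delta>(\<alpha>, \<alpha>\<^sup>*)\<close> equals the excess
  \<open>E Q(\<alpha>) - E Q(\<alpha>\<^sup>*)\<close> of the stationary mean loss, and consistency of the minimiser follows from a uniform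
  law of large numbers for the losses \<open>Q\<^sub>k(\<alpha>)\<close>.  For a fixed \<open>\<alpha>\<close> the law of large numbers holds because the
  losses decorrelate: \<open>Q\<^sub>k\<close> is close in mean to the same functional of the iteration restarted at the
  identity \<open>m\<close> steps earlier, which is independent of the past up to time \<open>k - m\<close>; the moment contraction makes the
  two iterations close in \<open>d\<^sub>1\<close>, and bi-Lipschitz regularity upgrades this to uniform closeness of the
  transports, their inverses and their \<open>\<odot>\<close>-multiples.  Uniformity in \<open>\<alpha>\<close> comes from a finite net,
  since \<open>\<alpha> \<mapsto> \<alpha> \<odot> T(x)\<close> is Lipschitz.\<close>

section \<open>Distortion maps and scalar multiplication\<close>

text \<open>The contraction hypothesis speaks of deterministic starting points in
  \<open>Tset\<close>, of \<open>d1\<close> only, and of an unspecified reference point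
  \<open>S0\<close>, whereas a uniform comparison needs invertible maps. Two devices bridge this.
  The stationary window enters as a random starting point by freezing the past, which is independent
  of the innovations after the restart. The comparison itself is made with the iterates from
  \<open>id\<close>, which remain homeomorphisms because every innovation turns out to be one;
  \<open>S0\<close> is only the midpoint of a triangle inequality. The perturbation lemmas ask for
  Lipschitz bounds on one side alone, the observed maps, and none is established for the restarted
  ones. Measurability shapes the rest: the maps live in the product sigma-algebra \<open>FN\<close>,
  on which evaluation at a variable point is not jointly measurable, so joint measurability is drawn
  from continuity or from finitely many measurable breakpoints. The estimator is not assumed to be
  measurable in the sample point, so the final event is only covered by a measurable one.\<close>

lemma Tset_mono: "T \<in> Tset s1 s2 \<Longrightarrow> x \<in> {s1..s2} \<Longrightarrow> y \<in> {s1..s2} \<Longrightarrow> x \<le> y \<Longrightarrow> T x \<le> T y"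
  by (auto simp: Tset_def mono_on_def)

lemma Tset_outside: "T \<in> Tset s1 s2 \<Longrightarrow> x \<notin> {s1..s2} \<Longrightarrow> T x = x"
  by (auto simp: Tset_def)

lemma Tset_range:
  assumes "T \<in> Tset s1 s2" "x \<in> {s1..s2}"
  shows "T x \<in> {s1..s2}"
  using Tset_mono[OF assms(1), of s1 x] Tset_mono[OF assms(1), of x s2] assms
  by (auto simp: Tset_def)

lemma ar_comp_cong:
  assumes "\<And>j. j \<in> {1..k} \<Longrightarrow> U j = V j"
  shows "ar_comp s1 s2 a U k = ar_comp s1 s2 a V k"
  using assms by (induction k) auto

text \<open>All four branches have one shape: a fractional step \<open>posmul r U\<close> after
  \<open>n\<close> full steps of \<open>U\<close>, with \<open>U\<close> either \<open>T\<close> or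
  its inverse (on \<open>[-1,0)\<close> take \<open>r = -\<alpha>\<close>, \<open>n = 0\<close>).
  The pair \<open>r\<close>, \<open>n\<close> is chosen before \<open>T\<close>, so two maps can be
  compared in the same branch, and the bound on \<open>n\<close> makes later constants uniform in
  the coefficient.\<close>

lemma smult_cases:
  obtains (pos) r n where "0 \<le> r" "r \<le> 1" "n \<le> nat \<lfloor>\<bar>\<alpha>\<bar>\<rfloor>"
      "\<And>T. smult s1 s2 \<alpha> T = posmul r T \<circ> (T ^^ n)"
  | (neg) r n where "0 \<le> r" "r \<le> 1" "n \<le> nat \<lfloor>\<bar>\<alpha>\<bar>\<rfloor>"
      "\<And>T. smult s1 s2 \<alpha> T = posmul r (tinv s1 s2 T) \<circ> (tinv s1 s2 T ^^ n)"
proof -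
  have fr: "0 \<le> x - of_int \<lfloor>x\<rfloor>" "x - of_int \<lfloor>x\<rfloor> \<le> 1" for x :: real
    by linarith+
  consider "0 \<le> \<alpha>" "\<alpha> \<le> 1" | "-1 \<le> \<alpha>" "\<alpha> < 0" | "1 < \<alpha>" | "\<alpha> < -1"
    by linarith
  then show thesis
  proof cases
    case 1 then show ?thesis by (intro pos[of \<alpha> 0]) (auto simp: smult_def)
  next
    case 2 then show ?thesis
      by (intro neg[of "-\<alpha>" 0]) (auto simp: smult_def posmul_def fun_eq_iff algebra_simps)
  next
    case 3 then show ?thesis
      by (intro pos[of "\<alpha> - of_int \<lfloor>\<alpha>\<rfloor>" "nat \<lfloor>\<alpha>\<rfloor>"]) (use fr[of \<alpha>] in \<open>auto simp: smult_def\<close>)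
  next
    case 4 then show ?thesis
      by (intro neg[of "\<bar>\<alpha>\<bar> - of_int \<lfloor>\<bar>\<alpha>\<bar>\<rfloor>" "nat \<lfloor>\<bar>\<alpha>\<bar>\<rfloor>"])
        (use fr[of "\<bar>\<alpha>\<bar>"] in \<open>auto simp: smult_def\<close>)
  qed
qed

text \<open>Increasing homeomorphisms of the interval, extended by the identity. On this class
  \<open>tinv\<close> is a genuine two-sided inverse, so it is closed under every operation of the
  model, which \<open>Tset\<close> is not.\<close>

definition homeo :: "real \<Rightarrow> real \<Rightarrow> (real \<Rightarrow> real) set" where
  "homeo s1 s2 = {f \<in> Tset s1 s2. strict_mono_on {s1..s2} f \<and> continuous_on {s1..s2} f}"

lemma homeo_Tset: "f \<in> homeo s1 s2 \<Longrightarrow> f \<in> Tset s1 s2"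
  by (simp add: homeo_def)

lemma homeo_range: "f \<in> homeo s1 s2 \<Longrightarrow> x \<in> {s1..s2} \<Longrightarrow> f x \<in> {s1..s2}"
  using Tset_range homeo_Tset by blast

lemma homeo_image:
  assumes "f \<in> homeo s1 s2"
  shows "f ` {s1..s2} = {s1..s2}"
proof (intro equalityI subsetI)
  fix y assume y: "y \<in> {s1..s2}"
  then have "\<exists>x\<ge>s1. x \<le> s2 \<and> f x = y"
    using assms by (intro IVT') (auto simp: homeo_def Tset_def)
  then show "y \<in> f ` {s1..s2}" by auto
qed (use homeo_range[OF assms] in auto)

lemma homeo_id: "id \<in> homeo s1 s2"
  by (auto simp: homeo_def Tset_def mono_on_def strict_mono_on_def)

lemma homeo_comp:
  assumes f: "f \<in> homeo s1 s2" and g: "g \<in> homeo s1 s2"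
  shows "f \<circ> g \<in> homeo s1 s2"
proof -
  have "continuous_on {s1..s2} (f \<circ> g)"
    using f g homeo_image[OF g] by (intro continuous_on_compose) (auto simp: homeo_def)
  then show ?thesis
    using f g homeo_range[OF g]
    by (auto simp: homeo_def Tset_def mono_on_def strict_mono_on_def Ball_def)
qed

lemma homeo_funpow: "f \<in> homeo s1 s2 \<Longrightarrow> f ^^ n \<in> homeo s1 s2"
  by (induction n) (auto simp: homeo_id[unfolded id_def] id_def intro!: homeo_comp)

text \<open>\<open>posmul r f\<close> is the convex combination of \<open>id\<close> and
  \<open>f\<close> with weights \<open>1 - r\<close> and \<open>r\<close>. Both are strictly
  increasing, so whichever weight is positive supplies strictness; \<open>r = 0\<close> has to be
  treated apart.\<close>

lemma homeo_posmul:
  assumes "f \<in> homeo s1 s2" "0 \<le> r" "r \<le> 1"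
  shows "posmul r f \<in> homeo s1 s2"
proof -
  have eq: "posmul r f x = (1 - r) * x + r * f x" for x
    by (simp add: posmul_def algebra_simps)
  have less: "posmul r f x < posmul r f y" if "x \<in> {s1..s2}" "y \<in> {s1..s2}" "x < y" for x y
  proof -
    have "f x < f y" using assms(1) that by (auto simp: homeo_def strict_mono_on_def)
    then have "(1 - r) * x \<le> (1 - r) * y" "r \<noteq> 0 \<Longrightarrow> r * f x < r * f y"
      using assms that by (auto intro!: mult_left_mono)
    then show ?thesis unfolding eq using that by (cases "r = 0") auto
  qed
  have "continuous_on {s1..s2} (posmul r f)"
    using assms unfolding posmul_def by (auto simp: homeo_def intro!: continuous_intros)
  then show ?thesis
    using assms less by (auto simp: homeo_def Tset_def mono_on_def strict_mono_on_def posmul_def le_less)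
qed

lemma tinv_homeo_left:
  assumes f: "f \<in> homeo s1 s2" and x: "x \<in> {s1..s2}"
  shows "tinv s1 s2 f (f x) = x"
proof -
  have "{z. s1 \<le> z \<and> z \<le> s2 \<and> f x \<le> f z} = {x..s2}"
  proof (intro equalityI subsetI)
    fix z assume z: "z \<in> {z. s1 \<le> z \<and> z \<le> s2 \<and> f x \<le> f z}"
    have "\<not> z < x"
    proof
      assume "z < x"
      then have "f z < f x" using f x z by (auto simp: homeo_def strict_mono_on_def)
      with z show False by simp
    qed
    with z show "z \<in> {x..s2}" by auto
  next
    fix z assume "z \<in> {x..s2}"
    then show "z \<in> {z. s1 \<le> z \<and> z \<le> s2 \<and> f x \<le> f z}"
      using Tset_mono[OF homeo_Tset[OF f], of x z] x by auto
  qed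
  then show ?thesis
    using homeo_range[OF f x] x by (auto simp: tinv_def)
qed

lemma tinv_homeo_right:
  assumes f: "f \<in> homeo s1 s2" and y: "y \<in> {s1..s2}"
  shows "f (tinv s1 s2 f y) = y"
  using homeo_image[OF f] tinv_homeo_left[OF f] y by (metis imageE)

lemma homeo_tinv:
  assumes f: "f \<in> homeo s1 s2"
  shows "tinv s1 s2 f \<in> homeo s1 s2"
proof -
  let ?g = "tinv s1 s2 f"
  have inv: "?g (f x) = x" if "x \<in> {s1..s2}" for x
    using tinv_homeo_left[OF f that] .
  have cont: "continuous_on {s1..s2} ?g"
    using continuous_on_inv[of "{s1..s2}" f ?g] inv f homeo_image[OF f] by (auto simp: homeo_def)
  have rng: "?g y \<in> {s1..s2}" if "y \<in> {s1..s2}" for y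
    using that homeo_image[OF f] inv by (metis imageE)
  have less: "?g x < ?g y" if "x \<in> {s1..s2}" "y \<in> {s1..s2}" "x < y" for x y
  proof (rule ccontr)
    assume "\<not> ?g x < ?g y"
    then have "f (?g y) \<le> f (?g x)"
      using that rng by (intro Tset_mono[OF homeo_Tset[OF f]]) auto
    then show False using that tinv_homeo_right[OF f] by auto
  qed
  \<comment> \<open>The interval may be empty here; in that case \<open>tinv\<close> is the identity
    by definition, so the endpoints are fixed anyway.\<close>
  have s: "?g s1 = s1" "?g s2 = s2" if "s1 \<le> s2"
    using that inv[of s1] inv[of s2] homeo_Tset[OF f] by (auto simp: Tset_def)
  have "?g s1 = s1 \<and> ?g s2 = s2"
    using s by (cases "s1 \<le> s2") (auto simp: tinv_def)
  then show ?thesis using cont less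
    by (auto simp: homeo_def Tset_def mono_on_def strict_mono_on_def le_less tinv_def)
qed

lemma homeo_smult:
  assumes "f \<in> homeo s1 s2"
  shows "smult s1 s2 \<alpha> f \<in> homeo s1 s2"
  by (rule smult_cases[of \<alpha> s1 s2])
    (auto intro!: homeo_comp homeo_posmul homeo_funpow homeo_tinv assms)

lemma homeo_ar_comp:
  assumes "\<And>j. j \<in> {1..k} \<Longrightarrow> U j \<in> homeo s1 s2"
  shows "ar_comp s1 s2 a U k \<in> homeo s1 s2"
  using assms by (induction k) (auto simp: homeo_id oplus_def intro!: homeo_comp homeo_smult)

text \<open>The lower bound is stored as a Lipschitz bound on the inverse, so that positive and
  negative coefficients can be handled by one argument applied to \<open>f\<close> or to
  \<open>tinv s1 s2 f\<close>.\<close>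

definition bilip :: "real \<Rightarrow> real \<Rightarrow> real \<Rightarrow> (real \<Rightarrow> real) set" where
  "bilip s1 s2 K = {f \<in> homeo s1 s2. K-lipschitz_on {s1..s2} f \<and> K-lipschitz_on {s1..s2} (tinv s1 s2 f)}"

lemma bilip_homeo: "f \<in> bilip s1 s2 K \<Longrightarrow> f \<in> homeo s1 s2"
  by (simp add: bilip_def)

lemma bilipI:
  assumes f: "f \<in> Tset s1 s2" "strict_mono_on {s1..s2} f" and K: "0 \<le> K"
    and up: "\<And>x y. x \<in> {s1..s2} \<Longrightarrow> y \<in> {s1..s2} \<Longrightarrow> \<bar>f x - f y\<bar> \<le> K * \<bar>x - y\<bar>"
    and low: "\<And>x y. x \<in> {s1..s2} \<Longrightarrow> y \<in> {s1..s2} \<Longrightarrow> \<bar>x - y\<bar> \<le> K * \<bar>f x - f y\<bar>"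
  shows "f \<in> bilip s1 s2 K"
proof -
  have L: "K-lipschitz_on {s1..s2} f"
    using up K by (auto simp: lipschitz_on_def dist_real_def)
  have H: "f \<in> homeo s1 s2"
    using f lipschitz_on_continuous_on[OF L] by (simp add: homeo_def)
  have "K-lipschitz_on {s1..s2} (tinv s1 s2 f)"
  proof (rule lipschitz_onI[OF _ K])
    fix x y assume xy: "x \<in> {s1..s2}" "y \<in> {s1..s2}"
    then show "dist (tinv s1 s2 f x) (tinv s1 s2 f y) \<le> K * dist x y"
      using low[of "tinv s1 s2 f x" "tinv s1 s2 f y"] homeo_range[OF homeo_tinv[OF H]]
        tinv_homeo_right[OF H] by (auto simp: dist_real_def)
  qed
  with L H show ?thesis by (simp add: bilip_def)
qed

text \<open>Both endpoints are fixed, so the average slope is 1. The bound makes powers of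
  \<open>K\<close> increasing, which all later estimates use.\<close>

lemma bilip_ge_1:
  assumes "f \<in> bilip s1 s2 K" "s1 < s2"
  shows "1 \<le> K"
proof -
  have "dist (f s1) (f s2) \<le> K * dist s1 s2"
    using assms by (intro lipschitz_onD[of K "{s1..s2}" f]) (auto simp: bilip_def)
  moreover have "f s1 = s1" "f s2 = s2"
    using assms by (auto simp: bilip_def homeo_def Tset_def)
  ultimately show ?thesis using assms(2) by (simp add: dist_real_def)
qed

section \<open>Uniform closeness and its propagation through the operations\<close>

definition unif_near :: "real \<Rightarrow> real \<Rightarrow> real \<Rightarrow> (real \<Rightarrow> real) \<Rightarrow> (real \<Rightarrow> real) \<Rightarrow> bool" where
  "unif_near s1 s2 \<delta> f g \<longleftrightarrow> (\<forall>x\<in>{s1..s2}. \<bar>f x - g x\<bar> \<le> \<delta>)"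

lemma unif_nearD: "unif_near s1 s2 \<delta> f g \<Longrightarrow> x \<in> {s1..s2} \<Longrightarrow> \<bar>f x - g x\<bar> \<le> \<delta>"
  by (simp add: unif_near_def)

lemma unif_near_mono: "unif_near s1 s2 \<delta> f g \<Longrightarrow> \<delta> \<le> \<delta>' \<Longrightarrow> unif_near s1 s2 \<delta>' f g"
  by (force simp: unif_near_def)

lemma unif_near_refl: "0 \<le> \<delta> \<Longrightarrow> unif_near s1 s2 \<delta> f f"
  by (simp add: unif_near_def)

text \<open>Insert \<open>f \<circ> g'\<close> as intermediate map. Only the unprimed outer map
  needs a Lipschitz bound; the primed maps merely have to stay in the interval where stated.\<close>

lemma unif_near_comp:
  assumes L: "L-lipschitz_on {s1..s2} f" and n: "unif_near s1 s2 \<delta> f f'" "unif_near s1 s2 \<delta>' g g'"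
    and r: "\<And>x. x \<in> {s1..s2} \<Longrightarrow> g x \<in> {s1..s2}" "\<And>x. x \<in> {s1..s2} \<Longrightarrow> g' x \<in> {s1..s2}"
  shows "unif_near s1 s2 (L * \<delta>' + \<delta>) (f \<circ> g) (f' \<circ> g')"
  unfolding unif_near_def
proof
  fix x assume x: "x \<in> {s1..s2}"
  have "\<bar>f (g x) - f (g' x)\<bar> \<le> L * \<bar>g x - g' x\<bar>"
    using lipschitz_onD[OF L r(1)[OF x] r(2)[OF x]] by (simp add: dist_real_def)
  also have "\<dots> \<le> L * \<delta>'"
    using unif_nearD[OF n(2) x] lipschitz_on_nonneg[OF L] by (intro mult_left_mono)
  finally show "\<bar>(f \<circ> g) x - (f' \<circ> g') x\<bar> \<le> L * \<delta>' + \<delta>"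
    using unif_nearD[OF n(1) r(2)[OF x]] by simp
qed

lemma lipschitz_comp:
  assumes "L-lipschitz_on {s1..s2} f" "L'-lipschitz_on {s1..s2} g"
    and "g \<in> homeo s1 s2"
  shows "(L * L')-lipschitz_on {s1..s2} (f \<circ> g)"
proof -
  have "L-lipschitz_on (g ` {s1..s2}) f" using assms homeo_image by metis
  from lipschitz_on_compose[OF assms(2) this] show ?thesis .
qed

lemma lipschitz_posmul:
  assumes "K-lipschitz_on {s1..s2} f" "1 \<le> K" "0 \<le> r" "r \<le> 1"
  shows "K-lipschitz_on {s1..s2} (posmul r f)"
proof (rule lipschitz_onI)
  fix x y assume xy: "x \<in> {s1..s2}" "y \<in> {s1..s2}"
  have "\<bar>posmul r f x - posmul r f y\<bar> = \<bar>(1 - r) * (x - y) + r * (f x - f y)\<bar>"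
    by (simp add: posmul_def algebra_simps)
  also have "\<dots> \<le> (1 - r) * \<bar>x - y\<bar> + r * \<bar>f x - f y\<bar>"
    using assms by (metis abs_mult abs_of_nonneg abs_triangle_ineq diff_ge_0_iff_ge)
  also have "\<dots> \<le> (1 - r) * (K * \<bar>x - y\<bar>) + r * (K * \<bar>x - y\<bar>)"
  proof (intro add_mono mult_left_mono)
    show "\<bar>x - y\<bar> \<le> K * \<bar>x - y\<bar>" using assms(2) mult_right_mono[of 1 K "\<bar>x - y\<bar>"] by simp
    show "\<bar>f x - f y\<bar> \<le> K * \<bar>x - y\<bar>" using lipschitz_onD[OF assms(1) xy] by (simp add: dist_real_def)
  qed (use assms in auto)
  finally show "dist (posmul r f x) (posmul r f y) \<le> K * dist x y"
    by (simp add: dist_real_def algebra_simps)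
qed (use assms in auto)

lemma lipschitz_funpow:
  assumes "K-lipschitz_on {s1..s2} f" "f \<in> homeo s1 s2"
  shows "(K ^ n)-lipschitz_on {s1..s2} (f ^^ n)"
proof (induction n)
  case 0 then show ?case by (auto simp: lipschitz_on_def)
next
  case (Suc n)
  show ?case using lipschitz_comp[OF assms(1) Suc homeo_funpow[OF assms(2)]] by simp
qed

lemma unif_near_posmul:
  assumes "unif_near s1 s2 \<delta> f g" "0 \<le> r" "r \<le> 1"
  shows "unif_near s1 s2 \<delta> (posmul r f) (posmul r g)"
  unfolding unif_near_def
proof
  fix x assume x: "x \<in> {s1..s2}"
  have "\<bar>posmul r f x - posmul r g x\<bar> = r * \<bar>f x - g x\<bar>"
  proof -
    have "posmul r f x - posmul r g x = r * (f x - g x)" by (simp add: posmul_def algebra_simps)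
    then show ?thesis using assms by (simp add: abs_mult)
  qed
  also have "\<dots> \<le> 1 * \<bar>f x - g x\<bar>" using assms by (intro mult_right_mono) auto
  finally show "\<bar>posmul r f x - posmul r g x\<bar> \<le> \<delta>" using unif_nearD[OF assms(1) x] by simp
qed

lemma unif_near_funpow:
  assumes L: "K-lipschitz_on {s1..s2} f" "1 \<le> K" and h: "f \<in> homeo s1 s2" "g \<in> homeo s1 s2"
    and n: "unif_near s1 s2 \<delta> f g" "0 \<le> \<delta>"
  shows "unif_near s1 s2 (real n * K ^ n * \<delta>) (f ^^ n) (g ^^ n)"
proof (induction n)
  case 0 then show ?case by (auto simp: unif_near_def)
next
  case (Suc n)
  have "unif_near s1 s2 (K * (real n * K ^ n * \<delta>) + \<delta>) (f \<circ> f ^^ n) (g \<circ> g ^^ n)"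
    using homeo_range[OF homeo_funpow[OF h(1)]] homeo_range[OF homeo_funpow[OF h(2)]]
    by (intro unif_near_comp[OF L(1) n(1) Suc]) auto
  moreover have "\<delta> \<le> K ^ Suc n * \<delta>"
    using mult_right_mono[OF one_le_power[OF L(2), of "Suc n"] n(2)] by simp
  \<comment> \<open>The errors obey \<open>e(n+1) = K * e(n) + \<delta>\<close>; the new summand is
    enlarged to \<open>K ^ Suc n * \<delta>\<close> to keep the closed form.\<close>
  then have "K * (real n * K ^ n * \<delta>) + \<delta> \<le> real (Suc n) * K ^ Suc n * \<delta>"
    by (simp add: algebra_simps)
  ultimately show ?case unfolding funpow.simps by (rule unif_near_mono)
qed

text \<open>With \<open>z\<close> the \<open>g\<close>-preimage of \<open>y\<close>, write
  \<open>z\<close> as the \<open>f\<close>-preimage of \<open>f z\<close> and \<open>y\<close> as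
  \<open>g z\<close>. The two inverses then differ by at most \<open>K\<close> times the gap between
  \<open>f\<close> and \<open>g\<close> at the single point \<open>z\<close>, without any regularity
  of the inverse of \<open>g\<close>.\<close>

lemma unif_near_tinv:
  assumes f: "f \<in> bilip s1 s2 K" and g: "g \<in> homeo s1 s2" and n: "unif_near s1 s2 \<delta> f g"
  shows "unif_near s1 s2 (K * \<delta>) (tinv s1 s2 f) (tinv s1 s2 g)"
  unfolding unif_near_def
proof
  fix y assume y: "y \<in> {s1..s2}"
  let ?z = "tinv s1 s2 g y"
  have f': "f \<in> homeo s1 s2" using bilip_homeo[OF f] .
  have z: "?z \<in> {s1..s2}" using homeo_range[OF homeo_tinv[OF g] y] .
  have "\<bar>tinv s1 s2 f y - tinv s1 s2 f (f ?z)\<bar> \<le> K * \<bar>y - f ?z\<bar>"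
    using f y homeo_range[OF f' z] lipschitz_onD[of K "{s1..s2}" "tinv s1 s2 f" y "f ?z"]
    by (auto simp: bilip_def dist_real_def)
  also have "\<dots> \<le> K * \<delta>"
  proof (rule mult_left_mono)
    show "\<bar>y - f ?z\<bar> \<le> \<delta>" using unif_nearD[OF n z] tinv_homeo_right[OF g y] by auto
    show "0 \<le> K" using f lipschitz_on_nonneg by (auto simp: bilip_def)
  qed
  finally show "\<bar>tinv s1 s2 f y - ?z\<bar> \<le> K * \<delta>"
    using tinv_homeo_left[OF f' z] by simp
qed

text \<open>A common bound, over all \<open>\<bar>\<alpha>\<bar> \<le> c\<close>, for the Lipschitz constant of \<open>\<alpha> \<odot> T\<close> and for the
  sensitivity of \<open>\<alpha> \<odot> T\<close> to uniform perturbations of \<open>T\<close>.\<close>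

definition smult_const :: "real \<Rightarrow> real \<Rightarrow> real" where
  "smult_const K c = (real (nat \<lfloor>c\<rfloor>) + 1) * K ^ (nat \<lfloor>c\<rfloor> + 2)"

lemma smult_const_ge_1: "1 \<le> K \<Longrightarrow> 1 \<le> smult_const K c"
  unfolding smult_const_def using mult_mono[of 1 "real (nat \<lfloor>c\<rfloor>) + 1" 1 "K ^ (nat \<lfloor>c\<rfloor> + 2)"]
  by (simp add: one_le_power del: power_Suc)

lemma smult_lipschitz_near:
  assumes f: "f \<in> bilip s1 s2 K" and K: "1 \<le> K" and \<alpha>: "\<bar>\<alpha>\<bar> \<le> c"
  shows "(smult_const K c)-lipschitz_on {s1..s2} (smult s1 s2 \<alpha> f)"
    and "g \<in> homeo s1 s2 \<Longrightarrow> unif_near s1 s2 \<delta> f g \<Longrightarrow> 0 \<le> \<delta> \<Longrightarrow>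
      unif_near s1 s2 (smult_const K c * \<delta>) (smult s1 s2 \<alpha> f) (smult s1 s2 \<alpha> g)"
proof -
  let ?m = "nat \<lfloor>c\<rfloor>"
  have f': "f \<in> homeo s1 s2" "tinv s1 s2 f \<in> homeo s1 s2"
    using bilip_homeo[OF f] homeo_tinv by auto
  have Lf: "K-lipschitz_on {s1..s2} f" "K-lipschitz_on {s1..s2} (tinv s1 s2 f)"
    using f by (auto simp: bilip_def)
  have le_m: "n \<le> ?m" if "n \<le> nat \<lfloor>\<bar>\<alpha>\<bar>\<rfloor>" for n
    using that \<alpha> by (meson floor_mono le_trans nat_mono)
  have lip: "(smult_const K c)-lipschitz_on {s1..s2} (posmul r U \<circ> (U ^^ n))"
    if *: "0 \<le> r" "r \<le> 1" "n \<le> nat \<lfloor>\<bar>\<alpha>\<bar>\<rfloor>" and U: "K-lipschitz_on {s1..s2} U" "U \<in> homeo s1 s2" for r n U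
  proof -
    have "(K * K ^ n)-lipschitz_on {s1..s2} (posmul r U \<circ> (U ^^ n))"
      using * U K by (intro lipschitz_comp lipschitz_posmul lipschitz_funpow homeo_funpow)
    moreover have "K * K ^ n \<le> smult_const K c"
    proof -
      have "K * K ^ n \<le> K ^ (?m + 2)"
        using K le_m[OF *(3)] power_increasing[of "Suc n" "?m + 2" K] by simp
      also have "\<dots> \<le> smult_const K c"
        unfolding smult_const_def
        using mult_right_mono[of 1 "real ?m + 1" "K ^ (?m + 2)"] K by (simp del: power_Suc)
      finally show ?thesis .
    qed
    ultimately show ?thesis using lipschitz_on_le by blast
  qed
  show "(smult_const K c)-lipschitz_on {s1..s2} (smult s1 s2 \<alpha> f)"
    by (rule smult_cases[of \<alpha> s1 s2]) (simp_all only: lip Lf f')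
  assume g: "g \<in> homeo s1 s2" and n: "unif_near s1 s2 \<delta> f g" and \<delta>: "0 \<le> \<delta>"
  have main: "unif_near s1 s2 (smult_const K c * \<delta>) (posmul r U \<circ> (U ^^ n)) (posmul r V \<circ> (V ^^ n))"
    if *: "0 \<le> r" "r \<le> 1" "n \<le> nat \<lfloor>\<bar>\<alpha>\<bar>\<rfloor>" and U: "K-lipschitz_on {s1..s2} U" "U \<in> homeo s1 s2"
      and V: "V \<in> homeo s1 s2" and UV: "unif_near s1 s2 (K * \<delta>) U V" for r n U V
  proof -
    have K\<delta>: "0 \<le> K * \<delta>" using K \<delta> by simp
    have "unif_near s1 s2 (K * (real n * K ^ n * (K * \<delta>)) + K * \<delta>) (posmul r U \<circ> (U ^^ n)) (posmul r V \<circ> (V ^^ n))"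
      using * U V K K\<delta> UV homeo_range[OF homeo_funpow[OF U(2)]] homeo_range[OF homeo_funpow[OF V]]
      by (intro unif_near_comp lipschitz_posmul unif_near_posmul unif_near_funpow) auto
    moreover have "K * (real n * K ^ n * (K * \<delta>)) + K * \<delta> \<le> smult_const K c * \<delta>"
    proof -
      have a: "K ^ (n + 2) \<le> K ^ (?m + 2)" "K \<le> K ^ (?m + 2)"
        using K le_m[OF *(3)] power_increasing[of 1 "?m + 2" K] by (auto intro: power_increasing)
      \<comment> \<open>Origin of the exponent in \<open>smult_const\<close>: besides
        \<open>K ^ n\<close> from the full steps, one factor \<open>K\<close> comes from the outer
        fractional step and one from the closeness of the inverses. The isolated \<open>K\<close>
        accounts for the extra 1 in the first factor.\<close>
      have "real n * K ^ (n + 2) + K \<le> real ?m * K ^ (?m + 2) + K ^ (?m + 2)"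
        using a le_m[OF *(3)] K by (intro add_mono mult_mono) auto
      then have "(real n * K ^ (n + 2) + K) * \<delta> \<le> smult_const K c * \<delta>"
        using \<delta> by (intro mult_right_mono) (auto simp: smult_const_def algebra_simps)
      then show ?thesis by (simp add: algebra_simps)
    qed
    ultimately show ?thesis by (rule unif_near_mono)
  qed
  \<comment> \<open>Weakened from \<open>\<delta>\<close> to \<open>K * \<delta>\<close> so that
    \<open>main\<close> covers the maps and their inverses with the same error.\<close>
  have n1: "unif_near s1 s2 (K * \<delta>) f g"
    using unif_near_mono[OF n] mult_right_mono[OF K \<delta>] by simp
  have n2: "unif_near s1 s2 (K * \<delta>) (tinv s1 s2 f) (tinv s1 s2 g)"
    using unif_near_tinv[OF f g n] .
  show "unif_near s1 s2 (smult_const K c * \<delta>) (smult s1 s2 \<alpha> f) (smult s1 s2 \<alpha> g)"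
    by (rule smult_cases[of \<alpha> s1 s2])
      (simp_all only: main Lf f' g n1 n2 homeo_tinv)
qed

text \<open>The recursion puts the composite of the first \<open>k\<close> factors outside the new
  one, so its Lipschitz constant is needed to carry the new error outward; hence the joint
  induction. Coefficients and maps may both change: one application perturbs the maps, another the
  coefficients.\<close>

lemma ar_comp_near:
  assumes L: "\<And>j. j \<in> {1..k} \<Longrightarrow> L-lipschitz_on {s1..s2} (smult s1 s2 (a j) (U j))" "1 \<le> L"
    and h: "\<And>j. j \<in> {1..k} \<Longrightarrow> U j \<in> homeo s1 s2" "\<And>j. j \<in> {1..k} \<Longrightarrow> V j \<in> homeo s1 s2"
    and n: "\<And>j. j \<in> {1..k} \<Longrightarrow> unif_near s1 s2 \<delta> (smult s1 s2 (a j) (U j)) (smult s1 s2 (b j) (V j))" "0 \<le> \<delta>"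
  shows "unif_near s1 s2 (real k * L ^ k * \<delta>) (ar_comp s1 s2 a U k) (ar_comp s1 s2 b V k)
    \<and> (L ^ k)-lipschitz_on {s1..s2} (ar_comp s1 s2 a U k)"
  using L(1) h n(1)
proof (induction k)
  case 0 then show ?case by (auto simp: unif_near_def lipschitz_on_def)
next
  case (Suc k)
  have IH: "unif_near s1 s2 (real k * L ^ k * \<delta>) (ar_comp s1 s2 a U k) (ar_comp s1 s2 b V k)"
    "(L ^ k)-lipschitz_on {s1..s2} (ar_comp s1 s2 a U k)"
    using Suc by auto
  have hs: "smult s1 s2 (a (Suc k)) (U (Suc k)) \<in> homeo s1 s2" "smult s1 s2 (b (Suc k)) (V (Suc k)) \<in> homeo s1 s2"
    using Suc by (auto intro!: homeo_smult)
  have "unif_near s1 s2 (L ^ k * \<delta> + real k * L ^ k * \<delta>) (ar_comp s1 s2 a U (Suc k)) (ar_comp s1 s2 b V (Suc k))"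
    unfolding ar_comp.simps oplus_def
    using homeo_range[OF hs(1)] homeo_range[OF hs(2)] Suc.prems
    by (intro unif_near_comp[OF IH(2,1)]) auto
  moreover have "L ^ k * \<delta> + real k * L ^ k * \<delta> \<le> real (Suc k) * L ^ Suc k * \<delta>"
  proof -
    have "real (Suc k) * (L ^ k * \<delta>) \<le> real (Suc k) * (L ^ Suc k * \<delta>)"
      using L(2) n(2) by (intro mult_left_mono mult_right_mono power_increasing) auto
    then show ?thesis by (simp add: algebra_simps)
  qed
  moreover have "(L ^ k * L)-lipschitz_on {s1..s2} (ar_comp s1 s2 a U (Suc k))"
    unfolding ar_comp.simps oplus_def
    using Suc.prems hs by (intro lipschitz_comp[OF IH(2)]) auto
  ultimately show ?case by (auto intro: unif_near_mono simp: mult.commute)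
qed

text \<open>The curve \<open>\<alpha> \<mapsto> \<alpha> \<odot> T(x)\<close> interpolates linearly between consecutive points of the orbit of \<open>x\<close>
  under \<open>T\<close> and \<open>T\<^sup>-\<^sup>1\<close>.\<close>

definition orbit_interp :: "nat \<Rightarrow> real \<Rightarrow> (real \<Rightarrow> real) \<Rightarrow> real \<Rightarrow> real" where
  "orbit_interp m t U x = (\<Sum>k<m. max 0 (min 1 (t - real k)) * ((U ^^ Suc k) x - (U ^^ k) x))"

lemma orbit_interp_nonpos: "t \<le> 0 \<Longrightarrow> orbit_interp m t U x = 0"
  by (auto simp: orbit_interp_def)

text \<open>At \<open>t = n + r\<close> the clamped weights are 1 below \<open>n\<close>,
  \<open>r\<close> at \<open>n\<close> and 0 above, so the sum telescopes to the \<open>n\<close>-th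
  orbit point plus a fraction \<open>r\<close> of the next increment.\<close>

lemma orbit_interp_eq:
  assumes "0 \<le> r" "r \<le> 1" "n < m"
  shows "x + orbit_interp m (real n + r) U x = (posmul r U \<circ> (U ^^ n)) x"
proof -
  let ?f = "\<lambda>k. max 0 (min 1 (real n + r - real k)) * ((U ^^ Suc k) x - (U ^^ k) x)"
  have split: "{..<m} = {..<n} \<union> {n} \<union> {n<..<m}" using assms(3) by auto
  have "sum ?f {..<m} = sum ?f {..<n} + ?f n + sum ?f {n<..<m}"
    unfolding split by (subst sum.union_disjoint, simp, simp, force, subst sum.union_disjoint) auto
  also have "sum ?f {n<..<m} = 0"
    using assms by (intro sum.neutral) auto
  also have "sum ?f {..<n} = (\<Sum>k<n. (U ^^ Suc k) x - (U ^^ k) x)"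
    using assms by (intro sum.cong) auto
  also have "\<dots> = (U ^^ n) x - x"
    by (subst sum_lessThan_telescope) simp
  also have "?f n = r * ((U ^^ Suc n) x - (U ^^ n) x)" using assms by simp
  finally show ?thesis by (simp add: orbit_interp_def posmul_def)
qed

text \<open>One formula for all branches, so that continuity across integer coefficients and across
  0 needs no gluing. Whichever of the two orbits has the wrong sign contributes nothing;
  \<open>m\<close> only has to exceed the number of full steps.\<close>

lemma smult_orbit_interp:
  assumes "\<bar>\<alpha>\<bar> \<le> c" "nat \<lfloor>c\<rfloor> < m"
  shows "smult s1 s2 \<alpha> T x = x + orbit_interp m \<alpha> T x + orbit_interp m (-\<alpha>) (tinv s1 s2 T) x"
proof -
  have fr: "0 \<le> x - of_int \<lfloor>x\<rfloor>" "x - of_int \<lfloor>x\<rfloor> \<le> 1" for x :: real by linarith+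
  have fl: "nat \<lfloor>\<alpha>\<rfloor> < m" "nat \<lfloor>\<bar>\<alpha>\<bar>\<rfloor> < m"
    using assms by (meson abs_le_iff floor_mono le_less_trans nat_mono abs_ge_self order_trans)+
  consider "0 \<le> \<alpha>" "\<alpha> \<le> 1" | "-1 \<le> \<alpha>" "\<alpha> < 0" | "1 < \<alpha>" | "\<alpha> < -1"
    by linarith
  then show ?thesis
  proof cases
    case 1 then show ?thesis
      using orbit_interp_eq[of \<alpha> 0 m x T] fl by (simp add: orbit_interp_nonpos smult_def)
  next
    case 2
    have "0 < m" using assms(2) by simp
    with 2 show ?thesis
      using orbit_interp_eq[of "-\<alpha>" 0 m x "tinv s1 s2 T"] by (simp add: orbit_interp_nonpos smult_def posmul_def algebra_simps)
  next
    case 3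
    then have "real (nat \<lfloor>\<alpha>\<rfloor>) + (\<alpha> - of_int \<lfloor>\<alpha>\<rfloor>) = \<alpha>" by simp
    with 3 show ?thesis
      using orbit_interp_eq[OF fr[of \<alpha>] fl(1), of x T] by (simp add: orbit_interp_nonpos smult_def)
  next
    case 4
    then have "real (nat \<lfloor>\<bar>\<alpha>\<bar>\<rfloor>) + (\<bar>\<alpha>\<bar> - of_int \<lfloor>\<bar>\<alpha>\<bar>\<rfloor>) = -\<alpha>" by simp
    with 4 show ?thesis
      using orbit_interp_eq[OF fr[of "\<bar>\<alpha>\<bar>"] fl(2), of x "tinv s1 s2 T"]
      by (simp add: orbit_interp_nonpos smult_def)
  qed
qed

lemma orbit_interp_lipschitz:
  assumes U: "U \<in> homeo s1 s2" and x: "x \<in> {s1..s2}"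
  shows "\<bar>orbit_interp m t U x - orbit_interp m t' U x\<bar> \<le> real m * (s2 - s1) * \<bar>t - t'\<bar>"
proof -
  let ?d = "\<lambda>k. (U ^^ Suc k) x - (U ^^ k) x" and ?w = "\<lambda>t k. max 0 (min 1 (t - real k))"
  have "\<bar>orbit_interp m t U x - orbit_interp m t' U x\<bar> = \<bar>\<Sum>k<m. (?w t k - ?w t' k) * ?d k\<bar>"
    by (simp add: orbit_interp_def sum_subtractf left_diff_distrib)
  also have "\<dots> \<le> (\<Sum>k<m. \<bar>t - t'\<bar> * (s2 - s1))"
  proof (rule order_trans[OF sum_abs], rule sum_mono)
    fix k
    have "\<bar>?d k\<bar> \<le> s2 - s1"
      using homeo_range[OF homeo_funpow[OF U, of "Suc k"] x] homeo_range[OF homeo_funpow[OF U, of k] x]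
      by auto
    then show "\<bar>(?w t k - ?w t' k) * ?d k\<bar> \<le> \<bar>t - t'\<bar> * (s2 - s1)"
      unfolding abs_mult by (intro mult_mono) auto
  qed
  also have "\<dots> = real m * (s2 - s1) * \<bar>t - t'\<bar>" by simp
  finally show ?thesis .
qed

text \<open>The constant counts the forward and the backward orbit (factor 2), at most
  \<open>nat \<lfloor>c\<rfloor> + 1\<close> segments in each, and a length of at most
  \<open>s2 - s1\<close> per segment.\<close>

lemma smult_near_coeff:
  assumes T: "T \<in> homeo s1 s2" and \<alpha>: "\<bar>\<alpha>\<bar> \<le> c" "\<bar>\<beta>\<bar> \<le> c"
  shows "unif_near s1 s2 (2 * (real (nat \<lfloor>c\<rfloor>) + 1) * (s2 - s1) * \<bar>\<alpha> - \<beta>\<bar>) (smult s1 s2 \<alpha> T) (smult s1 s2 \<beta> T)"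
  unfolding unif_near_def
proof
  fix x assume x: "x \<in> {s1..s2}"
  let ?m = "Suc (nat \<lfloor>c\<rfloor>)"
  define E where "E = real ?m * (s2 - s1) * \<bar>\<alpha> - \<beta>\<bar>"
  have "\<bar>orbit_interp ?m \<alpha> T x - orbit_interp ?m \<beta> T x\<bar> \<le> E"
    "\<bar>orbit_interp ?m (-\<alpha>) (tinv s1 s2 T) x - orbit_interp ?m (-\<beta>) (tinv s1 s2 T) x\<bar> \<le> E"
    using orbit_interp_lipschitz[OF T x, of ?m \<alpha> \<beta>]
      orbit_interp_lipschitz[OF homeo_tinv[OF T] x, of ?m "-\<alpha>" "-\<beta>"]
    by (auto simp: abs_minus_commute E_def)
  then have "\<bar>smult s1 s2 \<alpha> T x - smult s1 s2 \<beta> T x\<bar> \<le> 2 * E"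
    using smult_orbit_interp[OF \<alpha>(1), of ?m s1 s2 T x] smult_orbit_interp[OF \<alpha>(2), of ?m s1 s2 T x]
    by linarith
  then show "\<bar>smult s1 s2 \<alpha> T x - smult s1 s2 \<beta> T x\<bar> \<le> 2 * (real (nat \<lfloor>c\<rfloor>) + 1) * (s2 - s1) * \<bar>\<alpha> - \<beta>\<bar>"
    by (simp add: E_def algebra_simps)
qed

section \<open>Integrals over the interval and the metric \<open>d1\<close>\<close>

lemma Tset_borel:
  assumes "T \<in> Tset s1 s2"
  shows "T \<in> borel_measurable borel"
proof (rule borel_measurable_mono, rule monoI)
  fix x y :: real assume "x \<le> y"
  moreover have "T z \<in> {s1..s2}" if "z \<in> {s1..s2}" for z using Tset_range[OF assms that] .
  ultimately show "T x \<le> T y"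
    using Tset_mono[OF assms, of x y] Tset_outside[OF assms, of x] Tset_outside[OF assms, of y]
    by (cases "x \<in> {s1..s2}"; cases "y \<in> {s1..s2}") force+
qed

lemma set_integrable_bounded_Icc:
  fixes f :: "real \<Rightarrow> real"
  assumes "f \<in> borel_measurable borel" "\<And>x. x \<in> {s1..s2} \<Longrightarrow> \<bar>f x\<bar> \<le> B"
  shows "set_integrable lborel {s1..s2} f"
  unfolding set_integrable_def
  by (rule integrableI_bounded_set_indicator[where B = B])
    (use assms in \<open>auto simp: emeasure_lborel_Icc_eq\<close>)

lemma set_integral_const_Icc:
  fixes s1 s2 b :: real
  assumes "s1 \<le> s2"
  shows "(LINT x:{s1..s2}|lborel. b) = b * (s2 - s1)"
  using assms by (simp add: set_lebesgue_integral_def mult.commute)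

lemma set_integral_abs_le_Icc:
  fixes f :: "real \<Rightarrow> real"
  assumes "s1 \<le> s2" "f \<in> borel_measurable borel" "\<And>x. x \<in> {s1..s2} \<Longrightarrow> \<bar>f x\<bar> \<le> B"
  shows "\<bar>LINT x:{s1..s2}|lborel. f x\<bar> \<le> B * (s2 - s1)"
proof -
  have i: "set_integrable lborel {s1..s2} f"
    using assms by (intro set_integrable_bounded_Icc)
  have c: "set_integrable lborel {s1..s2} (\<lambda>x. B)" "set_integrable lborel {s1..s2} (\<lambda>x. -B)"
    by (auto intro!: set_integrable_bounded_Icc)
  have "(LINT x:{s1..s2}|lborel. f x) \<le> (LINT x:{s1..s2}|lborel. B)"
    "(LINT x:{s1..s2}|lborel. -B) \<le> (LINT x:{s1..s2}|lborel. f x)"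
    using i c assms(3) by (auto intro!: set_integral_mono simp: abs_le_iff minus_le_iff)
  then show ?thesis unfolding set_integral_const_Icc[OF assms(1)] by (simp add: abs_le_iff)
qed

lemma d1_nonneg: "0 \<le> d1 s1 s2 f g"
  by (auto simp: d1_def set_lebesgue_integral_def intro!: integral_nonneg)

lemma d1_le:
  assumes "f \<in> Tset s1 s2" "g \<in> Tset s1 s2" "s1 \<le> s2"
  shows "d1 s1 s2 f g \<le> (s2 - s1)\<^sup>2"
proof -
  have "\<bar>f x - g x\<bar> \<le> s2 - s1" if "x \<in> {s1..s2}" for x
    using Tset_range[OF assms(1) that] Tset_range[OF assms(2) that] by auto
  then have "\<bar>LINT x:{s1..s2}|lborel. \<bar>f x - g x\<bar>\<bar> \<le> (s2 - s1) * (s2 - s1)"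
    using assms Tset_borel by (intro set_integral_abs_le_Icc) auto
  then show ?thesis by (simp add: d1_def power2_eq_square)
qed

text \<open>An \<open>L\<^sup>1\<close>-small perturbation of a Lipschitz map within the monotone maps is uniformly small:
  a gap of \<open>\<tau>\<close> at one point persists, at size \<open>\<tau> / 2\<close>, over an interval of length \<open>\<tau> / (2 K)\<close>.\<close>

lemma d1_small_imp_unif_near:
  assumes s: "s1 \<le> s2" and f: "f \<in> Tset s1 s2" "K-lipschitz_on {s1..s2} f" "0 < K" and g: "g \<in> Tset s1 s2"
    and \<tau>: "0 < \<tau>" and small: "d1 s1 s2 f g < \<tau>\<^sup>2 / (4 * K)"
  shows "unif_near s1 s2 \<tau> f g"
proof (rule ccontr)
  assume "\<not> unif_near s1 s2 \<tau> f g"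
  then obtain x0 where x0: "x0 \<in> {s1..s2}" and gap: "\<tau> < \<bar>f x0 - g x0\<bar>"
    by (auto simp: unif_near_def not_le)
  \<comment> \<open>Over a distance \<open>h\<close> the map \<open>f\<close> moves by at most half
    of the gap.\<close>
  define h where "h = \<tau> / (2 * K)"
  have h: "0 < h" "K * h = \<tau> / 2" using \<tau> f(3) by (auto simp: h_def)
  have lip: "\<bar>f x - f y\<bar> \<le> K * \<bar>x - y\<bar>" if "x \<in> {s1..s2}" "y \<in> {s1..s2}" for x y
    using lipschitz_onD[OF f(2) that] by (simp add: dist_real_def)
  have close: "\<bar>f x - f y\<bar> \<le> \<tau> / 2" if "x \<in> {s1..s2}" "y \<in> {s1..s2}" "\<bar>x - y\<bar> \<le> h" for x y
    using lip[OF that(1,2)] mult_left_mono[OF that(3), of K] f(3) h(2) by linarith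
  have far: "h < \<bar>x - y\<bar>" if "x \<in> {s1..s2}" "y \<in> {s1..s2}" "\<tau> / 2 < \<bar>f x - f y\<bar>" for x y
    using close[OF that(1,2)] that(3) by linarith
  have ends: "f s1 = s1" "f s2 = s2" using f by (auto simp: Tset_def)
  have gr: "g x0 \<in> {s1..s2}" using Tset_range[OF g x0] .
  have "\<exists>u. {u..u + h} \<subseteq> {s1..s2} \<and> (\<forall>x\<in>{u..u + h}. \<tau> / 2 \<le> \<bar>f x - g x\<bar>)"
  proof (cases "f x0 < g x0")
    case True
    \<comment> \<open>There is room to the right:
      \<open>f x0 < g x0 - \<tau> \<le> s2 - \<tau>\<close>, so \<open>f\<close> still has to climb
      by more than \<open>\<tau> / 2\<close> before reaching \<open>s2\<close>. The other case looks
      left, towards \<open>s1\<close>.\<close>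
    have "h < \<bar>s2 - x0\<bar>" using far[of s2 x0] gap True gr x0 ends \<tau> by auto
    then have sub: "{x0..x0 + h} \<subseteq> {s1..s2}" using x0 by auto
    moreover have "\<tau> / 2 \<le> \<bar>f x - g x\<bar>" if "x \<in> {x0..x0 + h}" for x
    proof -
      have x: "x \<in> {s1..s2}" using sub that by blast
      have "g x0 \<le> g x" using Tset_mono[OF g x0 x] that by simp
      moreover have "\<bar>f x - f x0\<bar> \<le> \<tau> / 2" using close[OF x x0] that by auto
      ultimately show ?thesis using gap True by linarith
    qed
    ultimately show ?thesis by blast
  next
    case False
    have "h < \<bar>x0 - s1\<bar>" using far[of x0 s1] gap False gr x0 ends \<tau> by auto
    then have sub: "{x0 - h..x0} \<subseteq> {s1..s2}" using x0 by auto
    moreover have "\<tau> / 2 \<le> \<bar>f x - g x\<bar>" if "x \<in> {x0 - h..x0}" for x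
    proof -
      have x: "x \<in> {s1..s2}" using sub that by blast
      have "g x \<le> g x0" using Tset_mono[OF g x x0] that by simp
      moreover have "\<bar>f x - f x0\<bar> \<le> \<tau> / 2" using close[OF x x0] that by auto
      ultimately show ?thesis using gap False by linarith
    qed
    ultimately show ?thesis by (intro exI[of _ "x0 - h"]) auto
  qed
  then obtain u where u: "{u..u + h} \<subseteq> {s1..s2}" "\<And>x. x \<in> {u..u + h} \<Longrightarrow> \<tau> / 2 \<le> \<bar>f x - g x\<bar>"
    by blast
  \<comment> \<open>The threshold in the hypothesis is precisely width \<open>h\<close> times height
    \<open>\<tau> / 2\<close>.\<close>
  have "\<tau>\<^sup>2 / (4 * K) = (LINT x:{u..u + h}|lborel. \<tau> / 2)"
    using h by (subst set_integral_const_Icc) (auto simp: h_def power2_eq_square field_simps)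
  also have "\<dots> \<le> d1 s1 s2 f g"
    unfolding d1_def set_lebesgue_integral_def
  proof (rule integral_mono)
    have "\<bar>\<bar>f x - g x\<bar>\<bar> \<le> s2 - s1" if "x \<in> {s1..s2}" for x
      using Tset_range[OF f(1) that] Tset_range[OF g that] by auto
    then show "integrable lborel (\<lambda>x. indicator {s1..s2} x *\<^sub>R \<bar>f x - g x\<bar>)"
      using Tset_borel f g set_integrable_bounded_Icc[of "\<lambda>x. \<bar>f x - g x\<bar>" s1 s2 "s2 - s1"]
      by (auto simp: set_integrable_def)
    show "integrable lborel (\<lambda>x. indicator {u..u + h} x *\<^sub>R (\<tau> / 2))"
      using set_integrable_bounded_Icc[of "\<lambda>x. \<tau> / 2" u "u + h" "\<bar>\<tau>\<bar>"] unfolding set_integrable_def by simp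
    show "indicator {u..u + h} x *\<^sub>R (\<tau> / 2) \<le> indicator {s1..s2} x *\<^sub>R \<bar>f x - g x\<bar>" for x
      using u by (auto simp: indicator_def)
  qed
  finally show False using small by simp
qed

section \<open>Measurability of random maps\<close>

text \<open>The countable family \<open>J\<close> of measurable selectors finds, below any bound
  that some element of \<open>A w\<close> respects, another element of \<open>A w\<close>. The
  sublevel sets of the infimum thereby become countable unions.\<close>

lemma borel_measurable_Inf_detect:
  fixes A :: "'a \<Rightarrow> real set" and J :: "('a \<Rightarrow> real) set"
  assumes J: "countable J" "J \<subseteq> borel_measurable N"
    and hit: "\<And>d. d \<in> J \<Longrightarrow> {w \<in> space N. d w \<in> A w} \<in> sets N"
    and bdd: "\<And>w. w \<in> space N \<Longrightarrow> bdd_below (A w)"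
    and det: "\<And>w x a. w \<in> space N \<Longrightarrow> x \<in> A w \<Longrightarrow> x < a \<Longrightarrow> \<exists>d\<in>J. d w \<in> A w \<and> d w < a"
  shows "(\<lambda>w. Inf (A w)) \<in> borel_measurable N"
    and "{w \<in> space N. A w \<noteq> {}} \<in> sets N"
proof -
  have ne: "{w \<in> space N. A w \<noteq> {}} = (\<Union>d\<in>J. {w \<in> space N. d w \<in> A w})"
  proof (intro equalityI subsetI)
    fix w assume "w \<in> {w \<in> space N. A w \<noteq> {}}"
    then obtain x where "w \<in> space N" "x \<in> A w" by auto
    then show "w \<in> (\<Union>d\<in>J. {w \<in> space N. d w \<in> A w})"
      using det[of w x "x + 1"] by auto
  qed auto
  then show ne_meas: "{w \<in> space N. A w \<noteq> {}} \<in> sets N"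
    using J hit by (auto intro!: sets.countable_UN'')
  show "(\<lambda>w. Inf (A w)) \<in> borel_measurable N"
    unfolding borel_measurable_iff_less
  proof
    fix a :: real
    \<comment> \<open>An empty \<open>A w\<close> is compared with \<open>a\<close> through the
      fixed, unspecified value \<open>Inf {}\<close>, so it forms a separate measurable
      piece.\<close>
    have eq: "{w \<in> space N. Inf (A w) < a} =
        (\<Union>d\<in>J. {w \<in> space N. d w \<in> A w} \<inter> {w \<in> space N. d w < a}) \<union>
        ((space N - {w \<in> space N. A w \<noteq> {}}) \<inter> {w \<in> space N. Inf ({}::real set) < a})"
      (is "?L = ?R")
    proof (intro equalityI subsetI)
      fix w assume w: "w \<in> ?L"
      show "w \<in> ?R"
      proof (cases "A w = {}")
        case False
        then obtain x where "x \<in> A w" "x < a" using w bdd[of w] by (auto simp: cInf_less_iff)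
        then show ?thesis using det[of w x a] w by auto
      qed (use w in auto)
    next
      fix w assume "w \<in> ?R"
      then show "w \<in> ?L" using bdd[of w] by (auto intro: le_less_trans[OF cInf_lower])
    qed
    have "{w \<in> space N. d w < a} \<in> sets N" if "d \<in> J" for d
    proof -
      have "d \<in> borel_measurable N" using J that by blast
      then show ?thesis by (simp add: borel_measurable_iff_less)
    qed
    then show "{w \<in> space N. Inf (A w) < a} \<in> sets N"
      unfolding eq using J hit ne_meas
      by (intro sets.Un sets.countable_UN'' sets.Int sets.compl_sets) auto
  qed
qed

text \<open>Points of \<open>B\<close> carry no constraint and jumps of either sign across them are
  allowed. Downward jumps do occur, since an empty infimum falls to an unknown value.\<close>

definition mono_between :: "real set \<Rightarrow> (real \<Rightarrow> real) \<Rightarrow> bool" where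
  "mono_between B f \<longleftrightarrow> (\<forall>x y. x < y \<longrightarrow> (\<forall>t\<in>B. t \<notin> {x..y}) \<longrightarrow> f x \<le> f y)"

lemma mono_betweenD: "mono_between B f \<Longrightarrow> x \<le> y \<Longrightarrow> (\<And>t. t \<in> B \<Longrightarrow> t \<notin> {x..y}) \<Longrightarrow> f x \<le> f y"
  unfolding mono_between_def by (cases "x = y") force+

lemma mono_between_subset: "mono_between B f \<Longrightarrow> B \<subseteq> B' \<Longrightarrow> mono_between B' f"
  unfolding mono_between_def by blast

text \<open>If \<open>z\<close> is no breakpoint, finiteness leaves a gap to the right of
  \<open>z\<close> before the next breakpoint and before \<open>a\<close>; any rational in this gap
  lies on the same monotone piece.\<close>

lemma mono_between_detect:
  assumes "mono_between B f" "finite B" "z < a"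
  shows "z \<in> B \<or> (\<exists>q. z < of_rat q \<and> of_rat q < a \<and> f z \<le> f (of_rat q))"
proof (cases "z \<in> B")
  case False
  define b where "b = Min (insert a {t\<in>B. z < t})"
  have b: "z < b" "b \<le> a" "\<And>t. t \<in> B \<Longrightarrow> z < t \<Longrightarrow> b \<le> t"
    unfolding b_def using assms by auto
  obtain q where q: "z < of_rat q" "of_rat q < b" using of_rat_dense[OF b(1)] by blast
  have "f z \<le> f (of_rat q)"
  proof (rule mono_betweenD[OF assms(1)])
    fix t assume "t \<in> B"
    then show "t \<notin> {z..of_rat q}" using b(3)[of t] q False by (cases "z < t") auto
  qed (use q in simp)
  with q b show ?thesis by fastforce
qed simp

text \<open>Random maps that increase between finitely many measurable breakpoints.  The generalised inverse
  of a map in \<open>\<T>\<close> that attains \<open>s2\<close> early lies outside \<open>\<T>\<close>, and its own generalised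
  inverse takes the unspecified value \<open>Inf {}\<close> near \<open>s2\<close>; so iterates of \<open>\<Upsilon>\<close> started anywhere in
  \<open>\<T>\<^sup>p\<close> need not be monotone.  This class is nevertheless closed under all operations involved, and the
  breakpoints together with the rationals reduce each infimum to a countable one.\<close>

definition pw_mono_map :: "real \<Rightarrow> real \<Rightarrow> 'a measure \<Rightarrow> ('a \<Rightarrow> real \<Rightarrow> real) \<Rightarrow> bool" where
  "pw_mono_map s1 s2 N X \<longleftrightarrow>
     (\<lambda>z. X (fst z) (snd z)) \<in> borel_measurable (N \<Otimes>\<^sub>M borel) \<and>
     (\<forall>w\<in>space N. \<forall>x. x \<notin> {s1..s2} \<longrightarrow> X w x = x) \<and>
     (\<exists>B. \<forall>w\<in>space N. \<forall>x. \<bar>X w x\<bar> \<le> max B \<bar>x\<bar>) \<and>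
     (\<exists>\<Theta>. finite \<Theta> \<and> \<Theta> \<subseteq> borel_measurable N \<and> (\<forall>w\<in>space N. mono_between ((\<lambda>t. t w) ` \<Theta>) (X w)))"

lemma pw_mono_map_measurable:
  "pw_mono_map s1 s2 N X \<Longrightarrow> (\<lambda>z. X (fst z) (snd z)) \<in> borel_measurable (N \<Otimes>\<^sub>M borel)"
  by (simp add: pw_mono_map_def)

lemma pw_mono_map_outside:
  "pw_mono_map s1 s2 N X \<Longrightarrow> w \<in> space N \<Longrightarrow> x \<notin> {s1..s2} \<Longrightarrow> X w x = x"
  by (simp add: pw_mono_map_def)

lemma pw_mono_map_apply:
  assumes X: "pw_mono_map s1 s2 N X" and g: "g \<in> measurable L N" and h: "h \<in> borel_measurable L"
  shows "(\<lambda>z. X (g z) (h z)) \<in> borel_measurable L"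
  using measurable_compose[OF measurable_Pair[OF g h] pw_mono_map_measurable[OF X]] by simp

lemma pw_mono_map_apply_id:
  assumes X: "pw_mono_map s1 s2 N X" and h: "h \<in> borel_measurable N"
  shows "(\<lambda>z. X z (h z)) \<in> borel_measurable N"
  using pw_mono_map_apply[OF X measurable_ident h] by simp

lemma pw_mono_map_breakpoints:
  assumes "pw_mono_map s1 s2 N X"
  obtains \<Theta> where "finite \<Theta>" "\<Theta> \<subseteq> borel_measurable N"
    "(\<lambda>_. s1) \<in> \<Theta>" "(\<lambda>_. s2) \<in> \<Theta>"
    "\<And>w. w \<in> space N \<Longrightarrow> mono_between ((\<lambda>t. t w) ` \<Theta>) (X w)"
proof -
  obtain \<Theta> where T: "finite \<Theta>" "\<Theta> \<subseteq> borel_measurable N"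
    "\<And>w. w \<in> space N \<Longrightarrow> mono_between ((\<lambda>t. t w) ` \<Theta>) (X w)"
    using assms unfolding pw_mono_map_def by blast
  show thesis
    by (rule that[of "insert (\<lambda>_. s1) (insert (\<lambda>_. s2) \<Theta>)"])
      (use T in \<open>auto intro: mono_between_subset\<close>)
qed

text \<open>The shape \<open>max B \<bar>x\<bar>\<close> survives composition. It replaces the range
  condition of \<open>Tset\<close>, which may fail after an empty infimum, and later gives
  integrability of the iterates started at \<open>S0\<close>.\<close>

lemma pw_mono_map_bound:
  assumes "pw_mono_map s1 s2 N X"
  obtains B where "\<And>w x. w \<in> space N \<Longrightarrow> \<bar>X w x\<bar> \<le> max B \<bar>x\<bar>"
  using assms unfolding pw_mono_map_def by blast

lemma countable_rat_consts: "countable (range (\<lambda>q (_::'a). real_of_rat q))"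
  by (rule countable_image) auto

lemma pw_mono_map_cong:
  assumes "pw_mono_map s1 s2 N X" "\<And>w. w \<in> space N \<Longrightarrow> X w = Y w"
  shows "pw_mono_map s1 s2 N Y"
proof -
  have "(\<lambda>z. Y (fst z) (snd z)) \<in> borel_measurable (N \<Otimes>\<^sub>M borel) \<longleftrightarrow>
    (\<lambda>z. X (fst z) (snd z)) \<in> borel_measurable (N \<Otimes>\<^sub>M borel)"
    using assms(2) by (intro measurable_cong) (auto simp: space_pair_measure)
  with assms show ?thesis unfolding pw_mono_map_def by auto
qed

lemma pw_mono_map_TsetI:
  assumes T: "\<And>w. w \<in> space N \<Longrightarrow> X w \<in> Tset s1 s2"
    and m: "(\<lambda>z. X (fst z) (snd z)) \<in> borel_measurable (N \<Otimes>\<^sub>M borel)"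
  shows "pw_mono_map s1 s2 N X"
proof -
  have "mono_between {s1, s2} (X w)" if w: "w \<in> space N" for w
    unfolding mono_between_def
  proof (intro allI impI)
    fix x y :: real assume "x < y" "\<forall>t\<in>{s1, s2}. t \<notin> {x..y}"
    then show "X w x \<le> X w y"
      using Tset_outside[OF T[OF w], of x] Tset_outside[OF T[OF w], of y] Tset_mono[OF T[OF w], of x y]
      by (cases "x \<in> {s1..s2}"; cases "y \<in> {s1..s2}") auto
  qed
  moreover have "\<bar>X w x\<bar> \<le> max (max \<bar>s1\<bar> \<bar>s2\<bar>) \<bar>x\<bar>" if w: "w \<in> space N" for w x
    using Tset_range[OF T[OF w], of x] Tset_outside[OF T[OF w], of x] by (cases "x \<in> {s1..s2}") auto
  ultimately show ?thesis
    unfolding pw_mono_map_def using Tset_outside[OF T] m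
    by (intro conjI exI[of _ "max \<bar>s1\<bar> \<bar>s2\<bar>"] exI[of _ "{\<lambda>_. s1, \<lambda>_. s2}"]) auto
qed

lemma pw_mono_map_Tset_const: "T \<in> Tset s1 s2 \<Longrightarrow> pw_mono_map s1 s2 N (\<lambda>_. T)"
  using measurable_compose[OF measurable_snd Tset_borel] by (intro pw_mono_map_TsetI) auto

text \<open>Monotonicity and continuity turn pointwise into joint measurability: for
  \<open>x\<close> in the interval and \<open>a \<ge> s1\<close>, \<open>a < X w x\<close> holds iff
  \<open>a < X w q\<close> for some rational \<open>q < x\<close> of the interval. This is the
  passage from \<open>FN\<close> to random maps evaluated at random points.\<close>

lemma pw_mono_map_homeo:
  assumes H: "\<And>w. w \<in> space N \<Longrightarrow> X w \<in> homeo s1 s2"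
    and m: "\<And>x. x \<in> {s1..s2} \<Longrightarrow> (\<lambda>w. X w x) \<in> borel_measurable N"
  shows "pw_mono_map s1 s2 N X"
proof (rule pw_mono_map_TsetI)
  show "X w \<in> Tset s1 s2" if "w \<in> space N" for w using homeo_Tset[OF H[OF that]] .
  show "(\<lambda>z. X (fst z) (snd z)) \<in> borel_measurable (N \<Otimes>\<^sub>M borel)"
    unfolding borel_measurable_iff_greater
  proof
    fix a :: real
    let ?Q = "{q. of_rat q \<in> {s1..s2}}"
    have eq: "{z \<in> space (N \<Otimes>\<^sub>M borel). a < X (fst z) (snd z)} =
       ({w\<in>space N. True} \<times> ({x. x \<notin> {s1..s2} \<and> a < x} \<union> {x \<in> {s1..s2}. a < s1})) \<union>
       (\<Union>q\<in>?Q. {w\<in>space N. a < X w (of_rat q)} \<times> {x \<in> {s1..s2}. of_rat q < x})"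
      (is "?L = ?R")
    proof (intro equalityI subsetI)
      fix z assume z: "z \<in> ?L"
      obtain w x where zz: "z = (w, x)" "w \<in> space N" "a < X w x" using z by (auto simp: space_pair_measure)
      note T = homeo_Tset[OF H[OF zz(2)]]
      show "z \<in> ?R"
      proof (cases "x \<in> {s1..s2} \<and> s1 \<le> a")
        case True
        then have r: "a \<in> {s1..s2}" using Tset_range[OF T, of x] zz(3) by auto
        \<comment> \<open>The preimage of a level strictly between \<open>a\<close> and
          \<open>X w x\<close> lies strictly left of \<open>x\<close>, which leaves space for a
          rational.\<close>
        define y where "y = (a + X w x) / 2"
        have y: "a < y" "y < X w x" using zz(3) by (auto simp: y_def)
        have "y \<in> {s1..s2}" using y r Tset_range[OF T, of x] True by auto
        then obtain u where u: "u \<in> {s1..s2}" "X w u = y"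
          using homeo_image[OF H[OF zz(2)]] by (metis imageE)
        have "u < x" using Tset_mono[OF T, of x u] u True y by force
        then obtain q where q: "u < of_rat q" "of_rat q < x" using of_rat_dense by blast
        have "y \<le> X w (of_rat q)" using Tset_mono[OF T, of u "of_rat q"] u q True by auto
        then have "z \<in> {w\<in>space N. a < X w (of_rat q)} \<times> {x \<in> {s1..s2}. of_rat q < x}" "q \<in> ?Q"
          using zz y q u True by auto
        then show ?thesis by blast
      next
        case False
        then show ?thesis using zz Tset_outside[OF T, of x] by auto
      qed
    next
      fix z assume "z \<in> ?R"
      then consider w x where "z = (w, x)" "w \<in> space N" "x \<notin> {s1..s2}" "a < x"
        | w x where "z = (w, x)" "w \<in> space N" "x \<in> {s1..s2}" "a < s1"
        | w x q where "z = (w, x)" "w \<in> space N" "x \<in> {s1..s2}" "of_rat q \<in> {s1..s2}" "of_rat q < x" "a < X w (of_rat q)"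
        by blast
      then show "z \<in> ?L"
      proof cases
        case 1 then show ?thesis using Tset_outside[OF homeo_Tset[OF H]] by (auto simp: space_pair_measure)
      next
        case 2 then show ?thesis using Tset_range[OF homeo_Tset[OF H], of w x] by (auto simp: space_pair_measure)
      next
        case 3 then show ?thesis
          using Tset_mono[OF homeo_Tset[OF H], of w "of_rat q" x] by (auto simp: space_pair_measure)
      qed
    qed
    have "{w\<in>space N. a < X w (of_rat q)} \<in> sets N" if "q \<in> ?Q" for q
      using m[of "of_rat q"] that by (simp add: borel_measurable_iff_greater)
    moreover have "{x. x \<notin> {s1..s2} \<and> a < x} \<union> {x \<in> {s1..s2}. a < s1} \<in> sets borel"
      "\<And>q. {x \<in> {s1..s2}. real_of_rat q < x} \<in> sets borel"
      by measurable
    ultimately show "{z \<in> space (N \<Otimes>\<^sub>M borel). a < X (fst z) (snd z)} \<in> sets (N \<Otimes>\<^sub>M borel)"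
      unfolding eq by (intro sets.Un sets.countable_UN'' pair_measureI) auto
  qed
qed

lemma pw_mono_map_detect:
  assumes \<Theta>: "finite \<Theta>" and m: "mono_between ((\<lambda>t. t w) ` \<Theta>) f" and "z < a"
  shows "\<exists>d \<in> \<Theta> \<union> range (\<lambda>q _. real_of_rat q). z \<le> d w \<and> d w < a \<and> f z \<le> f (d w)"
proof -
  consider t where "t \<in> \<Theta>" "z = t w" | q where "z < of_rat q" "of_rat q < a" "f z \<le> f (of_rat q)"
    using mono_between_detect[OF m _ \<open>z < a\<close>] \<Theta> by auto
  then show ?thesis
  proof cases
    case 1 then show ?thesis using \<open>z < a\<close> by (intro bexI[of _ t]) auto
  next
    case 2 then show ?thesis by (intro bexI[of _ "\<lambda>_. of_rat q"]) auto
  qed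
qed

lemma pw_mono_map_posmul:
  assumes X: "pw_mono_map s1 s2 N X" and r: "0 \<le> r" "r \<le> 1"
  shows "pw_mono_map s1 s2 N (\<lambda>w. posmul r (X w))"
proof -
  have eq: "posmul r f x = (1 - r) * x + r * f x" for f x
    by (simp add: posmul_def algebra_simps)
  obtain \<Theta> where T: "finite \<Theta>" "\<Theta> \<subseteq> borel_measurable N" 
    "\<And>w. w \<in> space N \<Longrightarrow> mono_between ((\<lambda>t. t w) ` \<Theta>) (X w)"
    by (rule pw_mono_map_breakpoints[OF X]) blast
  obtain B where B: "\<And>w x. w \<in> space N \<Longrightarrow> \<bar>X w x\<bar> \<le> max B \<bar>x\<bar>"
    by (rule pw_mono_map_bound[OF X]) blast
  show ?thesis unfolding pw_mono_map_def
  proof (intro conjI)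
    show "(\<lambda>z. posmul r (X (fst z)) (snd z)) \<in> borel_measurable (N \<Otimes>\<^sub>M borel)"
      unfolding posmul_def using pw_mono_map_measurable[OF X] by measurable
    show "\<forall>w\<in>space N. \<forall>x. x \<notin> {s1..s2} \<longrightarrow> posmul r (X w) x = x"
      using pw_mono_map_outside[OF X] by (auto simp: posmul_def)
    show "\<exists>B. \<forall>w\<in>space N. \<forall>x. \<bar>posmul r (X w) x\<bar> \<le> max B \<bar>x\<bar>"
    proof (intro exI ballI allI)
      fix w x assume w: "w \<in> space N"
      have "\<bar>posmul r (X w) x\<bar> \<le> (1 - r) * \<bar>x\<bar> + r * \<bar>X w x\<bar>"
        unfolding eq using r by (metis abs_mult abs_of_nonneg abs_triangle_ineq diff_ge_0_iff_ge)
      also have "\<dots> \<le> (1 - r) * max B \<bar>x\<bar> + r * max B \<bar>x\<bar>"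
        using r B[OF w] by (intro add_mono mult_left_mono) auto
      finally show "\<bar>posmul r (X w) x\<bar> \<le> max B \<bar>x\<bar>" by (simp add: algebra_simps)
    qed
    have "mono_between A (posmul r f)" if "mono_between A f" for A f
      using that r unfolding mono_between_def eq
      by (auto intro!: add_mono mult_left_mono)
    then show "\<exists>\<Theta>. finite \<Theta> \<and> \<Theta> \<subseteq> borel_measurable N \<and>
        (\<forall>w\<in>space N. mono_between ((\<lambda>t. t w) ` \<Theta>) (posmul r (X w)))"
      using T by (intro exI[of _ \<Theta>]) auto
  qed
qed

text \<open>As the level rises the set in the infimum shrinks, so the inverse increases while that
  set is nonempty and is constantly \<open>Inf {}\<close> afterwards. The only new breakpoint is the
  level \<open>top\<close> where this change occurs.\<close>

lemma pw_mono_map_tinv: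
  assumes X: "pw_mono_map s1 s2 N X" and s: "s1 \<le> s2"
  shows "pw_mono_map s1 s2 N (\<lambda>w. tinv s1 s2 (X w))"
proof -
  obtain \<Theta> where T: "finite \<Theta>" "\<Theta> \<subseteq> borel_measurable N" "(\<lambda>_. s1) \<in> \<Theta>" "(\<lambda>_. s2) \<in> \<Theta>"
    "\<And>w. w \<in> space N \<Longrightarrow> mono_between ((\<lambda>t. t w) ` \<Theta>) (X w)"
    by (rule pw_mono_map_breakpoints[OF X]) blast
  define A where "A = (\<lambda>w y. {x. s1 \<le> x \<and> x \<le> s2 \<and> y \<le> X w x})"
  have tinv_eq: "tinv s1 s2 (X w) y = (if s1 \<le> y \<and> y \<le> s2 then Inf (A w y) else y)" for w y
    by (simp add: tinv_def A_def)
  define J where "J = \<Theta> \<union> range (\<lambda>q _. real_of_rat q)"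
  have J: "countable J" "J \<subseteq> borel_measurable N"
    using T by (auto simp: J_def countable_finite countable_rat_consts)
  have det: "\<exists>d\<in>J. d w \<in> A w y \<and> d w < a" if "w \<in> space N" "x \<in> A w y" "x < a" for w y x a
  proof (cases "x = s2")
    case True
    then show ?thesis using that T by (intro bexI[of _ "\<lambda>_. s2"]) (auto simp: J_def)
  next
    case False
    \<comment> \<open>The cut at \<open>s2\<close> keeps the selected point inside the interval. The
      point \<open>s2\<close> itself is caught by the constant breakpoint \<open>s2\<close>.\<close>
    then have "x < min a s2" using that by (auto simp: A_def)
    from pw_mono_map_detect[OF T(1) T(5)[OF that(1)] this]
    obtain d where d: "d \<in> J" "x \<le> d w" "d w < min a s2" "X w x \<le> X w (d w)"
      unfolding J_def by blast
    with that show ?thesis by (intro bexI[of _ d]) (auto simp: A_def)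
  qed
  have m: "(\<lambda>z. Inf (A (fst z) (snd z))) \<in> borel_measurable (N \<Otimes>\<^sub>M borel)"
  proof (rule borel_measurable_Inf_detect[where J = "(\<lambda>d z. d (fst z)) ` J"])
    show "countable ((\<lambda>d z. d (fst z)) ` J)" using J by auto
    show *: "(\<lambda>d z. d (fst z)) ` J \<subseteq> borel_measurable (N \<Otimes>\<^sub>M borel)"
      using J by (auto intro: measurable_compose[OF measurable_fst])
    show "{z \<in> space (N \<Otimes>\<^sub>M borel). d z \<in> A (fst z) (snd z)} \<in> sets (N \<Otimes>\<^sub>M borel)"
      if "d \<in> (\<lambda>d z. d (fst z)) ` J" for d
    proof -
      have d [measurable]: "d \<in> borel_measurable (N \<Otimes>\<^sub>M borel)" using * that by blast
      have [measurable]: "(\<lambda>z. X (fst z) (d z)) \<in> borel_measurable (N \<Otimes>\<^sub>M borel)"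
        by (rule pw_mono_map_apply[OF X]) auto
      show ?thesis unfolding A_def mem_Collect_eq by measurable
    qed
    show "bdd_below (A (fst z) (snd z))" for z :: "'a \<times> real"
      by (auto simp: A_def intro: bdd_belowI)
    show "\<exists>d\<in>(\<lambda>d z. d (fst z)) ` J. d z \<in> A (fst z) (snd z) \<and> d z < a"
      if "z \<in> space (N \<Otimes>\<^sub>M borel)" "x \<in> A (fst z) (snd z)" "x < a" for z x a
      using det[OF _ that(2,3)] that(1) by (auto simp: space_pair_measure)
  qed
  have ne: "{w \<in> space N. A w y \<noteq> {}} \<in> sets N" for y
  proof (rule borel_measurable_Inf_detect(2)[OF J])
    show "{w \<in> space N. d w \<in> A w y} \<in> sets N" if "d \<in> J" for d
    proof -
      have d [measurable]: "d \<in> borel_measurable N" using J that by blast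
      have [measurable]: "(\<lambda>z. X z (d z)) \<in> borel_measurable N"
        by (rule pw_mono_map_apply_id[OF X]) auto
      show ?thesis unfolding A_def mem_Collect_eq by measurable
    qed
    show "bdd_below (A w y)" for w by (auto simp: A_def intro: bdd_belowI)
  qed (use det in blast)
  \<comment> \<open>\<open>f w q\<close> is the level \<open>q\<close> if it is attained and the
    harmless default \<open>s1\<close> otherwise. Restricting to rational levels makes
    \<open>top\<close> a countable supremum and hence measurable.\<close>
  define f where "f = (\<lambda>w q. if s1 \<le> of_rat q \<and> of_rat q \<le> s2 \<and> A w (of_rat q) \<noteq> {} then real_of_rat q else s1)"
  define top where "top = (\<lambda>w. SUP q. f w q)"
  have bdd: "bdd_above (range (f w))" for w
    using s by (auto simp: f_def intro!: bdd_aboveI[of _ s2])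
  have [measurable]: "(\<lambda>w. f w q) \<in> borel_measurable N" for q
  proof -
    have [measurable]: "Measurable.pred N (\<lambda>w. A w (of_rat q) \<noteq> {})"
      using ne by (simp add: Measurable.pred_def)
    show ?thesis unfolding f_def by measurable
  qed
  have top: "top \<in> borel_measurable N"
    unfolding top_def by (intro borel_measurable_cSUP bdd) auto
  have mono: "mono_between ((\<lambda>t. t w) ` {\<lambda>_. s1, \<lambda>_. s2, top}) (tinv s1 s2 (X w))" for w
    unfolding mono_between_def
  proof (intro allI impI)
    fix x y assume xy: "x < y" and "\<forall>t\<in>(\<lambda>t. t w) ` {\<lambda>_. s1, \<lambda>_. s2, top}. t \<notin> {x..y}"
    then have out: "s1 \<notin> {x..y}" "s2 \<notin> {x..y}" "top w \<notin> {x..y}" by auto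
    show "tinv s1 s2 (X w) x \<le> tinv s1 s2 (X w) y"
    proof (cases "s1 < x \<and> y < s2")
      case False
      then have "x \<notin> {s1..s2}" "y \<notin> {s1..s2}" using out xy by auto
      then show ?thesis using xy by (auto simp: tinv_def)
    next
      case True
      have sub: "A w v \<subseteq> A w u" if "u \<le> v" for u v using that by (auto simp: A_def)
      have "Inf (A w x) \<le> Inf (A w y)"
      proof (cases "y < top w")
        case True
        then obtain q where "y < f w q" unfolding top_def using bdd by (auto simp: less_cSUP_iff)
        then have "A w y \<noteq> {}"
          using sub[of y "of_rat q"] \<open>s1 < x \<and> y < s2\<close> xy by (auto simp: f_def split: if_splits)
        then show ?thesis
          using sub[of x y] xy by (intro cInf_superset_mono) (auto simp: A_def intro: bdd_belowI)
      next
        case False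
        then have tx: "top w < x" using out by auto
        have "A w x = {}"
        proof (rule ccontr)
          assume ne: "A w x \<noteq> {}"
          have "max s1 (top w) < x" using tx True by auto
          then obtain q where q: "max s1 (top w) < of_rat q" "of_rat q < x" using of_rat_dense by blast
          then have "f w q = of_rat q" using ne sub[of "of_rat q" x] True xy by (auto simp: f_def)
          moreover have "f w q \<le> top w" unfolding top_def by (intro cSUP_upper bdd) auto
          ultimately show False using q by simp
        qed
        then show ?thesis using sub[of x y] xy by auto
      qed
      then show ?thesis using True xy by (simp add: tinv_eq)
    qed
  qed
  show ?thesis unfolding pw_mono_map_def
  proof (intro conjI)
    show "(\<lambda>z. tinv s1 s2 (X (fst z)) (snd z)) \<in> borel_measurable (N \<Otimes>\<^sub>M borel)"
      unfolding tinv_eq using m by measurable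
    show "\<exists>B. \<forall>w\<in>space N. \<forall>x. \<bar>tinv s1 s2 (X w) x\<bar> \<le> max B \<bar>x\<bar>"
    proof (intro exI ballI allI)
      fix w y
      have "A w y \<noteq> {} \<Longrightarrow> Inf (A w y) \<in> {s1..s2}"
      proof -
        assume "A w y \<noteq> {}"
        then obtain x where "x \<in> A w y" by auto
        moreover have "bdd_below (A w y)" by (auto simp: A_def intro: bdd_belowI)
        ultimately have "Inf (A w y) \<le> x" "x \<le> s2" by (auto intro: cInf_lower simp: A_def)
        moreover have "s1 \<le> Inf (A w y)" using \<open>A w y \<noteq> {}\<close> by (intro cInf_greatest) (auto simp: A_def)
        ultimately show ?thesis by auto
      qed
      then show "\<bar>tinv s1 s2 (X w) y\<bar> \<le> max (max (max \<bar>s1\<bar> \<bar>s2\<bar>) \<bar>Inf ({}::real set)\<bar>) \<bar>y\<bar>"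
        unfolding tinv_eq by (cases "A w y = {}") auto
    qed
    show "\<exists>\<Theta>. finite \<Theta> \<and> \<Theta> \<subseteq> borel_measurable N \<and>
        (\<forall>w\<in>space N. mono_between ((\<lambda>t. t w) ` \<Theta>) (tinv s1 s2 (X w)))"
      using mono top by (intro exI[of _ "{\<lambda>_. s1, \<lambda>_. s2, top}"]) auto
  qed (auto simp: tinv_def)
qed

text \<open>Breakpoints of the composite are those of both maps together with the places where the
  inner map crosses a breakpoint of the outer one. These crossings are infima, measurable by the
  detection lemma.\<close>

lemma pw_mono_map_comp:
  assumes X: "pw_mono_map s1 s2 N X" and Y: "pw_mono_map s1 s2 N Y"
  shows "pw_mono_map s1 s2 N (\<lambda>w. X w \<circ> Y w)"
proof -
  obtain \<Theta>X where TX: "finite \<Theta>X" "\<Theta>X \<subseteq> borel_measurable N"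
    "\<And>w. w \<in> space N \<Longrightarrow> mono_between ((\<lambda>t. t w) ` \<Theta>X) (X w)"
    by (rule pw_mono_map_breakpoints[OF X]) blast
  obtain \<Theta> where T: "finite \<Theta>" "\<Theta> \<subseteq> borel_measurable N" "(\<lambda>_. s1) \<in> \<Theta>" "(\<lambda>_. s2) \<in> \<Theta>"
    "\<And>w. w \<in> space N \<Longrightarrow> mono_between ((\<lambda>t. t w) ` \<Theta>) (Y w)"
    by (rule pw_mono_map_breakpoints[OF Y]) blast
  obtain BX where BX: "\<And>w x. w \<in> space N \<Longrightarrow> \<bar>X w x\<bar> \<le> max BX \<bar>x\<bar>"
    by (rule pw_mono_map_bound[OF X]) blast
  obtain BY where BY: "\<And>w x. w \<in> space N \<Longrightarrow> \<bar>Y w x\<bar> \<le> max BY \<bar>x\<bar>"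
    by (rule pw_mono_map_bound[OF Y]) blast
  define J where "J = \<Theta> \<union> range (\<lambda>q _. real_of_rat q)"
  have J: "countable J" "J \<subseteq> borel_measurable N"
    using T by (auto simp: J_def countable_finite countable_rat_consts)
  \<comment> \<open>Start after the breakpoint \<open>\<tau>\<close> of \<open>Y\<close> and wait
    until \<open>Y\<close> reaches \<open>t\<close> (\<open>b\<close> false) or exceeds it
    (\<open>b\<close> true). Both times are required because \<open>Y\<close> may rest at the level
    \<open>t\<close>: an interval avoiding both cannot see \<open>Y\<close> enter or leave this
    level.\<close>
  define A where "A = (\<lambda>(\<tau>, t, b) w. {z. \<tau> w < z \<and> (if b then t w < Y w z else t w \<le> Y w z)})"
  define C where "C = (\<lambda>u w. Inf (A u w)) ` (\<Theta> \<times> \<Theta>X \<times> UNIV)"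
  have C: "C \<subseteq> borel_measurable N"
  proof -
    have "(\<lambda>w. Inf (A (\<tau>, t, b) w)) \<in> borel_measurable N" if "\<tau> \<in> \<Theta>" "t \<in> \<Theta>X" for \<tau> t b
    proof (rule borel_measurable_Inf_detect[OF J])
      have [measurable]: "\<tau> \<in> borel_measurable N" "t \<in> borel_measurable N" using that T TX by auto
      show "{w \<in> space N. d w \<in> A (\<tau>, t, b) w} \<in> sets N" if "d \<in> J" for d
      proof -
        have d [measurable]: "d \<in> borel_measurable N" using J that by blast
        have [measurable]: "(\<lambda>z. Y z (d z)) \<in> borel_measurable N"
          by (rule pw_mono_map_apply_id[OF Y]) auto
        show ?thesis unfolding A_def prod.case mem_Collect_eq by measurable
      qed
      show "bdd_below (A (\<tau>, t, b) w)" for w by (auto simp: A_def intro: bdd_belowI less_imp_le)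
      show "\<exists>d\<in>J. d w \<in> A (\<tau>, t, b) w \<and> d w < a"
        if "w \<in> space N" "z \<in> A (\<tau>, t, b) w" "z < a" for w z a
      proof -
        from pw_mono_map_detect[OF T(1) T(5)[OF that(1)] that(3)]
        obtain d where d: "d \<in> J" "z \<le> d w" "d w < a" "Y w z \<le> Y w (d w)"
          unfolding J_def by blast
        with that(2) show ?thesis by (intro bexI[of _ d]) (auto simp: A_def split: if_splits)
      qed
    qed
    then show ?thesis by (auto simp: C_def)
  qed
  let ?\<Theta> = "\<Theta>X \<union> \<Theta> \<union> C"
  have mono: "mono_between ((\<lambda>t. t w) ` ?\<Theta>) (X w \<circ> Y w)" if w: "w \<in> space N" for w
    unfolding mono_between_def
  proof (intro allI impI)
    fix x y assume xy: "x < y" and out: "\<forall>t\<in>(\<lambda>t. t w) ` ?\<Theta>. t \<notin> {x..y}"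
    have out': "t w \<notin> {x..y}" if "t \<in> ?\<Theta>" for t using out that by blast
    have outX: "t w \<notin> {x..y}" if "t \<in> \<Theta>X" for t using that by (intro out') simp
    have outY: "t w \<notin> {x..y}" if "t \<in> \<Theta>" for t using that by (intro out') simp
    have outC: "Inf (A (\<tau>, t, b) w) \<notin> {x..y}" if "\<tau> \<in> \<Theta>" "t \<in> \<Theta>X" for \<tau> t b
    proof -
      have "(\<lambda>w. Inf (A (\<tau>, t, b) w)) \<in> C"
        unfolding C_def using that by (intro image_eqI[where x = "(\<tau>, t, b)"]) auto
      from out'[OF UnI2[OF this]] show ?thesis .
    qed
    have ends: "s1 \<notin> {x..y}" "s2 \<notin> {x..y}" using outY[OF T(3)] outY[OF T(4)] by auto
    have Yxy: "Y w x \<le> Y w y" using mono_betweenD[OF T(5)[OF w], of x y] xy outY by auto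
    show "(X w \<circ> Y w) x \<le> (X w \<circ> Y w) y"
    proof (cases "s1 < x")
      case False
      then have "x \<notin> {s1..s2}" "y \<notin> {s1..s2}" using ends xy by auto
      then have "Y w x = x" "Y w y = y" using pw_mono_map_outside[OF Y w] by auto
      then show ?thesis using mono_betweenD[OF TX(3)[OF w], of x y] outX xy by auto
    next
      case True
      \<comment> \<open>\<open>\<tau>\<close> becomes the last breakpoint of \<open>Y\<close> before
        \<open>x\<close>; one exists since \<open>s1\<close> is a breakpoint and
        \<open>s1 < x\<close>. Hence \<open>Y\<close> is monotone between \<open>\<tau>\<close>
        (excluded) and \<open>y\<close>, although the sets \<open>A\<close> are not confined to one
        piece.\<close>
      define S where "S = {t w |t. t \<in> \<Theta> \<and> t w < x}"
      have S: "finite S" "s1 \<in> S" using T True by (auto simp: S_def)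
      then have "Max S \<in> S" by (intro Max_in) auto
      then obtain \<tau> where \<tau>: "\<tau> \<in> \<Theta>" "\<tau> w < x" "\<tau> w = Max S" by (auto simp: S_def)
      have gap: "t w \<notin> {u..v}" if "t \<in> \<Theta>" "\<tau> w < u" "v \<le> y" for t u v
      proof (cases "t w < x")
        case True
        then have "t w \<le> \<tau> w" using S that \<tau>(3) by (auto simp: S_def intro!: Max_ge)
        then show ?thesis using that by auto
      next
        case False then show ?thesis using outY[OF that(1)] that by auto
      qed
      have Ymono: "Y w u \<le> Y w v" if "\<tau> w < u" "u \<le> v" "v \<le> y" for u v
        using mono_betweenD[OF T(5)[OF w], of u v] gap that by auto
      have early: "\<exists>z\<in>A (\<tau>, t, b) w. z < x" if "y \<in> A (\<tau>, t, b) w" "t \<in> \<Theta>X" for t b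
      proof -
        have bdd: "bdd_below (A (\<tau>, t, b) w)" by (auto simp: A_def intro: bdd_belowI less_imp_le)
        have "Inf (A (\<tau>, t, b) w) \<le> y" using bdd that by (intro cInf_lower)
        then have "Inf (A (\<tau>, t, b) w) < x" using outC[OF \<tau>(1) that(2), of b] by auto
        then show ?thesis using bdd that(1) by (subst (asm) cInf_less_iff) auto
      qed
      have no_t: "t w \<notin> {Y w x..Y w y}" if "Y w x < Y w y" "t \<in> \<Theta>X" for t
      proof
        assume t: "t w \<in> {Y w x..Y w y}"
        then have "y \<in> A (\<tau>, t, False) w" using \<tau>(2) xy by (auto simp: A_def)
        from early[OF this that(2)] obtain z where z: "\<tau> w < z" "t w \<le> Y w z" "z < x" by (auto simp: A_def)
        then have "t w \<le> Y w x" using Ymono[of z x] xy by auto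
        with t have eq: "t w = Y w x" by auto
        then have "y \<in> A (\<tau>, t, True) w" using \<tau>(2) xy that by (auto simp: A_def)
        from early[OF this that(2)] obtain z where z: "\<tau> w < z" "t w < Y w z" "z < x" by (auto simp: A_def)
        then show False using Ymono[of z x] xy eq by auto
      qed
      show ?thesis
      proof (cases "Y w x = Y w y")
        case False
        then have "Y w x < Y w y" using Yxy by simp
        then show ?thesis using mono_betweenD[OF TX(3)[OF w], of "Y w x" "Y w y"] no_t by auto
      qed simp
    qed
  qed
  show ?thesis unfolding pw_mono_map_def
  proof (intro conjI)
    show "(\<lambda>z. (X (fst z) \<circ> Y (fst z)) (snd z)) \<in> borel_measurable (N \<Otimes>\<^sub>M borel)"
      unfolding o_def using pw_mono_map_measurable[OF Y] by (intro pw_mono_map_apply[OF X]) auto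
    show "\<forall>w\<in>space N. \<forall>x. x \<notin> {s1..s2} \<longrightarrow> (X w \<circ> Y w) x = x"
      using pw_mono_map_outside[OF X] pw_mono_map_outside[OF Y] by auto
    show "\<exists>B. \<forall>w\<in>space N. \<forall>x. \<bar>(X w \<circ> Y w) x\<bar> \<le> max B \<bar>x\<bar>"
    proof (intro exI ballI allI)
      fix w x assume w: "w \<in> space N"
      have "\<bar>(X w \<circ> Y w) x\<bar> \<le> max BX \<bar>Y w x\<bar>" using BX[OF w] by simp
      also have "\<dots> \<le> max BX (max BY \<bar>x\<bar>)" by (intro max.mono BY w order_refl)
      finally show "\<bar>(X w \<circ> Y w) x\<bar> \<le> max (max BX BY) \<bar>x\<bar>" by (simp add: max.assoc)
    qed
    show "\<exists>\<Theta>. finite \<Theta> \<and> \<Theta> \<subseteq> borel_measurable N \<and>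
        (\<forall>w\<in>space N. mono_between ((\<lambda>t. t w) ` \<Theta>) (X w \<circ> Y w))"
      using mono T TX C by (intro exI[of _ ?\<Theta>]) (auto simp: C_def)
  qed
qed

lemma pw_mono_map_id: "s1 \<le> s2 \<Longrightarrow> pw_mono_map s1 s2 N (\<lambda>_. id)"
  by (intro pw_mono_map_Tset_const homeo_Tset homeo_id)

lemma pw_mono_map_funpow:
  assumes "pw_mono_map s1 s2 N X" "s1 \<le> s2"
  shows "pw_mono_map s1 s2 N (\<lambda>w. X w ^^ n)"
proof (induction n)
  case 0 then show ?case using pw_mono_map_id[OF assms(2)] by (simp add: id_def)
next
  case (Suc n) then show ?case using pw_mono_map_comp[OF assms(1) Suc] by (simp only: funpow.simps)
qed

lemma pw_mono_map_smult:
  assumes "pw_mono_map s1 s2 N X" "s1 \<le> s2"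
  shows "pw_mono_map s1 s2 N (\<lambda>w. smult s1 s2 \<alpha> (X w))"
  by (rule smult_cases[of \<alpha> s1 s2])
    (simp_all only: pw_mono_map_comp pw_mono_map_funpow pw_mono_map_posmul pw_mono_map_tinv assms)

lemma pw_mono_map_ar_comp:
  assumes "\<And>j. j \<in> {1..k} \<Longrightarrow> pw_mono_map s1 s2 N (U j)" "s1 \<le> s2"
  shows "pw_mono_map s1 s2 N (\<lambda>w. ar_comp s1 s2 a (\<lambda>j. U j w) k)"
  using assms(1)
  by (induction k) (simp_all add: pw_mono_map_id oplus_def pw_mono_map_comp pw_mono_map_smult assms(2))

lemma pw_mono_map_upsilon:
  assumes S: "\<And>j. j \<in> {1..p} \<Longrightarrow> pw_mono_map s1 s2 N (S j)" and e: "pw_mono_map s1 s2 N e"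
    and s: "s1 \<le> s2" and j: "j \<in> {1..p}"
  shows "pw_mono_map s1 s2 N (\<lambda>w. upsilon s1 s2 p a (e w) (\<lambda>j. S j w) j)"
proof (cases "j < p")
  case True then show ?thesis using S[of "Suc j"] j by (simp add: upsilon_def)
next
  case False
  have "pw_mono_map s1 s2 N (\<lambda>w. e w \<circ> ar_comp s1 s2 a (\<lambda>k. S (p + 1 - k) w) p)"
    using s by (intro pw_mono_map_comp e pw_mono_map_ar_comp S) auto
  then show ?thesis using False j by (simp add: upsilon_def oplus_def)
qed

lemma pw_mono_map_upsilon_iter:
  assumes S: "\<And>j. j \<in> {1..p} \<Longrightarrow> pw_mono_map s1 s2 N (S j)" and s: "s1 \<le> s2"
    and e: "\<And>k. i < k + m \<Longrightarrow> k \<le> i \<Longrightarrow> pw_mono_map s1 s2 N (e k)" and j: "j \<in> {1..p}" and im: "m \<le> i"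
  shows "pw_mono_map s1 s2 N (\<lambda>w. upsilon_iter s1 s2 p a (\<lambda>k. e k w) i m (\<lambda>j. S j w) j)"
  using e j im
proof (induction m arbitrary: i j)
  case 0 then show ?case using S by simp
next
  case (Suc m)
  have "pw_mono_map s1 s2 N (\<lambda>w. upsilon_iter s1 s2 p a (\<lambda>k. e k w) (i - 1) m (\<lambda>j. S j w) j)"
    if "j \<in> {1..p}" for j
    using Suc.prems(1,3) that by (intro Suc.IH) auto
  then show ?case unfolding upsilon_iter.simps
    using Suc.prems by (intro pw_mono_map_upsilon s) auto
qed

lemma d1_measurable:
  assumes "pw_mono_map s1 s2 N X" "pw_mono_map s1 s2 N Y"
  shows "(\<lambda>w. d1 s1 s2 (X w) (Y w)) \<in> borel_measurable N"
  unfolding d1_def set_lebesgue_integral_def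
proof (rule lborel.borel_measurable_lebesgue_integral)
  show "(\<lambda>(w, x). indicator {s1..s2} x *\<^sub>R \<bar>X w x - Y w x\<bar>) \<in> borel_measurable (N \<Otimes>\<^sub>M lborel)"
    using pw_mono_map_measurable[OF assms(1)] pw_mono_map_measurable[OF assms(2)]
    by (auto simp: split_beta' cong: measurable_cong_sets) 
qed

lemma d1p_measurable:
  assumes "\<And>j. j \<in> {1..p} \<Longrightarrow> pw_mono_map s1 s2 N (X j)" "\<And>j. j \<in> {1..p} \<Longrightarrow> pw_mono_map s1 s2 N (Y j)"
  shows "(\<lambda>w. d1p s1 s2 p (\<lambda>j. X j w) (\<lambda>j. Y j w)) \<in> borel_measurable N"
  unfolding d1p_def
  by (intro measurable_compose[OF _ borel_measurable_sqrt] borel_measurable_sum borel_measurable_power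
      d1_measurable assms)

lemma pw_mono_map_section_borel:
  assumes "pw_mono_map s1 s2 N X" "w \<in> space N"
  shows "X w \<in> borel_measurable borel"
  using pw_mono_map_apply[OF assms(1), of "\<lambda>_. w" borel "\<lambda>x. x"] assms(2) by simp

lemma pw_mono_map_measurable_space:
  assumes "pw_mono_map s1 s2 N X" "f \<in> measurable L N"
  shows "pw_mono_map s1 s2 L (\<lambda>w. X (f w))"
proof -
  obtain \<Theta> where T: "finite \<Theta>" "\<Theta> \<subseteq> borel_measurable N" 
    "\<And>w. w \<in> space N \<Longrightarrow> mono_between ((\<lambda>t. t w) ` \<Theta>) (X w)"
    by (rule pw_mono_map_breakpoints[OF assms(1)]) blast
  obtain B where B: "\<And>w x. w \<in> space N \<Longrightarrow> \<bar>X w x\<bar> \<le> max B \<bar>x\<bar>"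
    by (rule pw_mono_map_bound[OF assms(1)]) blast
  have sp: "f w \<in> space N" if "w \<in> space L" for w using measurable_space[OF assms(2) that] .
  show ?thesis unfolding pw_mono_map_def
  proof (intro conjI)
    show "(\<lambda>z. X (f (fst z)) (snd z)) \<in> borel_measurable (L \<Otimes>\<^sub>M borel)"
      using assms(2) by (intro pw_mono_map_apply[OF assms(1)]) auto
    show "\<exists>\<Theta>. finite \<Theta> \<and> \<Theta> \<subseteq> borel_measurable L \<and> (\<forall>w\<in>space L. mono_between ((\<lambda>t. t w) ` \<Theta>) (X (f w)))"
      using T sp by (intro exI[of _ "(\<lambda>t w. t (f w)) ` \<Theta>"])
        (auto simp: image_image intro: measurable_compose[OF assms(2)])
    show "\<exists>B. \<forall>w\<in>space L. \<forall>x. \<bar>X (f w) x\<bar> \<le> max B \<bar>x\<bar>"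
      using B sp by blast
  qed (use pw_mono_map_outside[OF assms(1)] sp in auto)
qed

section \<open>Decorrelation and independence\<close>

text \<open>Every row has at most \<open>2 * m\<close> entries at distance less than
  \<open>m\<close> from the diagonal; those cost \<open>B\<close>, and \<open>\<tau>\<close> is
  charged for every entry.\<close>

lemma sum_square_le_near_diagonal:
  fixes B \<tau> :: real
  assumes "0 \<le> B" "0 \<le> \<tau>" and c: "\<And>i j. i \<in> {p+1..n} \<Longrightarrow> j \<in> {p+1..n} \<Longrightarrow> c i j \<le> (if i < j + m \<and> j < i + m then B else \<tau>)"
  shows "(\<Sum>i\<in>{p+1..n}. \<Sum>j\<in>{p+1..n}. c i j) \<le> real (n - p) * (2 * real m * B + real (n - p) * \<tau>)"
proof -
  have "(\<Sum>j\<in>{p+1..n}. c i j) \<le> 2 * real m * B + real (n - p) * \<tau>" if i: "i \<in> {p+1..n}" for i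
  proof -
    have "(\<Sum>j\<in>{p+1..n}. c i j) \<le> (\<Sum>j\<in>{p+1..n}. (if i < j + m \<and> j < i + m then B else 0) + \<tau>)"
    proof (rule sum_mono)
      fix j assume "j \<in> {p+1..n}"
      from c[OF i this] assms show "c i j \<le> (if i < j + m \<and> j < i + m then B else 0) + \<tau>"
        by (auto split: if_splits)
    qed
    also have "\<dots> = real (card {j \<in> {p+1..n}. i < j + m \<and> j < i + m}) * B + real (n - p) * \<tau>"
      by (simp add: sum.distrib sum.If_cases Int_def)
    also have "\<dots> \<le> real (2 * m) * B + real (n - p) * \<tau>"
    proof -
      have "card {j \<in> {p+1..n}. i < j + m \<and> j < i + m} \<le> card {Suc i - m..<i + m}"
        by (intro card_mono) auto
      also have "\<dots> \<le> 2 * m" by auto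
      finally show ?thesis using assms by (intro add_right_mono mult_right_mono) auto
    qed
    finally show ?thesis by simp
  qed
  then have "(\<Sum>i\<in>{p+1..n}. \<Sum>j\<in>{p+1..n}. c i j) \<le> (\<Sum>i\<in>{p+1..n}. 2 * real m * B + real (n - p) * \<tau>)"
    by (rule sum_mono)
  also have "\<dots> = real (n - p) * (2 * real m * B + real (n - p) * \<tau>)"
    by (simp only: sum_constant card_atLeastAtMost) simp
  finally show ?thesis .
qed

context prob_space
begin

lemma integrable_bounded:
  fixes X :: "'a \<Rightarrow> real"
  assumes "X \<in> borel_measurable M" "\<And>w. w \<in> space M \<Longrightarrow> \<bar>X w\<bar> \<le> B"
  shows "integrable M X"
  using assms by (intro integrable_const_bound[of X B]) auto

lemma weak_law_decorrelated:
  fixes X :: "nat \<Rightarrow> 'a \<Rightarrow> real"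
  assumes meas: "\<And>i. p < i \<Longrightarrow> X i \<in> borel_measurable M"
    and bnd: "\<And>i w. p < i \<Longrightarrow> w \<in> space M \<Longrightarrow> \<bar>X i w\<bar> \<le> B"
    and cov: "\<And>\<tau>. 0 < \<tau> \<Longrightarrow> \<exists>m. \<forall>i j. p < i \<longrightarrow> i + m \<le> j \<longrightarrow> \<bar>expectation (\<lambda>w. X i w * X j w)\<bar> \<le> \<tau>"
    and \<tau>: "0 < \<tau>" and \<delta>: "0 < \<delta>"
  shows "\<exists>N. \<forall>n\<ge>N. prob {w \<in> space M. \<tau> \<le> \<bar>1 / real (n - p) * (\<Sum>i\<in>{p+1..n}. X i w)\<bar>} < \<delta>"
proof -
  \<comment> \<open>After division by \<open>\<tau>\<^sup>2\<close> in the Chebyshev bound, the far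
    pairs use up \<open>\<delta> / 2\<close>; for large \<open>n\<close> the near-diagonal pairs use
    less than the other half.\<close>
  define \<sigma> where "\<sigma> = \<delta> * \<tau>\<^sup>2 / 2"
  have \<sigma>: "0 < \<sigma>" using \<tau> \<delta> by (simp add: \<sigma>_def)
  obtain m where m: "\<And>i j. p < i \<Longrightarrow> i + m \<le> j \<Longrightarrow> \<bar>expectation (\<lambda>w. X i w * X j w)\<bar> \<le> \<sigma>"
    using cov[OF \<sigma>] by blast
  have [measurable]: "(\<lambda>w. X i w * X j w) \<in> borel_measurable M" if "p < i" "p < j" for i j
    using meas that by auto
  have B2: "\<bar>X i w * X j w\<bar> \<le> B\<^sup>2" if "p < i" "p < j" "w \<in> space M" for i j w
    using bnd that unfolding abs_mult power2_eq_square by (intro mult_mono) (auto intro: order_trans[OF abs_ge_zero])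
  have int: "integrable M (\<lambda>w. X i w * X j w)" if "p < i" "p < j" for i j
    using that B2 by (intro integrable_bounded[of _ "B\<^sup>2"]) auto
  have eB: "\<bar>expectation (\<lambda>w. X i w * X j w)\<bar> \<le> B\<^sup>2" if "p < i" "p < j" for i j
  proof -
    have "\<bar>expectation (\<lambda>w. X i w * X j w)\<bar> \<le> expectation (\<lambda>w. \<bar>X i w * X j w\<bar>)"
      using integral_norm_bound[of M "\<lambda>w. X i w * X j w"] by simp
    also have "\<dots> \<le> expectation (\<lambda>w. B\<^sup>2)"
      using int[OF that] B2[OF that] by (intro integral_mono) auto
    finally show ?thesis by (simp add: prob_space)
  qed
  have second: "expectation (\<lambda>w. (\<Sum>i\<in>{p+1..n}. X i w)\<^sup>2) \<le> real (n - p) * (2 * real m * B\<^sup>2 + real (n - p) * \<sigma>)" for n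
  proof -
    have "expectation (\<lambda>w. (\<Sum>i\<in>{p+1..n}. X i w)\<^sup>2) = (\<Sum>i\<in>{p+1..n}. \<Sum>j\<in>{p+1..n}. expectation (\<lambda>w. X i w * X j w))"
      unfolding power2_eq_square sum_product
      by (subst Bochner_Integration.integral_sum, intro Bochner_Integration.integrable_sum int, simp, simp,
          rule sum.cong[OF refl], subst Bochner_Integration.integral_sum) (auto intro: int)
    also have "\<dots> \<le> real (n - p) * (2 * real m * B\<^sup>2 + real (n - p) * \<sigma>)"
    proof (rule sum_square_le_near_diagonal)
      fix i j assume ij: "i \<in> {p+1..n}" "j \<in> {p+1..n}"
      have sym: "expectation (\<lambda>w. X i w * X j w) = expectation (\<lambda>w. X j w * X i w)"
        by (simp add: mult.commute)
      show "expectation (\<lambda>w. X i w * X j w) \<le> (if i < j + m \<and> j < i + m then B\<^sup>2 else \<sigma>)"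
        using eB[of i j] m[of i j] m[of j i] ij sym by auto
    qed (use \<sigma> in auto)
    finally show ?thesis .
  qed
  have prob_le: "prob {w \<in> space M. \<tau> \<le> \<bar>1 / real (n - p) * (\<Sum>i\<in>{p+1..n}. X i w)\<bar>}
      \<le> (2 * real m * B\<^sup>2 / real (n - p) + \<sigma>) / \<tau>\<^sup>2" if n: "p < n" for n
  proof -
    let ?S = "\<lambda>w. \<Sum>i\<in>{p+1..n}. X i w"
    have S: "?S \<in> borel_measurable M" using meas by (intro borel_measurable_sum) auto
    have "\<bar>?S w\<bar> \<le> real (n - p) * B" if "w \<in> space M" for w
    proof -
      have "\<bar>?S w\<bar> \<le> (\<Sum>i\<in>{p+1..n}. B)" using that bnd by (intro order_trans[OF sum_abs] sum_mono) auto
      then show ?thesis by simp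
    qed
    then have "\<bar>(?S w)\<^sup>2\<bar> \<le> (real (n - p) * B)\<^sup>2" if "w \<in> space M" for w
      using that abs_le_square_iff by (auto simp: power2_eq_square abs_mult_self_eq intro!: abs_le_square_iff[THEN iffD1, unfolded power2_eq_square] order_trans[OF _ abs_ge_self])
    then have iS: "integrable M (\<lambda>w. (?S w)\<^sup>2)"
      by (intro integrable_bounded[OF borel_measurable_power[OF S]])
    have "{w \<in> space M. \<tau> \<le> \<bar>1 / real (n - p) * ?S w\<bar>} = {w \<in> space M. (real (n - p) * \<tau>)\<^sup>2 \<le> (?S w)\<^sup>2}"
      using n \<tau> by (auto simp: abs_mult field_simps abs_le_square_iff[symmetric] abs_divide)
    also have "prob \<dots> \<le> expectation (\<lambda>w. (?S w)\<^sup>2) / (real (n - p) * \<tau>)\<^sup>2"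
      using n \<tau> by (intro integral_Markov_inequality_measure[OF iS sets.empty_sets]) auto
    also have "\<dots> \<le> real (n - p) * (2 * real m * B\<^sup>2 + real (n - p) * \<sigma>) / (real (n - p) * \<tau>)\<^sup>2"
      using second by (intro divide_right_mono) auto
    also have "\<dots> = (2 * real m * B\<^sup>2 / real (n - p) + \<sigma>) / \<tau>\<^sup>2"
    proof -
      have "N * (a + N * \<sigma>) / (N * \<tau>)\<^sup>2 = (a / N + \<sigma>) / \<tau>\<^sup>2" if "0 < N" for N a :: real
        using that \<tau> by (simp add: power2_eq_square field_simps)
      then show ?thesis using n by simp
    qed
    finally show ?thesis .
  qed
  have "(\<lambda>n. 2 * real m * B\<^sup>2 / real (n - p)) \<longlonglongrightarrow> 0"
  proof -
    have "filterlim (\<lambda>n. real (n - p)) at_top sequentially"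
      by (rule filterlim_compose[OF filterlim_real_sequentially filterlim_minus_const_nat_at_top])
    then show ?thesis by (rule real_tendsto_divide_at_top[OF tendsto_const])
  qed
  then have "\<forall>\<^sub>F n in sequentially. 2 * real m * B\<^sup>2 / real (n - p) < \<sigma>"
    using \<sigma> by (intro order_tendstoD)
  then obtain N where N: "\<And>n. N \<le> n \<Longrightarrow> 2 * real m * B\<^sup>2 / real (n - p) < \<sigma>"
    by (auto simp: eventually_sequentially)
  show ?thesis
  proof (intro exI[of _ "max N (Suc p)"] allI impI)
    fix n assume n: "max N (Suc p) \<le> n"
    have "(2 * real m * B\<^sup>2 / real (n - p) + \<sigma>) / \<tau>\<^sup>2 < (\<sigma> + \<sigma>) / \<tau>\<^sup>2"
      using N[of n] n \<tau> by (intro divide_strict_right_mono) auto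
    also have "\<dots> = \<delta>" using \<tau> by (simp add: \<sigma>_def)
    finally show "prob {w \<in> space M. \<tau> \<le> \<bar>1 / real (n - p) * (\<Sum>i\<in>{p+1..n}. X i w)\<bar>} < \<delta>"
      using prob_le[of n] n by auto
  qed
qed

text \<open>Independent sub-sigma-algebras are encoded as independence of the identity map read with
  the two target structures. The law of \<open>(w, w)\<close> on the product is then a product
  measure.\<close>

lemma distr_diagonal_indep:
  assumes G: "subalgebra M G" and H: "subalgebra M H" and ind: "indep_set (sets G) (sets H)"
  shows "indep_var G (\<lambda>w. w) H (\<lambda>w. w)"
proof -
  have sp: "space G = space M" "space H = space M" using G H by (auto simp: subalgebra_def)
  have *: "sigma_sets (space M) {(\<lambda>w. w) -` A \<inter> space M |A. A \<in> sets L} = sets L" if "space L = space M" for L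
  proof -
    have "{(\<lambda>w. w) -` A \<inter> space M |A. A \<in> sets L} = sets L"
      using sets.sets_into_space[of _ L] that by (auto simp: Int_absorb2)
    then show ?thesis using sets.sigma_sets_eq[of L] that by simp
  qed
  show ?thesis unfolding indep_var_eq *[OF sp(1)] *[OF sp(2)]
    using ind measurable_from_subalg[OF G measurable_ident] measurable_from_subalg[OF H measurable_ident]
    by (simp add: id_def)
qed

text \<open>The freezing rule: on the diagonal, the argument governed by \<open>G\<close> may be
  replaced by an independent copy, so it can be held fixed while the other one is integrated
  out.\<close>

lemma nn_integral_decouple:
  assumes G: "subalgebra M G" and H: "subalgebra M H" and ind: "indep_set (sets G) (sets H)"
    and f [measurable]: "f \<in> borel_measurable (G \<Otimes>\<^sub>M H)"
  shows "(\<integral>\<^sup>+w. f (w, w) \<partial>M) = (\<integral>\<^sup>+w'. \<integral>\<^sup>+w. f (w', w) \<partial>M \<partial>M)"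
proof -
  note iv = distr_diagonal_indep[OF G H ind]
  note rv [measurable] = indep_var_rv1[OF iv] indep_var_rv2[OF iv]
  have eq: "distr M G (\<lambda>w. w) \<Otimes>\<^sub>M distr M H (\<lambda>w. w) = distr M (G \<Otimes>\<^sub>M H) (\<lambda>w. (w, w))"
    using iv unfolding indep_var_distribution_eq by blast
  interpret D: prob_space "distr M H (\<lambda>w. w)" by (rule prob_space_distr) fact
  have "(\<integral>\<^sup>+w. f (w, w) \<partial>M) = integral\<^sup>N (distr M G (\<lambda>w. w) \<Otimes>\<^sub>M distr M H (\<lambda>w. w)) f"
    unfolding eq by (subst nn_integral_distr) (auto intro: measurable_Pair rv)
  also have "\<dots> = (\<integral>\<^sup>+w'. \<integral>\<^sup>+w. f (w', w) \<partial>distr M H (\<lambda>w. w) \<partial>distr M G (\<lambda>w. w))"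
    by (subst D.nn_integral_fst) auto
  also have "\<dots> = (\<integral>\<^sup>+w'. \<integral>\<^sup>+w. f (w', w) \<partial>distr M H (\<lambda>w. w) \<partial>M)"
    by (subst nn_integral_distr) auto
  also have "\<dots> = (\<integral>\<^sup>+w'. \<integral>\<^sup>+w. f (w', w) \<partial>M \<partial>M)"
  proof (rule nn_integral_cong)
    fix w' assume "w' \<in> space M"
    then have [measurable]: "w' \<in> space G" using G by (auto simp: subalgebra_def)
    show "(\<integral>\<^sup>+w. f (w', w) \<partial>distr M H (\<lambda>w. w)) = (\<integral>\<^sup>+w. f (w', w) \<partial>M)"
      by (subst nn_integral_distr) auto
  qed
  finally show ?thesis .
qed

lemma integral_decouple:
  fixes f :: "'a \<times> 'a \<Rightarrow> real"
  assumes G: "subalgebra M G" and H: "subalgebra M H" and ind: "indep_set (sets G) (sets H)"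
    and f [measurable]: "f \<in> borel_measurable (G \<Otimes>\<^sub>M H)"
    and bnd: "\<And>w' w. w' \<in> space M \<Longrightarrow> w \<in> space M \<Longrightarrow> \<bar>f (w', w)\<bar> \<le> B"
  shows "(\<integral>w. f (w, w) \<partial>M) = (\<integral>w'. \<integral>w. f (w', w) \<partial>M \<partial>M)"
proof -
  note iv = distr_diagonal_indep[OF G H ind]
  note rv [measurable] = indep_var_rv1[OF iv] indep_var_rv2[OF iv]
  have sp: "space G = space M" "space H = space M" using G H by (auto simp: subalgebra_def)
  have eq: "distr M G (\<lambda>w. w) \<Otimes>\<^sub>M distr M H (\<lambda>w. w) = distr M (G \<Otimes>\<^sub>M H) (\<lambda>w. (w, w))"
    using iv unfolding indep_var_distribution_eq by blast
  interpret C: prob_space "distr M G (\<lambda>w. w)" by (rule prob_space_distr) fact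
  interpret D: prob_space "distr M H (\<lambda>w. w)" by (rule prob_space_distr) fact
  interpret P: pair_prob_space "distr M G (\<lambda>w. w)" "distr M H (\<lambda>w. w)" ..
  have int: "integrable (distr M G (\<lambda>w. w) \<Otimes>\<^sub>M distr M H (\<lambda>w. w)) f"
    using bnd by (intro P.P.integrable_bounded[of _ B]) (auto simp: space_pair_measure sp)
  have "(\<integral>w. f (w, w) \<partial>M) = integral\<^sup>L (distr M G (\<lambda>w. w) \<Otimes>\<^sub>M distr M H (\<lambda>w. w)) f"
    unfolding eq by (subst integral_distr) (auto intro: measurable_Pair rv)
  also have "\<dots> = (\<integral>w'. \<integral>w. f (w', w) \<partial>distr M H (\<lambda>w. w) \<partial>distr M G (\<lambda>w. w))"
    using P.integral_fst'[OF int] by simp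
  also have "\<dots> = (\<integral>w'. \<integral>w. f (w', w) \<partial>distr M H (\<lambda>w. w) \<partial>M)"
    by (subst integral_distr) auto
  also have "\<dots> = (\<integral>w'. \<integral>w. f (w', w) \<partial>M \<partial>M)"
  proof (rule Bochner_Integration.integral_cong[OF refl])
    fix w' assume "w' \<in> space M"
    then have [measurable]: "w' \<in> space G" using G by (auto simp: subalgebra_def)
    show "(\<integral>w. f (w', w) \<partial>distr M H (\<lambda>w. w)) = (\<integral>w. f (w', w) \<partial>M)"
      by (subst integral_distr) auto
  qed
  finally show ?thesis .
qed

lemma expectation_mult_indep_subalgebras:
  fixes X Y :: "'a \<Rightarrow> real"
  assumes "subalgebra M G" "subalgebra M H" "indep_set (sets G) (sets H)"
    and X: "X \<in> borel_measurable G" "integrable M X" and Y: "Y \<in> borel_measurable H" "integrable M Y"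
  shows "expectation (\<lambda>w. X w * Y w) = expectation X * expectation Y"
proof -
  have "indep_var borel X borel Y"
    using indep_var_compose[OF distr_diagonal_indep[OF assms(1-3)] X(1) Y(1)] by (simp add: o_def)
  then show ?thesis using X Y by (intro indep_var_lebesgue_integral)
qed

end

text \<open>\<open>\<Omega>\<close> need not be measurable in \<open>P\<close>; it will be a set of
  homeomorphisms inside a product over all reals. Equality of laws still passes to the trace, since
  each trace set is \<open>\<Omega>\<close> intersected with a measurable \<open>B\<close> having
  the same preimage.\<close>

lemma distr_restrict_space_eq:
  assumes X: "X \<in> measurable M P" and Y: "Y \<in> measurable M P"
    and XO: "\<And>w. w \<in> space M \<Longrightarrow> X w \<in> \<Omega>" and YO: "\<And>w. w \<in> space M \<Longrightarrow> Y w \<in> \<Omega>"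
    and eq: "distr M P X = distr M P Y"
  shows "distr M (restrict_space P \<Omega>) X = distr M (restrict_space P \<Omega>) Y"
proof (rule measure_eqI)
  fix A assume "A \<in> sets (distr M (restrict_space P \<Omega>) X)"
  then have "A \<in> sets (restrict_space P \<Omega>)" by simp
  then obtain B where B: "B \<in> sets P" "A = \<Omega> \<inter> B" by (auto simp: sets_restrict_space)
  have r: "Z \<in> measurable M (restrict_space P \<Omega>)" if "Z \<in> measurable M P" "\<And>w. w \<in> space M \<Longrightarrow> Z w \<in> \<Omega>" for Z
    using that by (intro measurable_restrict_space2) auto
  have "emeasure (distr M (restrict_space P \<Omega>) Z) A = emeasure (distr M P Z) B"
    if "Z \<in> measurable M P" "\<And>w. w \<in> space M \<Longrightarrow> Z w \<in> \<Omega>" for Z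
  proof -
    have "Z -` A \<inter> space M = Z -` B \<inter> space M" using that(2) B by auto
    then show ?thesis
      using r[OF that] that(1) B \<open>A \<in> sets (restrict_space P \<Omega>)\<close> by (simp add: emeasure_distr)
  qed
  from this[OF X XO] this[OF Y YO]
  show "emeasure (distr M (restrict_space P \<Omega>) X) A = emeasure (distr M (restrict_space P \<Omega>) Y) A"
    unfolding eq by simp
qed simp

lemma integrated_square_diff_near:
  assumes s: "s1 \<le> s2" and r: "\<And>x. x \<in> {s1..s2} \<Longrightarrow> {f x, g x, f' x, g' x} \<subseteq> {s1..s2}"
    and m: "f \<in> borel_measurable borel" "g \<in> borel_measurable borel" "f' \<in> borel_measurable borel" "g' \<in> borel_measurable borel"
    and n: "unif_near s1 s2 \<delta> f f'" "unif_near s1 s2 \<delta>' g g'"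
  shows "\<bar>(LINT x:{s1..s2}|lborel. (f x - g x)\<^sup>2) - (LINT x:{s1..s2}|lborel. (f' x - g' x)\<^sup>2)\<bar> \<le> 2 * (s2 - s1)\<^sup>2 * (\<delta> + \<delta>')"
proof -
  have b: "\<bar>f x - g x\<bar> \<le> s2 - s1" "\<bar>f' x - g' x\<bar> \<le> s2 - s1" if "x \<in> {s1..s2}" for x
    using r[OF that] by auto
  have sq: "\<bar>(u::real)\<^sup>2\<bar> \<le> (s2 - s1)\<^sup>2" if "\<bar>u\<bar> \<le> s2 - s1" for u
    using that s by (simp add: abs_le_square_iff[symmetric])
  have i: "set_integrable lborel {s1..s2} (\<lambda>x. (f x - g x)\<^sup>2)" "set_integrable lborel {s1..s2} (\<lambda>x. (f' x - g' x)\<^sup>2)"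
    using m b sq by (auto intro!: set_integrable_bounded_Icc[of _ _ _ "(s2 - s1)\<^sup>2"])
  have "\<bar>(f x - g x)\<^sup>2 - (f' x - g' x)\<^sup>2\<bar> \<le> 2 * (s2 - s1) * (\<delta> + \<delta>')" if x: "x \<in> {s1..s2}" for x
  proof -
    have "(f x - g x)\<^sup>2 - (f' x - g' x)\<^sup>2 = ((f x - g x) + (f' x - g' x)) * ((f x - f' x) - (g x - g' x))"
      by (simp add: power2_eq_square algebra_simps)
    also have "\<bar>\<dots>\<bar> \<le> (2 * (s2 - s1)) * (\<delta> + \<delta>')"
      unfolding abs_mult using b[OF x] unif_nearD[OF n(1) x] unif_nearD[OF n(2) x] s
      by (intro mult_mono) auto
    finally show ?thesis by simp
  qed
  then have "\<bar>LINT x:{s1..s2}|lborel. (f x - g x)\<^sup>2 - (f' x - g' x)\<^sup>2\<bar> \<le> (2 * (s2 - s1) * (\<delta> + \<delta>')) * (s2 - s1)"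
    using s m by (intro set_integral_abs_le_Icc) auto
  then show ?thesis
    using i by (simp add: set_integral_diff power2_eq_square mult.commute mult.left_commute mult.assoc)
qed

section \<open>The autoregressive process\<close>

lemma FN_component: "(\<lambda>f. f x) \<in> borel_measurable FN"
  unfolding FN_def by (rule measurable_component_singleton) simp

lemma measurable_FN_component: "X \<in> measurable N FN \<Longrightarrow> (\<lambda>w. X w x) \<in> borel_measurable N"
  using measurable_compose[OF _ FN_component] .

lemma measurable_FNI:
  assumes "\<And>x. (\<lambda>w. X w x) \<in> borel_measurable N"
  shows "X \<in> measurable N FN"
  unfolding FN_def using assms by (intro measurable_PiM_single') auto

locale stationary_ar = prob_space M for M :: "'w measure" +
  fixes s1 s2 c K :: real and p :: nat and astar :: "nat \<Rightarrow> real"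
    and T eps :: "nat \<Rightarrow> 'w \<Rightarrow> real \<Rightarrow> real"
  assumes s12: "s1 < s2" and p_ge_1: "p \<ge> 1" and c_pos: "c > 0"
    and astar_box: "\<forall>j\<in>{1..p}. -c \<le> astar j \<and> astar j \<le> c"
    and eps_meas: "\<forall>i>p. eps i \<in> measurable M FN"
    and eps_T: "\<forall>i>p. \<forall>w\<in>space M. eps i w \<in> Tset s1 s2"
    and eps_mean: "\<forall>i>p. \<forall>x\<in>{s1..s2}. integral\<^sup>L M (\<lambda>w. eps i w x) = x"
    and eps_indep: "indep_vars (\<lambda>_. FN) eps {p<..}"
    and eps_ident: "\<forall>i>p. distr M FN (eps i) = distr M FN (eps (Suc p))"
    and GMC: "\<exists>\<eta>>0. \<exists>S0. (\<forall>j\<in>{1..p}. S0 j \<in> Tset s1 s2) \<and> (\<exists>C>0. \<exists>r. 0 < r \<and> r < 1 \<and>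
        (\<forall>R. (\<forall>j\<in>{1..p}. R j \<in> Tset s1 s2) \<longrightarrow> (\<forall>m i. i \<ge> p + m \<longrightarrow>
          (\<integral>\<^sup>+ w. ennreal ((d1p s1 s2 p
               (upsilon_iter s1 s2 p astar (\<lambda>k. eps k w) i m S0)
               (upsilon_iter s1 s2 p astar (\<lambda>k. eps k w) i m R)) powr \<eta>) \<partial>M)
          \<le> ennreal (C * r ^ m * (d1p s1 s2 p S0 R) powr \<eta>))))"
    and T_meas: "\<forall>i. T i \<in> measurable M FN"
    and T_T: "\<forall>i\<ge>1. \<forall>w\<in>space M. T i w \<in> Tset s1 s2"
    and init_indep: "indep_var
        (PiM {1..p} (\<lambda>_. FN)) (\<lambda>w. restrict (\<lambda>j. T j w) {1..p})
        (PiM {p<..} (\<lambda>_. FN)) (\<lambda>w. restrict (\<lambda>i. eps i w) {p<..})"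
    and init_stationary: "distr M (PiM {1..p} (\<lambda>_. FN)) (\<lambda>w. restrict (\<lambda>j. T (Suc j) w) {1..p})
        = distr M (PiM {1..p} (\<lambda>_. FN)) (\<lambda>w. restrict (\<lambda>j. T j w) {1..p})"
    and recursion: "\<forall>i>p. \<forall>w\<in>space M.
        T i w = oplus (ar_comp s1 s2 astar (\<lambda>j. T (i - j) w) p) (eps i w)"
    and K_pos: "K > 0"
    and T_reg: "\<forall>i\<ge>1. \<forall>w\<in>space M.
        strict_mono_on {s1..s2} (T i w) \<and> T i w differentiable_on {s1..s2} \<and>
        (\<forall>x\<in>{s1..s2}. \<forall>y\<in>{s1..s2}.
           \<bar>T i w x - T i w y\<bar> \<le> K * \<bar>x - y\<bar> \<and> \<bar>x - y\<bar> \<le> K * \<bar>T i w x - T i w y\<bar>)"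
begin

abbreviation "D \<equiv> s2 - s1"
abbreviation fit :: "(nat \<Rightarrow> real) \<Rightarrow> nat \<Rightarrow> 'w \<Rightarrow> real \<Rightarrow> real" where
  "fit a k w \<equiv> ar_comp s1 s2 a (\<lambda>j. T (k - j) w) p"

lemma s12_le: "s1 \<le> s2" using s12 by simp

lemma T_bilip: "1 \<le> i \<Longrightarrow> w \<in> space M \<Longrightarrow> T i w \<in> bilip s1 s2 K"
  using T_reg T_T K_pos by (intro bilipI) auto

lemma T_homeo: "1 \<le> i \<Longrightarrow> w \<in> space M \<Longrightarrow> T i w \<in> homeo s1 s2"
  using T_bilip bilip_homeo by blast

lemma K_ge_1: "1 \<le> K"
proof -
  obtain w where "w \<in> space M" using not_empty by auto
  from bilip_ge_1[OF T_bilip[OF order_refl this] s12] show ?thesis .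
qed

lemma fit_homeo: "p < k \<Longrightarrow> w \<in> space M \<Longrightarrow> fit a k w \<in> homeo s1 s2"
  by (intro homeo_ar_comp T_homeo) auto

lemma T_eq: "p < i \<Longrightarrow> w \<in> space M \<Longrightarrow> T i w = eps i w \<circ> fit astar i w"
  using recursion by (simp add: oplus_def)

text \<open>No regularity is assumed of the innovations. It is inherited: the recursion can be
  solved for \<open>eps i w\<close>, as \<open>T i w\<close> after the inverse of the fitted map,
  and both of these are homeomorphisms.\<close>

lemma eps_homeo:
  assumes "p < i" "w \<in> space M"
  shows "eps i w \<in> homeo s1 s2"
proof -
  let ?C = "fit astar i w"
  have C: "?C \<in> homeo s1 s2" using fit_homeo[OF assms] .
  have T: "T i w \<in> homeo s1 s2" using assms by (intro T_homeo) auto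
  have "eps i w x = (T i w \<circ> tinv s1 s2 ?C) x" for x
  proof (cases "x \<in> {s1..s2}")
    case True
    then show ?thesis using tinv_homeo_right[OF C True] T_eq[OF assms] by simp
  next
    case False
    then show ?thesis
      using Tset_outside[OF homeo_Tset[OF T] False] Tset_outside[OF homeo_Tset[OF homeo_tinv[OF C]] False]
        Tset_outside[of "eps i w" s1 s2 x] eps_T assms by auto
  qed
  then have "eps i w = T i w \<circ> tinv s1 s2 ?C" by blast
  then show ?thesis using homeo_comp[OF T homeo_tinv[OF C]] by simp
qed

section \<open>Initial values, innovations and the sigma-algebras they generate\<close>

text \<open>Index \<open>p\<close> carries the initial values \<open>T\<^sub>1, \<dots>, T\<^sub>p\<close>, index \<open>j > p\<close> the innovation \<open>\<epsilon>\<^sub>j\<close>.\<close>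

definition source_events :: "nat \<Rightarrow> 'w set set" where
  "source_events i = (if i = p
     then {(\<lambda>w. restrict (\<lambda>j. T j w) {1..p}) -` A \<inter> space M |A. A \<in> sets (PiM {1..p} (\<lambda>_. FN))}
     else {eps i -` A \<inter> space M |A. A \<in> sets FN})"

text \<open>For \<open>p \<le> i\<close> the past always contains the initial block, the future only
  innovations. Both are sigma-algebras on the sample space itself, so the process and its iterates
  can be tested for measurability against them directly.\<close>

definition past :: "nat \<Rightarrow> 'w measure" where
  "past i = sigma (space M) (\<Union>j\<in>{p..i}. source_events j)"

definition future :: "nat \<Rightarrow> 'w measure" where
  "future i = sigma (space M) (\<Union>j\<in>{i<..}. source_events j)"

lemma source_events_sub: "p \<le> j \<Longrightarrow> source_events j \<subseteq> events"
proof (cases "j = p")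
  case True
  then show ?thesis
    using measurable_sets[OF indep_var_rv1[OF init_indep]] by (auto simp: source_events_def)
next
  case False
  assume "p \<le> j"
  then have "eps j \<in> measurable M FN" using False eps_meas by simp
  from measurable_sets[OF this] show ?thesis using False by (auto simp: source_events_def)
qed

lemma source_events_Int_stable: "Int_stable (source_events j)"
proof -
  have *: "Int_stable {f -` A \<inter> space M |A. A \<in> sets N}" for f :: "'w \<Rightarrow> 'b" and N :: "'b measure"
  proof (rule Int_stableI)
    fix a b assume "a \<in> {f -` A \<inter> space M |A. A \<in> sets N}" "b \<in> {f -` A \<inter> space M |A. A \<in> sets N}"
    then obtain A B where AB: "A \<in> sets N" "B \<in> sets N" "a = f -` A \<inter> space M" "b = f -` B \<inter> space M" by blast
    then have "a \<inter> b = f -` (A \<inter> B) \<inter> space M" "A \<inter> B \<in> sets N" by auto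
    then show "a \<inter> b \<in> {f -` A \<inter> space M |A. A \<in> sets N}" by blast
  qed
  show ?thesis
  proof (cases "j = p")
    case True then show ?thesis unfolding source_events_def by (simp only: if_True refl *)
  next
    case False then show ?thesis unfolding source_events_def by (simp only: if_False *)
  qed
qed

text \<open>Two hypotheses are merged: the innovations are independent among themselves, and the
  initial block is independent of the innovation sequence as a whole. The factor of index
  \<open>p\<close> is split off by the second, the rest factorises by the first.\<close>

lemma indep_sources: "indep_sets source_events {p..}"
proof (rule indep_setsI)
  fix A J assume J: "J \<noteq> {}" "J \<subseteq> {p..}" "finite J" and A: "\<forall>j\<in>J. A j \<in> source_events j"
  have eps: "prob (\<Inter>j\<in>J'. A j) = (\<Prod>j\<in>J'. prob (A j))" if "J' \<noteq> {}" "J' \<subseteq> J - {p}" for J'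
  proof (rule indep_setsD)
    show "indep_sets (\<lambda>i. {eps i -` A \<inter> space M |A. A \<in> sets FN}) {p<..}"
      using eps_indep unfolding indep_vars_def2 by blast
    show "J' \<subseteq> {p<..}" using that J by force
    show "finite J'" using that J finite_subset by blast
    show "\<forall>j\<in>J'. A j \<in> {eps j -` A \<inter> space M |A. A \<in> sets FN}"
    proof
      fix j assume "j \<in> J'"
      then have "j \<noteq> p" "A j \<in> source_events j" using that A by auto
      then show "A j \<in> {eps j -` A \<inter> space M |A. A \<in> sets FN}" by (simp add: source_events_def)
    qed
  qed (use that in auto)
  show "prob (\<Inter>j\<in>J. A j) = (\<Prod>j\<in>J. prob (A j))"
  proof (cases "p \<in> J")
    case False
    then show ?thesis using J by (intro eps) auto
  next
    case True
    define J' where "J' = J - {p}"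
    have J': "J = insert p J'" "p \<notin> J'" "finite J'" using True J by (auto simp: J'_def)
    show ?thesis
    proof (cases "J' = {}")
      case True then show ?thesis using J' by simp
    next
      case False
      let ?P = "PiM {p<..} (\<lambda>_. FN)" and ?E = "\<lambda>w. restrict (\<lambda>i. eps i w) {p<..}"
      let ?Pinit = "PiM {1..p} (\<lambda>_. FN)" and ?I = "\<lambda>w. restrict (\<lambda>j. T j w) {1..p}"
      have "\<forall>j\<in>J'. \<exists>B\<in>sets FN. A j = eps j -` B \<inter> space M"
      proof
        fix j assume "j \<in> J'"
        then have "j \<noteq> p" "A j \<in> source_events j" using J' A by auto
        then show "\<exists>B\<in>sets FN. A j = eps j -` B \<inter> space M" by (auto simp: source_events_def)
      qed
      then obtain B where B: "\<And>j. j \<in> J' \<Longrightarrow> B j \<in> sets FN" "\<And>j. j \<in> J' \<Longrightarrow> A j = eps j -` B j \<inter> space M"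
        by metis
      have gt: "j \<in> {p<..}" if "j \<in> J'" for j using that J J' by (cases "j = p") auto
      \<comment> \<open>The innovation events are collected into one cylinder of the sequence space,
        the form in which \<open>init_indep\<close> applies.\<close>
      define S where "S = (\<Inter>j\<in>J'. (\<lambda>f. f j) -` B j \<inter> space ?P)"
      have S: "S \<in> sets ?P"
        unfolding S_def using J'(3) False
      proof (rule sets.finite_INT)
        fix j assume "j \<in> J'"
        then show "(\<lambda>f. f j) -` B j \<inter> space ?P \<in> sets ?P"
          using gt B(1) by (intro measurable_sets[OF measurable_component_singleton[of j "{p<..}"]]) auto
      qed
      have Esp: "?E w \<in> space ?P" if "w \<in> space M" for w
        using measurable_space[OF indep_var_rv2[OF init_indep] that] .
      have "(\<Inter>j\<in>J'. A j) = ?E -` S \<inter> space M"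
        using False B(2) gt Esp unfolding S_def by auto
      then have 2: "(\<Inter>j\<in>J'. A j) \<in> {?E -` A \<inter> space M |A. A \<in> sets ?P}" using S by blast
      have 1: "A p \<in> {?I -` A \<inter> space M |A. A \<in> sets ?Pinit}"
        using A True by (auto simp: source_events_def)
      have "prob (A p \<inter> (\<Inter>j\<in>J'. A j)) = prob (A p) * prob (\<Inter>j\<in>J'. A j)"
        by (rule indep_setD[OF conjunct2[OF init_indep[unfolded indep_var_eq]]])
          (use 1 2 in \<open>blast intro: sigma_sets.Basic\<close>)+
      also have "prob (\<Inter>j\<in>J'. A j) = (\<Prod>j\<in>J'. prob (A j))"
        using False by (intro eps) (auto simp: J'_def)
      finally show ?thesis using J' by (simp add: Inf_insert)
    qed
  qed
qed (use source_events_sub in auto)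

lemma past_sets: "sets (past i) = sigma_sets (space M) (\<Union>j\<in>{p..i}. source_events j)" "space (past i) = space M"
proof -
  have "(\<Union>j\<in>{p..i}. source_events j) \<subseteq> Pow (space M)"
    by (auto simp: source_events_def split: if_splits)
  then show "sets (past i) = sigma_sets (space M) (\<Union>j\<in>{p..i}. source_events j)" "space (past i) = space M"
    by (simp_all add: past_def)
qed

lemma future_sets: "sets (future i) = sigma_sets (space M) (\<Union>j\<in>{i<..}. source_events j)" "space (future i) = space M"
proof -
  have "(\<Union>j\<in>{i<..}. source_events j) \<subseteq> Pow (space M)"
    by (auto simp: source_events_def split: if_splits)
  then show "sets (future i) = sigma_sets (space M) (\<Union>j\<in>{i<..}. source_events j)" "space (future i) = space M"
    by (simp_all add: future_def)
qed

lemma subalgebra_past: "subalgebra M (past i)"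
proof -
  have "(\<Union>j\<in>{p..i}. source_events j) \<subseteq> events" using source_events_sub by fastforce
  then show ?thesis unfolding subalgebra_def past_sets by (simp add: sets.sigma_sets_subset)
qed

lemma subalgebra_future:
  assumes "p \<le> i"
  shows "subalgebra M (future i)"
proof -
  have "(\<Union>j\<in>{i<..}. source_events j) \<subseteq> events"
    using source_events_sub assms by (intro UN_least) auto
  then show ?thesis unfolding subalgebra_def future_sets by (simp add: sets.sigma_sets_subset)
qed

lemma measurable_past_mono:
  assumes "f \<in> measurable (past i) N" "i \<le> k"
  shows "f \<in> measurable (past k) N"
proof -
  have "(\<Union>j\<in>{p..i}. source_events j) \<subseteq> (\<Union>j\<in>{p..k}. source_events j)"
    using assms(2) by (intro UN_mono) auto
  then have "subalgebra (past k) (past i)"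
    unfolding subalgebra_def past_sets by (simp add: sigma_sets_mono')
  from measurable_from_subalg[OF this assms(1)] show ?thesis .
qed

lemma eps_in_space: "p < k \<Longrightarrow> w \<in> space M \<Longrightarrow> eps k w \<in> space FN"
  by (simp add: FN_def space_PiM)

lemma indep_past_future:
  assumes "p \<le> i"
  shows "indep_set (sets (past i)) (sets (future i))"
proof -
  let ?I = "\<lambda>b. if b then {p..i} else {i<..}"
  have "indep_sets (\<lambda>b. sigma_sets (space M) (\<Union>j\<in>?I b. source_events j)) UNIV"
  proof (rule indep_sets_collect_sigma)
    have "(\<Union>b\<in>UNIV. ?I b) = {p..}" using assms by (auto simp: UNIV_bool)
    then show "indep_sets source_events (\<Union>b\<in>UNIV. ?I b)" using indep_sources by simp
    show "disjoint_family_on ?I UNIV" by (auto simp: disjoint_family_on_def)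
  qed (rule source_events_Int_stable)
  then show ?thesis unfolding indep_set_def past_sets future_sets
    by (rule indep_sets_mono_sets) (auto split: bool.split)
qed

lemma measurable_sourceI:
  assumes X: "\<And>w. w \<in> space M \<Longrightarrow> X w \<in> space N"
    and L: "space L = space M" "\<And>A. A \<in> sets N \<Longrightarrow> X -` A \<inter> space M \<in> sets L"
  shows "X \<in> measurable L N"
  using assms by (intro measurableI) auto

lemma eps_measurable_past:
  assumes "p < k" "k \<le> i"
  shows "eps k \<in> measurable (past i) FN"
proof (rule measurable_sourceI)
  show "eps k -` A \<inter> space M \<in> sets (past i)" if "A \<in> sets FN" for A
    unfolding past_sets using assms that
    by (intro sigma_sets.Basic UN_I[of k]) (auto simp: source_events_def)
qed (simp_all add: eps_in_space assms past_sets)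

lemma eps_measurable_future:
  assumes "p \<le> i" "i < k"
  shows "eps k \<in> measurable (future i) FN"
proof (rule measurable_sourceI)
  show "eps k -` A \<inter> space M \<in> sets (future i)" if "A \<in> sets FN" for A
    unfolding future_sets using assms that
    by (intro sigma_sets.Basic UN_I[of k]) (auto simp: source_events_def)
qed (use assms in \<open>simp_all add: eps_in_space future_sets\<close>)

lemma init_measurable_past:
  assumes "p \<le> i"
  shows "(\<lambda>w. restrict (\<lambda>j. T j w) {1..p}) \<in> measurable (past i) (PiM {1..p} (\<lambda>_. FN))"
proof (rule measurable_sourceI)
  show "(\<lambda>w. restrict (\<lambda>j. T j w) {1..p}) -` A \<inter> space M \<in> sets (past i)" if "A \<in> sets (PiM {1..p} (\<lambda>_. FN))" for A
    unfolding past_sets using assms that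
    by (intro sigma_sets.Basic UN_I[of p]) (auto simp: source_events_def)
qed (simp_all only: measurable_space[OF indep_var_rv1[OF init_indep]] past_sets)

lemma eps_pw_past: "p < k \<Longrightarrow> k \<le> i \<Longrightarrow> pw_mono_map s1 s2 (past i) (eps k)"
  using eps_homeo past_sets by (intro pw_mono_map_homeo measurable_FN_component eps_measurable_past) auto

lemma eps_pw_future: "p \<le> i \<Longrightarrow> i < k \<Longrightarrow> pw_mono_map s1 s2 (future i) (eps k)"
  using eps_homeo future_sets by (intro pw_mono_map_homeo measurable_FN_component eps_measurable_future) auto

text \<open>\<open>T_meas\<close> gives measurability only for the full sigma-algebra. Adaptedness
  follows by unrolling the recursion down to the initial block.\<close>

lemma T_pw_past: "1 \<le> k \<Longrightarrow> k \<le> i \<Longrightarrow> p \<le> i \<Longrightarrow> pw_mono_map s1 s2 (past i) (T k)"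
proof (induction k rule: less_induct)
  case (less k)
  show ?case
  proof (cases "k \<le> p")
    case True
    have "(\<lambda>w. restrict (\<lambda>j. T j w) {1..p} k) \<in> measurable (past i) FN"
      using True less.prems
      by (intro measurable_compose[OF init_measurable_past measurable_component_singleton]) auto
    then have "T k \<in> measurable (past i) FN" using True less.prems by simp
    then show ?thesis
      using T_homeo less.prems past_sets by (intro pw_mono_map_homeo measurable_FN_component) auto
  next
    case False
    have "pw_mono_map s1 s2 (past i) (\<lambda>w. eps k w \<circ> fit astar k w)"
      using False less.prems s12
      by (intro pw_mono_map_comp eps_pw_past pw_mono_map_ar_comp less.IH) auto
    then show ?thesis by (rule pw_mono_map_cong) (use T_eq False past_sets in auto)
  qed
qed

lemma fit_pw_past: "p < k \<Longrightarrow> k \<le> Suc i \<Longrightarrow> p \<le> i \<Longrightarrow> pw_mono_map s1 s2 (past i) (fit a k)"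
  using s12 by (intro pw_mono_map_ar_comp T_pw_past) auto

end

section \<open>Coupling with the restarted iteration\<close>

lemma d1_triangle:
  assumes b: "f \<in> borel_measurable borel" "g \<in> borel_measurable borel" "h \<in> borel_measurable borel"
    and B: "\<And>x. x \<in> {s1..s2} \<Longrightarrow> \<bar>f x\<bar> \<le> B" "\<And>x. x \<in> {s1..s2} \<Longrightarrow> \<bar>g x\<bar> \<le> B" "\<And>x. x \<in> {s1..s2} \<Longrightarrow> \<bar>h x\<bar> \<le> B"
  shows "d1 s1 s2 f h \<le> d1 s1 s2 g f + d1 s1 s2 g h"
proof -
  have i: "set_integrable lborel {s1..s2} (\<lambda>x. \<bar>u x - v x\<bar>)"
    if "u \<in> borel_measurable borel" "v \<in> borel_measurable borel"
      "\<And>x. x \<in> {s1..s2} \<Longrightarrow> \<bar>u x\<bar> \<le> B" "\<And>x. x \<in> {s1..s2} \<Longrightarrow> \<bar>v x\<bar> \<le> B" for u v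
  proof (rule set_integrable_bounded_Icc)
    show "\<bar>\<bar>u x - v x\<bar>\<bar> \<le> B + B" if "x \<in> {s1..s2}" for x
      using \<open>\<And>x. x \<in> {s1..s2} \<Longrightarrow> \<bar>u x\<bar> \<le> B\<close>[OF that] \<open>\<And>x. x \<in> {s1..s2} \<Longrightarrow> \<bar>v x\<bar> \<le> B\<close>[OF that] by linarith
  qed (use that in auto)
  have "d1 s1 s2 f h \<le> (LINT x:{s1..s2}|lborel. \<bar>g x - f x\<bar> + \<bar>g x - h x\<bar>)"
    unfolding d1_def using b B by (intro set_integral_mono set_integral_add i) auto
  also have "\<dots> = d1 s1 s2 g f + d1 s1 s2 g h"
    unfolding d1_def using b B by (intro set_integral_add i)
  finally show ?thesis .
qed

lemma d1_le_d1p: "j \<in> {1..p} \<Longrightarrow> d1 s1 s2 (S j) (R j) \<le> d1p s1 s2 p S R"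
proof -
  assume j: "j \<in> {1..p}"
  have "d1 s1 s2 (S j) (R j) = sqrt ((d1 s1 s2 (S j) (R j))\<^sup>2)" using d1_nonneg by simp
  also have "\<dots> \<le> d1p s1 s2 p S R"
    unfolding d1p_def using j
    by (intro real_sqrt_le_mono member_le_sum[where f = "\<lambda>j. (d1 s1 s2 (S j) (R j))\<^sup>2"]) auto
  finally show ?thesis .
qed

lemma d1p_nonneg: "0 \<le> d1p s1 s2 p S R"
  by (simp add: d1p_def sum_nonneg)

lemma d1p_le:
  assumes "\<And>j. j \<in> {1..p} \<Longrightarrow> S j \<in> Tset s1 s2" "\<And>j. j \<in> {1..p} \<Longrightarrow> R j \<in> Tset s1 s2" "s1 \<le> s2"
  shows "d1p s1 s2 p S R \<le> sqrt (real p * ((s2 - s1)\<^sup>2)\<^sup>2)"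
proof -
  have "(\<Sum>j\<in>{1..p}. (d1 s1 s2 (S j) (R j))\<^sup>2) \<le> (\<Sum>j\<in>{1..p}. ((s2 - s1)\<^sup>2)\<^sup>2)"
    using assms d1_nonneg by (intro sum_mono power_mono d1_le) auto
  then show ?thesis unfolding d1p_def by (intro real_sqrt_le_mono) simp
qed

lemma d1p_cong:
  assumes "\<And>j. j \<in> {1..p} \<Longrightarrow> S j = S' j" "\<And>j. j \<in> {1..p} \<Longrightarrow> R j = R' j"
  shows "d1p s1 s2 p S R = d1p s1 s2 p S' R'"
  unfolding d1p_def using assms by simp

lemma integrated_square_diff_measurable:
  assumes "pw_mono_map s1 s2 N X" "pw_mono_map s1 s2 N Y"
  shows "(\<lambda>w. LINT x:{s1..s2}|lborel. (X w x - Y w x)\<^sup>2) \<in> borel_measurable N"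
  unfolding set_lebesgue_integral_def
proof (rule lborel.borel_measurable_lebesgue_integral)
  show "(\<lambda>(w, x). indicator {s1..s2} x *\<^sub>R (X w x - Y w x)\<^sup>2) \<in> borel_measurable (N \<Otimes>\<^sub>M lborel)"
    using pw_mono_map_measurable[OF assms(1)] pw_mono_map_measurable[OF assms(2)]
    by (auto simp: split_beta' cong: measurable_cong_sets) 
qed

lemma integrated_square_diff_bound:
  assumes "s1 \<le> s2" "f \<in> Tset s1 s2" "g \<in> Tset s1 s2"
  shows "\<bar>LINT x:{s1..s2}|lborel. (f x - g x)\<^sup>2\<bar> \<le> (s2 - s1) ^ 3"
proof -
  have "\<bar>(f x - g x)\<^sup>2\<bar> \<le> (s2 - s1)\<^sup>2" if "x \<in> {s1..s2}" for x
    using Tset_range[OF assms(2) that] Tset_range[OF assms(3) that] by (auto simp: abs_le_square_iff[symmetric])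
  then have "\<bar>LINT x:{s1..s2}|lborel. (f x - g x)\<^sup>2\<bar> \<le> (s2 - s1)\<^sup>2 * (s2 - s1)"
    using assms Tset_borel by (intro set_integral_abs_le_Icc) auto
  then show ?thesis by (simp add: power3_eq_cube power2_eq_square)
qed

context stationary_ar
begin

abbreviation iter :: "'w \<Rightarrow> nat \<Rightarrow> nat \<Rightarrow> (nat \<Rightarrow> real \<Rightarrow> real) \<Rightarrow> nat \<Rightarrow> real \<Rightarrow> real" where
  "iter w k m R \<equiv> upsilon_iter s1 s2 p astar (\<lambda>k. eps k w) k m R"

abbreviation window :: "nat \<Rightarrow> 'w \<Rightarrow> nat \<Rightarrow> real \<Rightarrow> real" where
  "window k w \<equiv> \<lambda>j. T (k - p + j) w"

text \<open>A window lists its maps oldest first, so entry \<open>p + 1 - i\<close> of the window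
  ending at \<open>k - 1\<close> is the map at lag \<open>i\<close> from \<open>k\<close>. One
  application of \<open>upsilon\<close> therefore performs one step of the recursion.\<close>

lemma upsilon_window:
  assumes k: "p < k" and w: "w \<in> space M" and S: "\<And>j. j \<in> {1..p} \<Longrightarrow> S j = window (k - 1) w j"
    and j: "j \<in> {1..p}"
  shows "upsilon s1 s2 p astar (eps k w) S j = window k w j"
proof (cases "j < p")
  case True
  have eq: "k - 1 - p + Suc j = k - p + j" using k by simp
  have "S (Suc j) = T (k - p + j) w" using True S[of "Suc j"] unfolding eq by simp
  then show ?thesis using True j by (simp add: upsilon_def)
next
  case False
  have "ar_comp s1 s2 astar (\<lambda>i. S (p + 1 - i)) p = fit astar k w"
  proof (rule ar_comp_cong)
    fix i assume i: "i \<in> {1..p}"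
    then have "k - 1 - p + (p + 1 - i) = k - i" "p + 1 - i \<in> {1..p}" using k by auto
    then show "S (p + 1 - i) = T (k - i) w" using S[of "p + 1 - i"] by simp
  qed
  then show ?thesis using False j T_eq[OF k w] k by (simp add: upsilon_def oplus_def)
qed

text \<open>Exhibits the current window as a function of the window \<open>m\<close> steps earlier
  and of later innovations only, ready for freezing the former.\<close>

lemma iter_window:
  assumes "p + m \<le> k" "w \<in> space M" "j \<in> {1..p}"
  shows "iter w k m (window (k - m) w) j = window k w j"
  using assms
proof (induction m arbitrary: k j)
  case (Suc m)
  have "iter w (k - 1) m (window (k - 1 - m) w) i = window (k - 1) w i" if "i \<in> {1..p}" for i
    using Suc.prems that by (intro Suc.IH) auto
  then show ?case
    unfolding upsilon_iter.simps using Suc.prems by (intro upsilon_window) auto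
qed simp

lemma iter_homeo:
  assumes "p + m \<le> k" "w \<in> space M" "\<And>j. j \<in> {1..p} \<Longrightarrow> R j \<in> homeo s1 s2" "j \<in> {1..p}"
  shows "iter w k m R j \<in> homeo s1 s2"
  using assms(1,4)
proof (induction m arbitrary: k j)
  case (Suc m)
  have IH: "iter w (k - 1) m R i \<in> homeo s1 s2" if "i \<in> {1..p}" for i
    using Suc.prems that by (intro Suc.IH) auto
  show ?case
  proof (cases "j < p")
    case True then show ?thesis using IH[of "Suc j"] Suc.prems by (simp add: upsilon_def)
  next
    case False
    have "eps k w \<circ> ar_comp s1 s2 astar (\<lambda>i. iter w (k - 1) m R (p + 1 - i)) p \<in> homeo s1 s2"
      using Suc.prems assms(2) by (intro homeo_comp eps_homeo homeo_ar_comp IH) auto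
    then show ?thesis using False Suc.prems by (simp add: upsilon_def oplus_def o_def)
  qed
qed (use assms in auto)

lemma iter_pw_future:
  assumes "p + m \<le> k" "\<And>j. j \<in> {1..p} \<Longrightarrow> R j \<in> Tset s1 s2" "j \<in> {1..p}"
  shows "pw_mono_map s1 s2 (future (k - m)) (\<lambda>w. iter w k m R j)"
  using assms by (intro pw_mono_map_upsilon_iter[where S = "\<lambda>j w. R j"] pw_mono_map_Tset_const s12_le eps_pw_future) auto

lemma pw_mono_map_of_past: "pw_mono_map s1 s2 (past i) X \<Longrightarrow> pw_mono_map s1 s2 M X"
  using pw_mono_map_measurable_space[of s1 s2 "past i" X "\<lambda>w. w" M]
    measurable_from_subalg[OF subalgebra_past measurable_ident[unfolded id_def]] by blast

lemma pw_mono_map_of_future: "p \<le> i \<Longrightarrow> pw_mono_map s1 s2 (future i) X \<Longrightarrow> pw_mono_map s1 s2 M X"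
  using pw_mono_map_measurable_space[of s1 s2 "future i" X "\<lambda>w. w" M]
    measurable_from_subalg[OF subalgebra_future measurable_ident[unfolded id_def]] by blast

lemma T_pw: "1 \<le> k \<Longrightarrow> pw_mono_map s1 s2 M (T k)"
  by (rule pw_mono_map_of_past[of "k + p"]) (simp add: T_pw_past)

lemma window_pw: "1 \<le> j \<Longrightarrow> pw_mono_map s1 s2 M (\<lambda>w. window k w j)"
  by (intro T_pw) simp

lemma fit_pw: "p < k \<Longrightarrow> pw_mono_map s1 s2 M (fit a k)"
  by (rule pw_mono_map_of_past[of "k + p"]) (simp add: fit_pw_past)

lemma iter_pw:
  assumes "p + m \<le> k" "\<And>j. j \<in> {1..p} \<Longrightarrow> R j \<in> Tset s1 s2" "j \<in> {1..p}"
  shows "pw_mono_map s1 s2 M (\<lambda>w. iter w k m R j)"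
  using assms by (intro pw_mono_map_of_future[OF _ iter_pw_future]) auto

text \<open>The distance from the stationary window to the iterate started at \<open>id\<close> is controlled through
  the iterate started at the reference point \<open>S0\<close> of the moment contraction.\<close>

definition coupling_gap :: "real \<Rightarrow> (nat \<Rightarrow> real \<Rightarrow> real) \<Rightarrow> nat \<Rightarrow> nat \<Rightarrow> 'w \<Rightarrow> real" where
  "coupling_gap \<eta> S0 k m w =
     d1p s1 s2 p (iter w k m S0) (window k w) powr \<eta> +
     d1p s1 s2 p (iter w k m S0) (iter w k m (\<lambda>_. id)) powr \<eta>"

lemma coupling_parts_measurable:
  assumes "p + m \<le> k" "\<And>j. j \<in> {1..p} \<Longrightarrow> S0 j \<in> Tset s1 s2"
  shows "(\<lambda>w. d1p s1 s2 p (iter w k m S0) (window k w)) \<in> borel_measurable M"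
    and "(\<lambda>w. d1p s1 s2 p (iter w k m S0) (iter w k m (\<lambda>_. id))) \<in> borel_measurable M"
proof -
  show "(\<lambda>w. d1p s1 s2 p (iter w k m S0) (window k w)) \<in> borel_measurable M"
  proof (rule d1p_measurable[where X = "\<lambda>j w. iter w k m S0 j" and Y = "\<lambda>j w. window k w j"])
    fix j assume j: "j \<in> {1..p}"
    show "pw_mono_map s1 s2 M (\<lambda>w. iter w k m S0 j)" by (rule iter_pw[OF assms j])
    show "pw_mono_map s1 s2 M (\<lambda>w. window k w j)" using j by (intro window_pw) simp
  qed
  show "(\<lambda>w. d1p s1 s2 p (iter w k m S0) (iter w k m (\<lambda>_. id))) \<in> borel_measurable M"
  proof (rule d1p_measurable[where X = "\<lambda>j w. iter w k m S0 j" and Y = "\<lambda>j w. iter w k m (\<lambda>_. id) j"])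
    fix j assume j: "j \<in> {1..p}"
    show "pw_mono_map s1 s2 M (\<lambda>w. iter w k m S0 j)" by (rule iter_pw[OF assms j])
    show "pw_mono_map s1 s2 M (\<lambda>w. iter w k m (\<lambda>_. id) j)"
      by (rule iter_pw[OF assms(1) _ j]) (rule homeo_Tset[OF homeo_id])
  qed
qed

lemma coupling_gap_measurable:
  assumes "p + m \<le> k" "\<And>j. j \<in> {1..p} \<Longrightarrow> S0 j \<in> Tset s1 s2"
  shows "coupling_gap \<eta> S0 k m \<in> borel_measurable M"
proof -
  note [measurable] = coupling_parts_measurable[OF assms]
  show ?thesis unfolding coupling_gap_def[abs_def] by measurable
qed

text \<open>The contraction is applied twice: to the start \<open>id\<close>, and to the random
  stationary window. For the latter the starting window is frozen by independence, the contraction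
  holds for each frozen value, and integrating over the start changes nothing because the bound is
  uniform.\<close>

lemma moment_contraction:
  "\<exists>\<eta>>0. \<exists>S0 C r. (\<forall>j\<in>{1..p}. S0 j \<in> Tset s1 s2) \<and> 0 \<le> C \<and> 0 < r \<and> r < 1 \<and>
    (\<forall>k m. p + m \<le> k \<longrightarrow> (\<integral>\<^sup>+w. ennreal (coupling_gap \<eta> S0 k m w) \<partial>M) \<le> ennreal (C * r ^ m))"
proof -
  from GMC obtain \<eta> S0 C r where \<eta>: "0 < \<eta>" and S0: "\<forall>j\<in>{1..p}. S0 j \<in> Tset s1 s2" and C: "0 < C" "0 < r" "r < 1"
    and con0: "\<forall>R. (\<forall>j\<in>{1..p}. R j \<in> Tset s1 s2) \<longrightarrow> (\<forall>m i. i \<ge> p + m \<longrightarrow>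
          (\<integral>\<^sup>+ w. ennreal ((d1p s1 s2 p (iter w i m S0) (iter w i m R)) powr \<eta>) \<partial>M)
          \<le> ennreal (C * r ^ m * (d1p s1 s2 p S0 R) powr \<eta>))"
    by (elim exE conjE) (rule that)
  have S0': "S0 j \<in> Tset s1 s2" if "j \<in> {1..p}" for j using S0 that by blast
  note g = \<eta> S0' C
  have con: "(\<integral>\<^sup>+ w. ennreal (d1p s1 s2 p (iter w k m S0) (iter w k m R) powr \<eta>) \<partial>M)
          \<le> ennreal (C * r ^ m * d1p s1 s2 p S0 R powr \<eta>)"
    if "\<And>j. j \<in> {1..p} \<Longrightarrow> R j \<in> Tset s1 s2" "p + m \<le> k" for R m k
    using con0[rule_format, OF that] .
  have id: "id \<in> Tset s1 s2" using homeo_Tset homeo_id by blast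
  \<comment> \<open>The contraction bound depends on the start through its distance from
    \<open>S0\<close>. On \<open>Tset\<close> this distance is bounded, which allows random
    starts.\<close>
  define B where "B = sqrt (real p * ((s2 - s1)\<^sup>2)\<^sup>2) powr \<eta>"
  have con': "(\<integral>\<^sup>+ w. ennreal (d1p s1 s2 p (iter w k m S0) (iter w k m R) powr \<eta>) \<partial>M) \<le> ennreal (C * B * r ^ m)"
    if R: "\<And>j. j \<in> {1..p} \<Longrightarrow> R j \<in> Tset s1 s2" and k: "p + m \<le> k" for R m k
  proof -
    have "d1p s1 s2 p S0 R powr \<eta> \<le> B"
      unfolding B_def using g R s12 by (intro powr_mono2 d1p_le d1p_nonneg) auto
    then have "C * r ^ m * d1p s1 s2 p S0 R powr \<eta> \<le> C * r ^ m * B"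
      using g by (intro mult_left_mono) auto
    then have "C * r ^ m * d1p s1 s2 p S0 R powr \<eta> \<le> C * B * r ^ m"
      by (simp only: mult_ac)
    from order_trans[OF con[OF R k] ennreal_leI[OF this]] show ?thesis .
  qed
  have "(\<integral>\<^sup>+w. ennreal (coupling_gap \<eta> S0 k m w) \<partial>M) \<le> ennreal (2 * (C * B) * r ^ m)" if k: "p + m \<le> k" for k m
  proof -
    let ?a = "\<lambda>w. ennreal (d1p s1 s2 p (iter w k m S0) (window k w) powr \<eta>)"
    let ?b = "\<lambda>w. ennreal (d1p s1 s2 p (iter w k m S0) (iter w k m (\<lambda>_. id)) powr \<eta>)"
    note [measurable] = coupling_parts_measurable[OF k g(2)]
    have a: "integral\<^sup>N M ?a \<le> ennreal (C * B * r ^ m)"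
    proof -
      let ?G = "past (k - m)" and ?H = "future (k - m)"
      \<comment> \<open>The first coordinate supplies the starting window, the second the
        innovations after time \<open>k - m\<close>.\<close>
      let ?f = "\<lambda>z. ennreal (d1p s1 s2 p (iter (snd z) k m S0) (iter (snd z) k m (window (k - m) (fst z))) powr \<eta>)"
      have km: "p \<le> k - m" using k by simp
      have X: "pw_mono_map s1 s2 (?G \<Otimes>\<^sub>M ?H) (\<lambda>z. iter (snd z) k m S0 j)" if "j \<in> {1..p}" for j
        by (rule pw_mono_map_measurable_space[OF iter_pw_future[where R = S0, OF k S0' that] measurable_snd])
      have Y: "pw_mono_map s1 s2 (?G \<Otimes>\<^sub>M ?H) (\<lambda>z. iter (snd z) k m (\<lambda>j. window (k - m) (fst z) j) j)" if "j \<in> {1..p}" for j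
        using k that
        by (intro pw_mono_map_upsilon_iter[where S = "\<lambda>j z. window (k - m) (fst z) j" and e = "\<lambda>k z. eps k (snd z)"] s12_le
            pw_mono_map_measurable_space[OF T_pw_past measurable_fst]
            pw_mono_map_measurable_space[OF eps_pw_future measurable_snd]) auto
      have f: "?f \<in> borel_measurable (?G \<Otimes>\<^sub>M ?H)"
        using d1p_measurable[OF X Y] by measurable
      have "integral\<^sup>N M ?a = (\<integral>\<^sup>+w. ?f (w, w) \<partial>M)"
      proof (rule nn_integral_cong)
        fix w assume "w \<in> space M"
        then have "d1p s1 s2 p (iter w k m S0) (window k w) = d1p s1 s2 p (iter w k m S0) (iter w k m (window (k - m) w))"
          by (intro d1p_cong refl iter_window[OF k, symmetric])
        then show "?a w = ?f (w, w)" by simp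
      qed
      also have "\<dots> = (\<integral>\<^sup>+w'. \<integral>\<^sup>+w. ?f (w', w) \<partial>M \<partial>M)"
        by (rule nn_integral_decouple[OF subalgebra_past subalgebra_future[OF km] indep_past_future[OF km] f])
      also have "\<dots> \<le> (\<integral>\<^sup>+w'. ennreal (C * B * r ^ m) \<partial>M)"
        using T_homeo homeo_Tset k by (intro nn_integral_mono) (auto intro!: con')
      finally show ?thesis by (simp add: emeasure_space_1)
    qed
    have "(\<integral>\<^sup>+w. ennreal (coupling_gap \<eta> S0 k m w) \<partial>M) = integral\<^sup>N M ?a + integral\<^sup>N M ?b"
      by (subst nn_integral_add[symmetric]) (auto simp: coupling_gap_def)
    also have "\<dots> \<le> ennreal (C * B * r ^ m) + ennreal (C * B * r ^ m)"
      using a con'[of "\<lambda>_. id", OF id k] by (rule add_mono)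
    also have "\<dots> = ennreal (2 * (C * B) * r ^ m)"
      using g by (subst ennreal_plus[symmetric]) (auto simp: B_def algebra_simps)
    finally show ?thesis .
  qed
  then show ?thesis using g
    by (intro exI[of _ \<eta>] exI[of _ S0] exI[of _ "2 * (C * B)"] exI[of _ r] conjI) (auto simp: B_def)
qed

lemma coupling_gap_small:
  assumes k: "p + m \<le> k" and w: "w \<in> space M" and S0: "\<And>j. j \<in> {1..p} \<Longrightarrow> S0 j \<in> Tset s1 s2"
    and \<eta>: "0 < \<eta>" and t: "0 < t" and gap: "coupling_gap \<eta> S0 k m w \<le> t powr \<eta>" and j: "j \<in> {1..p}"
  shows "d1 s1 s2 (window k w j) (iter w k m (\<lambda>_. id) j) \<le> 2 * t"
proof -
  let ?u = "iter w k m S0" and ?v = "window k w" and ?w = "iter w k m (\<lambda>_. id)"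
  have id: "id \<in> homeo s1 s2" using homeo_id by blast
  have le: "d1p s1 s2 p ?u R \<le> t" if "d1p s1 s2 p ?u R powr \<eta> \<le> t powr \<eta>" for R
    using that \<eta> t d1p_nonneg[of s1 s2 p ?u R] powr_less_mono2[of \<eta> t "d1p s1 s2 p ?u R"] by linarith
  have "d1p s1 s2 p ?u ?v powr \<eta> \<le> t powr \<eta>" "d1p s1 s2 p ?u ?w powr \<eta> \<le> t powr \<eta>"
    using gap by (simp_all add: coupling_gap_def) (smt (verit) powr_ge_zero)+
  then have d: "d1 s1 s2 (?u j) (?v j) \<le> t" "d1 s1 s2 (?u j) (?w j) \<le> t"
    using order_trans[OF d1_le_d1p[OF j] le] by blast+
  have U: "pw_mono_map s1 s2 M (\<lambda>w. iter w k m S0 j)" using iter_pw[OF k S0 j] .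
  \<comment> \<open>The iterates from \<open>S0\<close> may leave the interval, so integrability for
    the triangle inequality comes from the bound carried by \<open>pw_mono_map\<close>.\<close>
  obtain B where B: "\<And>w x. w \<in> space M \<Longrightarrow> \<bar>iter w k m S0 j x\<bar> \<le> max B \<bar>x\<bar>"
    by (rule pw_mono_map_bound[OF U]) blast
  have v: "?v j \<in> Tset s1 s2" using T_T w j by simp
  have idT: "?w j \<in> Tset s1 s2" by (rule homeo_Tset[OF iter_homeo[OF k w _ j]]) (rule id)
  define B' where "B' = max B (max \<bar>s1\<bar> \<bar>s2\<bar>)"
  have le_ends: "\<bar>y\<bar> \<le> max \<bar>s1\<bar> \<bar>s2\<bar>" if "y \<in> {s1..s2}" for y using that by auto
  have "d1 s1 s2 (?v j) (?w j) \<le> d1 s1 s2 (?u j) (?v j) + d1 s1 s2 (?u j) (?w j)"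
  proof (rule d1_triangle[where B = B'])
    fix x assume x: "x \<in> {s1..s2}"
    have "max B \<bar>x\<bar> \<le> B'" unfolding B'_def using x by (intro max.mono) auto
    with B[OF w, of x] show "\<bar>?u j x\<bar> \<le> B'" by linarith
    show "\<bar>?v j x\<bar> \<le> B'" "\<bar>?w j x\<bar> \<le> B'"
      unfolding B'_def using le_ends[OF Tset_range[OF v x]] le_ends[OF Tset_range[OF idT x]]
      by (simp_all only: max.coboundedI2)
  qed (use Tset_borel[OF v] Tset_borel[OF idT] pw_mono_map_section_borel[OF U w] in auto)
  then show ?thesis using d by linarith
qed

section \<open>The one-step loss and its restarted version\<close>

definition loss :: "(nat \<Rightarrow> real) \<Rightarrow> nat \<Rightarrow> 'w \<Rightarrow> real" where
  "loss a k w = (LINT x:{s1..s2}|lborel. (T k w x - fit a k w x)\<^sup>2)"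

text \<open>Both indices drop by one in the regressors, so they restart at the same time
  \<open>k - m\<close> as the response; hence the value depends only on innovations after that time.
  Entry \<open>p + 1 - j\<close> is lag \<open>j\<close>.\<close>

definition loss_iter :: "(nat \<Rightarrow> real) \<Rightarrow> nat \<Rightarrow> nat \<Rightarrow> 'w \<Rightarrow> real" where
  "loss_iter a k m w = (LINT x:{s1..s2}|lborel. (iter w k m (\<lambda>_. id) p x
     - ar_comp s1 s2 a (\<lambda>j. iter w (k - 1) (m - 1) (\<lambda>_. id) (p + 1 - j)) p x)\<^sup>2)"

lemma loss_bound: "p < k \<Longrightarrow> w \<in> space M \<Longrightarrow> \<bar>loss a k w\<bar> \<le> D ^ 3"
  unfolding loss_def using T_homeo fit_homeo
  by (intro integrated_square_diff_bound s12_le homeo_Tset) auto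

lemma loss_measurable_past: "p < k \<Longrightarrow> loss a k \<in> borel_measurable (past k)"
  unfolding loss_def by (intro integrated_square_diff_measurable T_pw_past fit_pw_past) auto

lemma loss_measurable: "p < k \<Longrightarrow> loss a k \<in> borel_measurable M"
  using measurable_from_subalg[OF subalgebra_past loss_measurable_past] .

lemma iter_id_homeo: "p + m \<le> k \<Longrightarrow> w \<in> space M \<Longrightarrow> j \<in> {1..p} \<Longrightarrow> iter w k m (\<lambda>_. id) j \<in> homeo s1 s2"
  by (intro iter_homeo homeo_id) auto

lemma loss_iter_bound:
  assumes "1 \<le> m" "p + m \<le> k" "w \<in> space M"
  shows "\<bar>loss_iter a k m w\<bar> \<le> D ^ 3"
  unfolding loss_iter_def using assms p_ge_1
  by (intro integrated_square_diff_bound s12_le homeo_Tset homeo_ar_comp iter_id_homeo) auto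

lemma loss_iter_measurable_future:
  assumes "1 \<le> m" "p + m \<le> k"
  shows "loss_iter a k m \<in> borel_measurable (future (k - m))"
proof -
  have id: "id \<in> Tset s1 s2" using homeo_Tset homeo_id by blast
  have "pw_mono_map s1 s2 (future (k - 1 - (m - 1))) (\<lambda>w. iter w (k - 1) (m - 1) (\<lambda>_. id) (p + 1 - j))"
    if "j \<in> {1..p}" for j
    using assms id that by (intro iter_pw_future) auto
  moreover have "k - 1 - (m - 1) = k - m" using assms by simp
  ultimately show ?thesis
    unfolding loss_iter_def using assms id p_ge_1
    by (intro integrated_square_diff_measurable iter_pw_future pw_mono_map_ar_comp s12_le) auto
qed

lemma loss_iter_measurable: "1 \<le> m \<Longrightarrow> p + m \<le> k \<Longrightarrow> loss_iter a k m \<in> borel_measurable M"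
  by (rule measurable_from_subalg[OF subalgebra_future loss_iter_measurable_future]) auto

text \<open>Small gaps give small \<open>d1\<close> distances, these give uniform closeness of the
  observed to the restarted maps, and this passes through the fitted composition to the loss. The
  threshold \<open>t\<close> is chosen before all of \<open>\<eta>\<close>, \<open>S0\<close>,
  \<open>k\<close>, \<open>m\<close> and \<open>w\<close>.\<close>

lemma loss_near_iter:
  assumes a: "\<And>j. j \<in> {1..p} \<Longrightarrow> \<bar>a j\<bar> \<le> c" and \<tau>: "0 < \<tau>"
  shows "\<exists>t>0. \<forall>\<eta> S0 k m w. 0 < \<eta> \<longrightarrow> (\<forall>j\<in>{1..p}. S0 j \<in> Tset s1 s2) \<longrightarrow> 1 \<le> m \<longrightarrow> p + m \<le> k \<longrightarrow>
     w \<in> space M \<longrightarrow> coupling_gap \<eta> S0 k m w \<le> t powr \<eta> \<longrightarrow> coupling_gap \<eta> S0 (k - 1) (m - 1) w \<le> t powr \<eta> \<longrightarrow>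
     \<bar>loss a k w - loss_iter a k m w\<bar> \<le> \<tau>"
proof -
  define L where "L = smult_const K c"
  have L: "1 \<le> L" unfolding L_def by (rule smult_const_ge_1[OF K_ge_1])
  \<comment> \<open>Total amplification of a uniform error: 1 from the response, the rest from the
    \<open>p\<close> regressors in the fitted composition.\<close>
  define E where "E = 1 + real p * L ^ p * L"
  have E: "1 \<le> E" using L by (simp add: E_def)
  define \<delta> where "\<delta> = \<tau> / (2 * D\<^sup>2 * E)"
  have \<delta>: "0 < \<delta>" "2 * D\<^sup>2 * (\<delta> + real p * L ^ p * (L * \<delta>)) = \<tau>"
  proof -
    show "0 < \<delta>" using \<tau> E s12 by (simp add: \<delta>_def)
    have "\<delta> + real p * L ^ p * (L * \<delta>) = E * \<delta>" by (simp add: E_def algebra_simps)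
    then show "2 * D\<^sup>2 * (\<delta> + real p * L ^ p * (L * \<delta>)) = \<tau>" using E s12 by (simp add: \<delta>_def)
  qed
  \<comment> \<open>The triangle inequality through \<open>S0\<close> yields \<open>2 * t\<close>,
    which is half of the \<open>d1\<close> threshold for uniform closeness
    \<open>\<delta>\<close>.\<close>
  define t where "t = \<delta>\<^sup>2 / (16 * K)"
  have t: "0 < t" "2 * t < \<delta>\<^sup>2 / (4 * K)" using \<delta> K_pos by (auto simp: t_def field_simps)
  show ?thesis
  proof (intro exI[of _ t] conjI t(1) allI impI)
    fix \<eta> S0 k m w
    assume \<eta>: "0 < \<eta>" and S0': "\<forall>j\<in>{1..p}. S0 j \<in> Tset s1 s2" and m: "1 \<le> m" and k: "p + m \<le> k"
      and w: "w \<in> space M" and gap: "coupling_gap \<eta> S0 k m w \<le> t powr \<eta>" "coupling_gap \<eta> S0 (k - 1) (m - 1) w \<le> t powr \<eta>"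
    have S0: "S0 j \<in> Tset s1 s2" if "j \<in> {1..p}" for j using S0' that by blast
    have near: "unif_near s1 s2 \<delta> (window k' w j) (iter w k' m' (\<lambda>_. id) j)"
      if "p + m' \<le> k'" "coupling_gap \<eta> S0 k' m' w \<le> t powr \<eta>" "j \<in> {1..p}" for k' m' j
    proof (rule d1_small_imp_unif_near)
      have B: "window k' w j \<in> bilip s1 s2 K" using that w by (intro T_bilip) auto
      then show "window k' w j \<in> Tset s1 s2" "K-lipschitz_on {s1..s2} (window k' w j)"
        by (auto simp: bilip_def homeo_def)
      show "iter w k' m' (\<lambda>_. id) j \<in> Tset s1 s2" using iter_id_homeo[OF that(1) w that(3)] by (rule homeo_Tset)
      show "d1 s1 s2 (window k' w j) (iter w k' m' (\<lambda>_. id) j) < \<delta>\<^sup>2 / (4 * K)"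
        using coupling_gap_small[OF that(1) w S0 \<eta> t(1) that(2,3)] t(2) by linarith
    qed (use K_pos \<delta> s12 in auto)
    have n1: "unif_near s1 s2 \<delta> (T k w) (iter w k m (\<lambda>_. id) p)"
      using near[OF k gap(1), of p] p_ge_1 k by simp
    have n2: "unif_near s1 s2 \<delta> (T (k - j) w) (iter w (k - 1) (m - 1) (\<lambda>_. id) (p + 1 - j))" if "j \<in> {1..p}" for j
    proof -
      have eq: "k - 1 - p + (p + 1 - j) = k - j" "p + (m - 1) \<le> k - 1" "p + 1 - j \<in> {1..p}" using that k m by auto
      from near[OF eq(2) gap(2) eq(3)] show ?thesis unfolding eq(1) .
    qed
    have Th: "T (k - j) w \<in> bilip s1 s2 K" if "j \<in> {1..p}" for j using that k m w by (intro T_bilip) auto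
    have Ih: "iter w (k - 1) (m - 1) (\<lambda>_. id) (p + 1 - j) \<in> homeo s1 s2" if "j \<in> {1..p}" for j
      using that k m w by (intro iter_id_homeo) auto
    have n3: "unif_near s1 s2 (real p * L ^ p * (L * \<delta>)) (fit a k w)
        (ar_comp s1 s2 a (\<lambda>j. iter w (k - 1) (m - 1) (\<lambda>_. id) (p + 1 - j)) p)"
    proof (rule conjunct1[OF ar_comp_near])
      fix j assume j: "j \<in> {1..p}"
      show "L-lipschitz_on {s1..s2} (smult s1 s2 (a j) (T (k - j) w))"
        unfolding L_def by (rule smult_lipschitz_near(1)[OF Th[OF j] K_ge_1 a[OF j]])
      show "unif_near s1 s2 (L * \<delta>) (smult s1 s2 (a j) (T (k - j) w))
          (smult s1 s2 (a j) (iter w (k - 1) (m - 1) (\<lambda>_. id) (p + 1 - j)))"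
        unfolding L_def using \<delta>(1) by (intro smult_lipschitz_near(2)[OF Th[OF j] K_ge_1 a[OF j] Ih[OF j] n2[OF j]]) simp
      show "T (k - j) w \<in> homeo s1 s2" using bilip_homeo[OF Th[OF j]] .
      show "iter w (k - 1) (m - 1) (\<lambda>_. id) (p + 1 - j) \<in> homeo s1 s2" using Ih[OF j] .
    qed (use L \<delta>(1) in auto)
    have h: "T k w \<in> homeo s1 s2" "fit a k w \<in> homeo s1 s2" "iter w k m (\<lambda>_. id) p \<in> homeo s1 s2"
      "ar_comp s1 s2 a (\<lambda>j. iter w (k - 1) (m - 1) (\<lambda>_. id) (p + 1 - j)) p \<in> homeo s1 s2"
      using k m w p_ge_1 Ih by (auto intro!: T_homeo fit_homeo iter_id_homeo homeo_ar_comp)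
    have "\<bar>loss a k w - loss_iter a k m w\<bar> \<le> 2 * D\<^sup>2 * (\<delta> + real p * L ^ p * (L * \<delta>))"
      unfolding loss_def loss_iter_def
      by (rule integrated_square_diff_near[OF s12_le _ _ _ _ _ n1 n3])
        (use h homeo_range Tset_borel homeo_Tset in auto)
    then show "\<bar>loss a k w - loss_iter a k m w\<bar> \<le> \<tau>" unfolding \<delta>(2) .
  qed
qed

text \<open>A Markov argument: where both gaps are small the losses are close; elsewhere their
  difference is bounded and the gaps, whose means decay geometrically, exceed a fixed level.\<close>

lemma loss_approx:
  assumes a: "\<And>j. j \<in> {1..p} \<Longrightarrow> \<bar>a j\<bar> \<le> c" and \<tau>: "0 < \<tau>"
  shows "\<exists>m\<ge>1. \<forall>k\<ge>p + m. expectation (\<lambda>w. \<bar>loss a k w - loss_iter a k m w\<bar>) \<le> \<tau>"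
proof -
  obtain \<eta> S0 C r where g: "0 < \<eta>" "\<And>j. j \<in> {1..p} \<Longrightarrow> S0 j \<in> Tset s1 s2" "0 \<le> C" "0 < r" "r < 1"
    and con: "\<And>k m. p + m \<le> k \<Longrightarrow> (\<integral>\<^sup>+w. ennreal (coupling_gap \<eta> S0 k m w) \<partial>M) \<le> ennreal (C * r ^ m)"
    using moment_contraction by blast
  have "0 < \<tau> / 2" using \<tau> by simp
  from loss_near_iter[where a = a, OF a this] obtain t where t: "0 < t" and near0: "\<forall>\<eta> S0 k m w. 0 < \<eta> \<longrightarrow> (\<forall>j\<in>{1..p}. S0 j \<in> Tset s1 s2) \<longrightarrow> 1 \<le> m \<longrightarrow> p + m \<le> k \<longrightarrow>
     w \<in> space M \<longrightarrow> coupling_gap \<eta> S0 k m w \<le> t powr \<eta> \<longrightarrow> coupling_gap \<eta> S0 (k - 1) (m - 1) w \<le> t powr \<eta> \<longrightarrow>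
     \<bar>loss a k w - loss_iter a k m w\<bar> \<le> \<tau> / 2"
    by blast
  have near: "\<bar>loss a k w - loss_iter a k m w\<bar> \<le> \<tau> / 2" if "1 \<le> m" "p + m \<le> k" "w \<in> space M"
    "coupling_gap \<eta> S0 k m w \<le> t powr \<eta>" "coupling_gap \<eta> S0 (k - 1) (m - 1) w \<le> t powr \<eta>" for k m w
    using near0[rule_format, OF g(1) g(2) that] .
  \<comment> \<open>Where one gap exceeds \<open>t powr \<eta>\<close>, the crude bound
    \<open>2 * D ^ 3\<close> on the difference is at most \<open>A\<close> times the sum of the
    gaps.\<close>
  define A where "A = 2 * D ^ 3 / t powr \<eta>"
  have A: "0 \<le> A" using s12 by (simp add: A_def)
  have gap_nonneg: "0 \<le> coupling_gap \<eta> S0 k m w" for k m w by (simp add: coupling_gap_def)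
  have bound: "\<bar>loss a k w - loss_iter a k m w\<bar> \<le> \<tau> / 2 + A * (coupling_gap \<eta> S0 k m w + coupling_gap \<eta> S0 (k - 1) (m - 1) w)"
    if "1 \<le> m" "p + m \<le> k" "w \<in> space M" for k m w
  proof (cases "coupling_gap \<eta> S0 k m w \<le> t powr \<eta> \<and> coupling_gap \<eta> S0 (k - 1) (m - 1) w \<le> t powr \<eta>")
    case True
    then have "\<bar>loss a k w - loss_iter a k m w\<bar> \<le> \<tau> / 2" using near[OF that] by blast
    moreover have "0 \<le> A * (coupling_gap \<eta> S0 k m w + coupling_gap \<eta> S0 (k - 1) (m - 1) w)"
      using A gap_nonneg by (intro mult_nonneg_nonneg add_nonneg_nonneg) auto
    ultimately show ?thesis by linarith
  next
    case False
    then have "t powr \<eta> \<le> coupling_gap \<eta> S0 k m w + coupling_gap \<eta> S0 (k - 1) (m - 1) w"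
      using gap_nonneg[of k m w] gap_nonneg[of "k - 1" "m - 1" w] by auto
    from mult_left_mono[OF this A]
    have "2 * D ^ 3 \<le> A * (coupling_gap \<eta> S0 k m w + coupling_gap \<eta> S0 (k - 1) (m - 1) w)"
      using t by (simp add: A_def)
    moreover have "\<bar>loss a k w\<bar> \<le> D ^ 3" "\<bar>loss_iter a k m w\<bar> \<le> D ^ 3"
      using that by (auto intro: loss_bound loss_iter_bound)
    ultimately show ?thesis using \<tau> by linarith
  qed
  \<comment> \<open>The restart length will be \<open>Suc n\<close>: the regressors have one step
    less, so \<open>r ^ n\<close> has to control both gaps.\<close>
  have "(\<lambda>n. (2 * A * C) * r ^ n) \<longlonglongrightarrow> (2 * A * C) * 0"
    using g by (intro tendsto_intros LIMSEQ_power_zero) auto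
  then have "\<forall>\<^sub>F n in sequentially. (2 * A * C) * r ^ n < \<tau> / 2"
    using \<tau> by (intro order_tendstoD) auto
  then obtain n where n: "(2 * A * C) * r ^ n < \<tau> / 2" by (auto simp: eventually_sequentially)
  show ?thesis
  proof (intro exI[of _ "Suc n"] conjI allI impI)
    fix k assume k: "p + Suc n \<le> k"
    have k': "p + n \<le> k - 1" using k by simp
    let ?L = "\<lambda>w. \<bar>loss a k w - loss_iter a k (Suc n) w\<bar>"
    have [measurable]: "loss a k \<in> borel_measurable M" "loss_iter a k (Suc n) \<in> borel_measurable M"
      "coupling_gap \<eta> S0 k (Suc n) \<in> borel_measurable M" "coupling_gap \<eta> S0 (k - 1) n \<in> borel_measurable M"
      using k k' g(2) by (auto intro: loss_measurable loss_iter_measurable coupling_gap_measurable)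
    have "\<bar>?L w\<bar> \<le> 2 * D ^ 3" if "w \<in> space M" for w
      using loss_bound[OF _ that, of k a] loss_iter_bound[OF _ k that, of a] k by auto
    then have iL: "integrable M ?L" by (intro integrable_bounded) auto
    have "ennreal (expectation ?L) = (\<integral>\<^sup>+w. ennreal (?L w) \<partial>M)"
      using iL by (intro nn_integral_eq_integral[symmetric]) auto
    also have "\<dots> \<le> (\<integral>\<^sup>+w. ennreal (\<tau> / 2) + ennreal A * (ennreal (coupling_gap \<eta> S0 k (Suc n) w) + ennreal (coupling_gap \<eta> S0 (k - 1) n w)) \<partial>M)"
    proof (rule nn_integral_mono)
      fix w assume "w \<in> space M"
      from bound[OF _ k this]
      have "ennreal (?L w) \<le> ennreal (\<tau> / 2 + A * (coupling_gap \<eta> S0 k (Suc n) w + coupling_gap \<eta> S0 (k - 1) n w))"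
        by (intro ennreal_leI) simp
      also have "\<dots> = ennreal (\<tau> / 2) + ennreal A * (ennreal (coupling_gap \<eta> S0 k (Suc n) w) + ennreal (coupling_gap \<eta> S0 (k - 1) n w))"
        using A \<tau> gap_nonneg by (simp add: ennreal_plus ennreal_mult)
      finally show "ennreal (?L w) \<le> ennreal (\<tau> / 2) + ennreal A * (ennreal (coupling_gap \<eta> S0 k (Suc n) w) + ennreal (coupling_gap \<eta> S0 (k - 1) n w))" .
    qed
    also have "\<dots> = ennreal (\<tau> / 2) + ennreal A * ((\<integral>\<^sup>+w. ennreal (coupling_gap \<eta> S0 k (Suc n) w) \<partial>M) + (\<integral>\<^sup>+w. ennreal (coupling_gap \<eta> S0 (k - 1) n w) \<partial>M))"
    proof -
      have split: "(\<integral>\<^sup>+w. ennreal (\<tau> / 2) + ennreal A * (f w + g w) \<partial>M) = ennreal (\<tau> / 2) + ennreal A * (integral\<^sup>N M f + integral\<^sup>N M g)"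
        if "f \<in> borel_measurable M" "g \<in> borel_measurable M" for f g
        using that by (simp add: nn_integral_add nn_integral_cmult emeasure_space_1)
      show ?thesis by (rule split) measurable
    qed
    also have "\<dots> \<le> ennreal (\<tau> / 2) + ennreal A * (ennreal (C * r ^ n) + ennreal (C * r ^ n))"
    proof (intro add_left_mono mult_left_mono add_mono)
      have "r ^ Suc n \<le> r ^ n" using g by (intro power_decreasing) auto
      then have "C * r ^ Suc n \<le> C * r ^ n" using g by (intro mult_left_mono)
      with con[OF k] show "(\<integral>\<^sup>+w. ennreal (coupling_gap \<eta> S0 k (Suc n) w) \<partial>M) \<le> ennreal (C * r ^ n)"
        using order_trans ennreal_leI by blast
      show "(\<integral>\<^sup>+w. ennreal (coupling_gap \<eta> S0 (k - 1) n w) \<partial>M) \<le> ennreal (C * r ^ n)" using con[OF k'] .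
    qed auto
    also have "\<dots> = ennreal (\<tau> / 2 + (2 * A * C) * r ^ n)"
    proof -
      have "ennreal (C * r ^ n) + ennreal (C * r ^ n) = ennreal (2 * C * r ^ n)"
        using g by (subst ennreal_plus[symmetric]) auto
      then show ?thesis using A g \<tau> by (simp add: ennreal_mult[symmetric] ennreal_plus[symmetric] mult_ac del: ennreal_plus)
    qed
    finally have "expectation ?L \<le> \<tau> / 2 + (2 * A * C) * r ^ n"
      using A g \<tau> by (subst (asm) ennreal_le_iff) auto
    then show "expectation ?L \<le> \<tau>" using n by linarith
  qed simp
qed

end

section \<open>Stationarity and consistency\<close>

lemma (in prob_space) distr_pair_subalgebras:
  assumes G: "subalgebra M G" and H: "subalgebra M H" and ind: "indep_set (sets G) (sets H)"
    and X: "X \<in> measurable G N1" and Y: "Y \<in> measurable H N2"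
  shows "distr M N1 X \<Otimes>\<^sub>M distr M N2 Y = distr M (N1 \<Otimes>\<^sub>M N2) (\<lambda>w. (X w, Y w))"
proof -
  note iv = distr_diagonal_indep[OF G H ind]
  note rv = indep_var_rv1[OF iv] indep_var_rv2[OF iv]
  have eq: "distr M G (\<lambda>w. w) \<Otimes>\<^sub>M distr M H (\<lambda>w. w) = distr M (G \<Otimes>\<^sub>M H) (\<lambda>w. (w, w))"
    using iv unfolding indep_var_distribution_eq by blast
  have XY: "distr (distr M G (\<lambda>w. w)) N1 X = distr M N1 X" "distr (distr M H (\<lambda>w. w)) N2 Y = distr M N2 Y"
    using distr_distr[OF X rv(1)] distr_distr[OF Y rv(2)] by (simp_all add: o_def)
  have Xd: "X \<in> measurable (distr M G (\<lambda>w. w)) N1" and Yd: "Y \<in> measurable (distr M H (\<lambda>w. w)) N2"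
    using X Y by simp_all
  have "prob_space (distr M N2 Y)"
    using measurable_from_subalg[OF H Y] by (rule prob_space_distr)
  then have sf: "sigma_finite_measure (distr (distr M H (\<lambda>w. w)) N2 Y)"
    unfolding XY by (simp add: prob_space_imp_sigma_finite)
  have "distr M N1 X \<Otimes>\<^sub>M distr M N2 Y = distr (distr M (G \<Otimes>\<^sub>M H) (\<lambda>w. (w, w))) (N1 \<Otimes>\<^sub>M N2) (\<lambda>(x, y). (X x, Y y))"
    using pair_measure_distr[OF Xd Yd sf] unfolding XY eq .
  also have "\<dots> = distr M (N1 \<Otimes>\<^sub>M N2) (\<lambda>w. (X w, Y w))"
    using X Y rv by (subst distr_distr) (auto intro: measurable_Pair simp: o_def)
  finally show ?thesis .
qed

context stationary_ar
begin

section \<open>The law of the window and stationarity of the loss\<close>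

abbreviation "windowM \<equiv> PiM {1..p} (\<lambda>_. FN)"
text \<open>The trace on homeomorphisms makes evaluation jointly measurable, so that one step of the
  recursion and the loss become measurable functions of a window and an innovation.\<close>

abbreviation "windowH \<equiv> restrict_space windowM {R. \<forall>j\<in>{1..p}. R j \<in> homeo s1 s2}"
abbreviation "epsH \<equiv> restrict_space FN (homeo s1 s2)"
definition "rwindow k w = restrict (window k w) {1..p}"

lemma rwindow_apply: "j \<in> {1..p} \<Longrightarrow> rwindow k w j = window k w j"
  by (simp add: rwindow_def)

lemma rwindow_homeo: "w \<in> space M \<Longrightarrow> rwindow k w \<in> {R. \<forall>j\<in>{1..p}. R j \<in> homeo s1 s2}"
  using T_homeo by (simp add: rwindow_apply)

lemma T_measurable_past: "1 \<le> k \<Longrightarrow> k \<le> i \<Longrightarrow> p \<le> i \<Longrightarrow> T k \<in> measurable (past i) FN"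
  by (intro measurable_FNI pw_mono_map_apply_id[OF T_pw_past]) auto

lemma rwindow_measurable_past:
  assumes "p \<le> i"
  shows "rwindow i \<in> measurable (past i) windowH"
proof (rule measurable_restrict_space2)
  show "rwindow i \<in> measurable (past i) windowM"
    unfolding rwindow_def using assms by (intro measurable_restrict T_measurable_past) auto
  show "rwindow i \<in> space (past i) \<rightarrow> {R. \<forall>j\<in>{1..p}. R j \<in> homeo s1 s2}"
    using rwindow_homeo unfolding past_sets by blast
qed

lemma rwindow_measurable: "p \<le> i \<Longrightarrow> rwindow i \<in> measurable M windowH"
  using measurable_from_subalg[OF subalgebra_past rwindow_measurable_past] .

lemma rwindow_measurable': "p \<le> i \<Longrightarrow> rwindow i \<in> measurable M windowM"
  using rwindow_measurable by (simp add: measurable_restrict_space2_iff)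

lemma eps_measurable_futureH:
  assumes "p \<le> i" "i < k"
  shows "eps k \<in> measurable (future i) epsH"
proof (rule measurable_restrict_space2)
  show "eps k \<in> space (future i) \<rightarrow> homeo s1 s2"
    using assms eps_homeo future_sets by auto
qed (rule eps_measurable_future[OF assms])

lemma pair_law:
  assumes "p \<le> i"
  shows "distr M windowH (rwindow i) \<Otimes>\<^sub>M distr M epsH (eps (Suc i))
    = distr M (windowH \<Otimes>\<^sub>M epsH) (\<lambda>w. (rwindow i w, eps (Suc i) w))"
    and "(\<lambda>w. (rwindow i w, eps (Suc i) w)) \<in> measurable M (windowH \<Otimes>\<^sub>M epsH)"
proof -
  have e: "eps (Suc i) \<in> measurable (future i) epsH"
    using assms by (intro eps_measurable_futureH) auto
  show "distr M windowH (rwindow i) \<Otimes>\<^sub>M distr M epsH (eps (Suc i))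
    = distr M (windowH \<Otimes>\<^sub>M epsH) (\<lambda>w. (rwindow i w, eps (Suc i) w))"
    by (rule distr_pair_subalgebras[OF subalgebra_past subalgebra_future[OF assms] indep_past_future[OF assms]
        rwindow_measurable_past[OF assms] e])
  show "(\<lambda>w. (rwindow i w, eps (Suc i) w)) \<in> measurable M (windowH \<Otimes>\<^sub>M epsH)"
    using rwindow_measurable[OF assms] measurable_from_subalg[OF subalgebra_future[OF assms] e]
    by (rule measurable_Pair)
qed

lemma windowH_pw:
  assumes "j \<in> {1..p}"
  shows "pw_mono_map s1 s2 (windowH \<Otimes>\<^sub>M epsH) (\<lambda>z. fst z j)"
proof -
  have "pw_mono_map s1 s2 windowH (\<lambda>R. R j)"
  proof (rule pw_mono_map_homeo)
    show "(\<lambda>R. R j x) \<in> borel_measurable windowH" for x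
      by (intro measurable_restrict_space1 measurable_FN_component measurable_component_singleton assms)
  qed (use assms in \<open>auto simp: space_restrict_space\<close>)
  from pw_mono_map_measurable_space[OF this measurable_fst] show ?thesis .
qed

lemma epsH_pw: "pw_mono_map s1 s2 (windowH \<Otimes>\<^sub>M epsH) (\<lambda>z. snd z)"
proof -
  have "pw_mono_map s1 s2 epsH (\<lambda>e. e)"
  proof (rule pw_mono_map_homeo)
    show "(\<lambda>e. e x) \<in> borel_measurable epsH" for x
      by (intro measurable_restrict_space1 FN_component)
  qed (auto simp: space_restrict_space)
  from pw_mono_map_measurable_space[OF this measurable_snd] show ?thesis .
qed

lemma upsilon_measurable:
  "(\<lambda>z. restrict (upsilon s1 s2 p astar (snd z) (fst z)) {1..p}) \<in> measurable (windowH \<Otimes>\<^sub>M epsH) windowM"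
proof (rule measurable_restrict)
  fix j assume j: "j \<in> {1..p}"
  have "pw_mono_map s1 s2 (windowH \<Otimes>\<^sub>M epsH) (\<lambda>z. upsilon s1 s2 p astar (snd z) (\<lambda>j. fst z j) j)"
    by (rule pw_mono_map_upsilon[where S = "\<lambda>j z. fst z j", OF windowH_pw epsH_pw s12_le j])
  from pw_mono_map_apply_id[OF this]
  show "(\<lambda>z. upsilon s1 s2 p astar (snd z) (fst z) j) \<in> measurable (windowH \<Otimes>\<^sub>M epsH) FN"
    by (intro measurable_FNI) simp
qed

lemma rwindow_Suc:
  assumes "p \<le> i" "w \<in> space M"
  shows "rwindow (Suc i) w = restrict (upsilon s1 s2 p astar (eps (Suc i) w) (rwindow i w)) {1..p}"
  unfolding rwindow_def[of "Suc i"]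
proof (rule restrict_ext)
  fix j assume "j \<in> {1..p}"
  then show "window (Suc i) w j = upsilon s1 s2 p astar (eps (Suc i) w) (rwindow i w) j"
    using assms by (intro upsilon_window[symmetric]) (auto simp: rwindow_apply)
qed

lemma window_law_Suc:
  assumes "p \<le> i"
  shows "distr M windowM (rwindow (Suc i)) = distr (distr M windowH (rwindow i) \<Otimes>\<^sub>M distr M epsH (eps (Suc i)))
    windowM (\<lambda>z. restrict (upsilon s1 s2 p astar (snd z) (fst z)) {1..p})"
proof -
  have "distr M windowM (rwindow (Suc i)) = distr M windowM
      ((\<lambda>z. restrict (upsilon s1 s2 p astar (snd z) (fst z)) {1..p}) \<circ> (\<lambda>w. (rwindow i w, eps (Suc i) w)))"
    using rwindow_Suc[OF assms] by (intro distr_cong refl) simp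
  also have "\<dots> = distr (distr M (windowH \<Otimes>\<^sub>M epsH) (\<lambda>w. (rwindow i w, eps (Suc i) w)))
      windowM (\<lambda>z. restrict (upsilon s1 s2 p astar (snd z) (fst z)) {1..p})"
    by (rule distr_distr[OF upsilon_measurable pair_law(2)[OF assms], symmetric])
  finally show ?thesis unfolding pair_law(1)[OF assms] .
qed

lemma epsH_law:
  assumes "p \<le> i"
  shows "distr M epsH (eps (Suc i)) = distr M epsH (eps (Suc p))"
proof (rule distr_restrict_space_eq)
  show "eps (Suc i) \<in> measurable M FN" "eps (Suc p) \<in> measurable M FN"
    using assms eps_meas by auto
  show "distr M FN (eps (Suc i)) = distr M FN (eps (Suc p))"
    using eps_ident assms by (meson le_imp_less_Suc)
qed (use assms eps_homeo in auto)

text \<open>The hypothesis compares only the first two windows. Each next law is the image of the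
  product of the window law and the common innovation law under one fixed map, so equality
  propagates; at every step it is first carried to the trace space on which this map is
  measurable.\<close>

lemma window_law: "p \<le> i \<Longrightarrow> distr M windowM (rwindow i) = distr M windowM (rwindow p)"
proof (induction i rule: nat_induct_at_least)
  case (Suc i)
  have "distr M windowH (rwindow i) = distr M windowH (rwindow p)"
    by (rule distr_restrict_space_eq[OF rwindow_measurable'[OF Suc.hyps] rwindow_measurable'[OF order_refl]
          rwindow_homeo rwindow_homeo Suc.IH])
  then have "distr M windowM (rwindow (Suc i)) = distr M windowM (rwindow (Suc p))"
    unfolding window_law_Suc[OF Suc.hyps] window_law_Suc[OF order_refl] epsH_law[OF Suc.hyps] by simp
  also have "\<dots> = distr M windowM (rwindow p)"
    using init_stationary by (simp add: rwindow_def[abs_def])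
  finally show ?case .
qed simp

lemma windowH_law: "p \<le> i \<Longrightarrow> distr M windowH (rwindow i) = distr M windowH (rwindow p)"
  by (rule distr_restrict_space_eq[OF rwindow_measurable' rwindow_measurable'[OF order_refl]
        rwindow_homeo rwindow_homeo window_law])

definition mean_loss :: "(nat \<Rightarrow> real) \<Rightarrow> real" where
  "mean_loss a = expectation (loss a (Suc p))"

text \<open>Writing the response as the innovation after the true fit makes the loss a fixed
  functional \<open>q\<close> of the preceding window and the new innovation, whose joint law does
  not depend on time.\<close>

lemma expectation_loss:
  assumes "p < k"
  shows "expectation (loss a k) = mean_loss a"
proof -
  define q where "q = (\<lambda>z. LINT x:{s1..s2}|lborel. ((snd z \<circ> ar_comp s1 s2 astar (\<lambda>j. fst z (p + 1 - j)) p) x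
    - ar_comp s1 s2 a (\<lambda>j. fst z (p + 1 - j)) p x)\<^sup>2)"
  have q: "q \<in> borel_measurable (windowH \<Otimes>\<^sub>M epsH)"
    unfolding q_def
    by (intro integrated_square_diff_measurable pw_mono_map_comp epsH_pw pw_mono_map_ar_comp s12_le windowH_pw) auto
  have eq: "expectation (loss a (Suc i)) = integral\<^sup>L (distr M windowH (rwindow i) \<Otimes>\<^sub>M distr M epsH (eps (Suc i))) q"
    if i: "p \<le> i" for i
  proof -
    have "loss a (Suc i) w = q (rwindow i w, eps (Suc i) w)" if w: "w \<in> space M" for w
    proof -
      have "fit b (Suc i) w = ar_comp s1 s2 b (\<lambda>j. rwindow i w (p + 1 - j)) p" for b
      proof (rule ar_comp_cong)
        fix j assume "j \<in> {1..p}"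
        then have "p + 1 - j \<in> {1..p}" "i - p + (p + 1 - j) = Suc i - j" using i by auto
        then show "T (Suc i - j) w = rwindow i w (p + 1 - j)" by (simp only: rwindow_apply)
      qed
      then show ?thesis using T_eq[of "Suc i" w] i w by (simp add: loss_def q_def)
    qed
    then have "expectation (loss a (Suc i)) = expectation (\<lambda>w. q (rwindow i w, eps (Suc i) w))"
      by (intro Bochner_Integration.integral_cong refl) auto
    also have "\<dots> = integral\<^sup>L (distr M (windowH \<Otimes>\<^sub>M epsH) (\<lambda>w. (rwindow i w, eps (Suc i) w))) q"
      by (rule integral_distr[OF pair_law(2)[OF i] q, symmetric])
    finally show ?thesis unfolding pair_law(1)[OF i] .
  qed
  obtain i where i: "k = Suc i" "p \<le> i" using assms by (cases k) auto
  show ?thesis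
    unfolding mean_loss_def i(1) eq[OF i(2)] eq[OF order_refl] windowH_law[OF i(2)] epsH_law[OF i(2)] ..
qed

lemma loss_integrable: "p < k \<Longrightarrow> integrable M (loss a k)"
  by (rule integrable_bounded[OF loss_measurable loss_bound])

text \<open>Split the later centred loss into its restarted version \<open>?Y\<close> and an error
  \<open>?X\<close>. The earlier loss \<open>?Z\<close> lies in the past of the restart and has mean
  zero, so its product with \<open>?Y\<close> integrates to zero even though \<open>?Y\<close> is
  not centred; the error part is at most \<open>B\<close> times a small mean.\<close>

lemma loss_decorrelation:
  assumes a: "\<And>j. j \<in> {1..p} \<Longrightarrow> \<bar>a j\<bar> \<le> c" and \<tau>: "0 < \<tau>"
  shows "\<exists>m. \<forall>i j. p < i \<longrightarrow> i + m \<le> j \<longrightarrow>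
    \<bar>expectation (\<lambda>w. (loss a i w - mean_loss a) * (loss a j w - mean_loss a))\<bar> \<le> \<tau>"
proof -
  define B where "B = 2 * D ^ 3"
  have B: "0 < B" using s12 by (simp add: B_def)
  have mean: "\<bar>mean_loss a\<bar> \<le> D ^ 3"
  proof -
    have "\<bar>mean_loss a\<bar> \<le> expectation (\<lambda>w. \<bar>loss a (Suc p) w\<bar>)"
      unfolding mean_loss_def using integral_norm_bound[of M "loss a (Suc p)"] by simp
    also have "\<dots> \<le> expectation (\<lambda>_. D ^ 3)"
      using loss_integrable[of "Suc p" a] loss_bound[of "Suc p" _ a] by (intro integral_mono) auto
    finally show ?thesis by (simp add: prob_space)
  qed
  have "0 < \<tau> / B" using \<tau> B by simp
  from loss_approx[where a = a, OF a this]
  obtain m where m: "1 \<le> m" "\<forall>k\<ge>p + m. expectation (\<lambda>w. \<bar>loss a k w - loss_iter a k m w\<bar>) \<le> \<tau> / B"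
    by blast
  show ?thesis
  proof (intro exI[of _ m] allI impI)
    fix i j assume i: "p < i" and j: "i + m \<le> j"
    let ?Z = "\<lambda>w. loss a i w - mean_loss a" and ?Y = "\<lambda>w. loss_iter a j m w - mean_loss a"
    let ?X = "\<lambda>w. loss a j w - loss_iter a j m w"
    have pm: "p + m \<le> j" "p \<le> j - m" "i \<le> j - m" "p < j" using i j by auto
    have Zb: "\<bar>?Z w\<bar> \<le> B" if "w \<in> space M" for w
      using loss_bound[OF i that, of a] mean unfolding B_def by linarith
    have Yb: "\<bar>?Y w\<bar> \<le> B" if "w \<in> space M" for w
      using loss_iter_bound[OF m(1) pm(1) that, of a] mean unfolding B_def by linarith
    have Xb: "\<bar>?X w\<bar> \<le> B" if "w \<in> space M" for w
      using loss_iter_bound[OF m(1) pm(1) that, of a] loss_bound[OF pm(4) that, of a] unfolding B_def by linarith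
    have Zm: "?Z \<in> borel_measurable M" using loss_measurable[OF i] by simp
    have Ym: "?Y \<in> borel_measurable M" using loss_iter_measurable[OF m(1) pm(1)] by simp
    have Xm: "?X \<in> borel_measurable M" using loss_iter_measurable[OF m(1) pm(1)] loss_measurable[OF pm(4)] by simp
    have Zi: "integrable M ?Z" by (rule integrable_bounded[OF Zm Zb])
    have Yi: "integrable M ?Y" by (rule integrable_bounded[OF Ym Yb])
    have Xi: "integrable M ?X" by (rule integrable_bounded[OF Xm Xb])
    have prod: "integrable M (\<lambda>w. ?Z w * V w)"
      if "V \<in> borel_measurable M" "\<And>w. w \<in> space M \<Longrightarrow> \<bar>V w\<bar> \<le> B" for V
      using Zb that B by (intro integrable_bounded[OF borel_measurable_times[OF Zm that(1)], of "B * B"])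
        (auto simp: abs_mult intro!: mult_mono)
    have "expectation (\<lambda>w. ?Z w * ?Y w) = expectation ?Z * expectation ?Y"
    proof (rule expectation_mult_indep_subalgebras[OF subalgebra_past subalgebra_future[OF pm(2)] indep_past_future[OF pm(2)] _ Zi _ Yi])
      show "?Z \<in> borel_measurable (past (j - m))"
        using measurable_past_mono[OF loss_measurable_past[OF i] pm(3)] by simp
      show "?Y \<in> borel_measurable (future (j - m))"
        using loss_iter_measurable_future[OF m(1) pm(1)] by simp
    qed
    moreover have "expectation ?Z = 0"
      using loss_integrable[OF i] expectation_loss[OF i] by (simp add: prob_space)
    ultimately have zero: "expectation (\<lambda>w. ?Z w * ?Y w) = 0" by simp
    have "expectation (\<lambda>w. ?Z w * (loss a j w - mean_loss a)) = expectation (\<lambda>w. ?Z w * ?X w + ?Z w * ?Y w)"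
      by (simp add: algebra_simps)
    also have "\<dots> = expectation (\<lambda>w. ?Z w * ?X w)"
      by (simp only: Bochner_Integration.integral_add[OF prod[OF Xm Xb] prod[OF Ym Yb]] zero add_0_right)
    finally have "\<bar>expectation (\<lambda>w. ?Z w * (loss a j w - mean_loss a))\<bar> \<le> expectation (\<lambda>w. \<bar>?Z w * ?X w\<bar>)"
      using integral_norm_bound[of M "\<lambda>w. ?Z w * ?X w"] by simp
    also have "\<dots> \<le> expectation (\<lambda>w. B * \<bar>?X w\<bar>)"
    proof (rule integral_mono)
      show "integrable M (\<lambda>w. \<bar>?Z w * ?X w\<bar>)" using prod[OF Xm Xb] by (rule integrable_abs)
      show "integrable M (\<lambda>w. B * \<bar>?X w\<bar>)" using Xi by simp
      show "\<bar>?Z w * ?X w\<bar> \<le> B * \<bar>?X w\<bar>" if "w \<in> space M" for w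
        unfolding abs_mult using Zb[OF that] by (intro mult_right_mono) auto
    qed
    also have "\<dots> = B * expectation (\<lambda>w. \<bar>?X w\<bar>)" by simp
    also have "\<dots> \<le> B * (\<tau> / B)" using m(2) pm(1) B by (intro mult_left_mono) auto
    also have "\<dots> = \<tau>" using B by simp
    finally show "\<bar>expectation (\<lambda>w. ?Z w * (loss a j w - mean_loss a))\<bar> \<le> \<tau>" .
  qed
qed

section \<open>Empirical loss, excess risk and the finite net\<close>

abbreviation "L n w a \<equiv> Ln s1 s2 p n (\<lambda>i. T i w) a"

lemma L_eq: "L n w a = 1 / real (n - p) * (\<Sum>i\<in>{p+1..n}. loss a i w)"
  by (simp add: Ln_def loss_def)

lemma L_measurable: "(\<lambda>w. L n w a) \<in> borel_measurable M"
  unfolding L_eq using loss_measurable by (intro borel_measurable_times borel_measurable_sum) auto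

lemma L_weak_law:
  assumes a: "\<And>j. j \<in> {1..p} \<Longrightarrow> \<bar>a j\<bar> \<le> c" and \<tau>: "0 < \<tau>" and \<delta>: "0 < \<delta>"
  shows "\<forall>\<^sub>F n in sequentially. prob {w \<in> space M. \<tau> \<le> \<bar>L n w a - mean_loss a\<bar>} < \<delta>"
proof -
  have mean: "\<bar>loss a i w - mean_loss a\<bar> \<le> D ^ 3 + \<bar>mean_loss a\<bar>" if "p < i" "w \<in> space M" for i w
    using loss_bound[OF that, of a] by linarith
  have "\<exists>N. \<forall>n\<ge>N. prob {w \<in> space M. \<tau> \<le> \<bar>1 / real (n - p) * (\<Sum>i\<in>{p+1..n}. loss a i w - mean_loss a)\<bar>} < \<delta>"
    by (rule weak_law_decorrelated[OF _ mean loss_decorrelation[where a = a, OF a] \<tau> \<delta>])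
      (use loss_measurable in auto)
  then obtain N where N: "\<And>n. N \<le> n \<Longrightarrow>
      prob {w \<in> space M. \<tau> \<le> \<bar>1 / real (n - p) * (\<Sum>i\<in>{p+1..n}. loss a i w - mean_loss a)\<bar>} < \<delta>" by blast
  have eq: "1 / real (n - p) * (\<Sum>i\<in>{p+1..n}. loss a i w - mean_loss a) = L n w a - mean_loss a" if "p < n" for n w
  proof -
    have "(\<Sum>i\<in>{p+1..n}. loss a i w - mean_loss a) = (\<Sum>i\<in>{p+1..n}. loss a i w) - real (n - p) * mean_loss a"
      by (simp only: sum_subtractf sum_constant card_atLeastAtMost) simp
    then show ?thesis unfolding L_eq using that by (simp add: right_diff_distrib del: of_nat_diff)
  qed
  show ?thesis unfolding eventually_sequentially
  proof (intro exI[of _ "max N (Suc p)"] allI impI)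
    fix n assume n: "max N (Suc p) \<le> n"
    show "prob {w \<in> space M. \<tau> \<le> \<bar>L n w a - mean_loss a\<bar>} < \<delta>"
    proof -
      have "p < n" "N \<le> n" using n by auto
      from N[OF this(2)] show ?thesis unfolding eq[OF \<open>p < n\<close>] .
    qed
  qed
qed

lemma expectation_set_integral_swap:
  fixes f :: "'w \<Rightarrow> real \<Rightarrow> real"
  assumes f: "(\<lambda>z. f (fst z) (snd z)) \<in> borel_measurable (M \<Otimes>\<^sub>M borel)"
    and B: "\<And>w x. w \<in> space M \<Longrightarrow> x \<in> {s1..s2} \<Longrightarrow> \<bar>f w x\<bar> \<le> B"
  shows "expectation (\<lambda>w. LINT x:{s1..s2}|lborel. f w x) = (LINT x:{s1..s2}|lborel. expectation (\<lambda>w. f w x))"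
proof -
  interpret P: pair_sigma_finite M lborel ..
  have "(\<lambda>z. f (fst z) (snd z)) \<in> borel_measurable (M \<Otimes>\<^sub>M lborel)"
    using f by (simp cong: measurable_cong_sets)
  then have "integrable (M \<Otimes>\<^sub>M lborel) (\<lambda>z. indicator (space M \<times> {s1..s2}) z *\<^sub>R f (fst z) (snd z))"
    using B by (intro integrableI_bounded_set_indicator[where B = B])
      (auto simp: lborel.emeasure_pair_measure_Times emeasure_space_1 emeasure_lborel_Icc_eq)
  also have "?this \<longleftrightarrow> integrable (M \<Otimes>\<^sub>M lborel) (case_prod (\<lambda>w x. indicator {s1..s2} x *\<^sub>R f w x))"
    by (intro Bochner_Integration.integrable_cong) (auto simp: space_pair_measure indicator_def)
  finally show ?thesis
    using P.Fubini_integral[of "\<lambda>w x. indicator {s1..s2} x *\<^sub>R f w x"]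
    by (simp add: set_lebesgue_integral_def)
qed

definition discrepancy :: "(nat \<Rightarrow> real) \<Rightarrow> real" where
  "discrepancy a = (LINT x:{s1..s2}|lborel. expectation (\<lambda>w. (fit a (p + 1) w x - fit astar (p + 1) w x)\<^sup>2))"

lemma fit_range: "p < k \<Longrightarrow> w \<in> space M \<Longrightarrow> x \<in> {s1..s2} \<Longrightarrow> fit a k w x \<in> {s1..s2}"
  by (rule homeo_range[OF fit_homeo])

text \<open>The mean-identity property of the innovation is assumed only at fixed points. Freezing
  the past makes the fitted value such a point, and the second factor becomes a constant.\<close>

lemma innovation_orthogonal:
  assumes x: "x \<in> {s1..s2}"
  shows "expectation (\<lambda>w. (T (p + 1) w x - fit astar (p + 1) w x) * (fit astar (p + 1) w x - fit a (p + 1) w x)) = 0"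
proof -
  let ?f = "\<lambda>z. (eps (p + 1) (snd z) (fit astar (p + 1) (fst z) x) - fit astar (p + 1) (fst z) x)
    * (fit astar (p + 1) (fst z) x - fit a (p + 1) (fst z) x)"
  have fm: "(\<lambda>z. fit b (p + 1) (fst z) x) \<in> borel_measurable (past p \<Otimes>\<^sub>M future p)" for b
    by (rule pw_mono_map_apply[OF fit_pw_past[of "p + 1" p b] measurable_fst]) auto
  have em: "(\<lambda>z. eps (p + 1) (snd z) (fit astar (p + 1) (fst z) x)) \<in> borel_measurable (past p \<Otimes>\<^sub>M future p)"
    by (rule pw_mono_map_apply[OF eps_pw_future[of p "p + 1"] measurable_snd fm]) auto
  have fr: "fit b (p + 1) w x \<in> {s1..s2}" if "w \<in> space M" for b w
    using fit_range[of "p + 1" w x b] that x by simp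
  have er: "eps (p + 1) w y \<in> {s1..s2}" if "w \<in> space M" "y \<in> {s1..s2}" for w y
    using Tset_range[of "eps (p + 1) w" s1 s2 y] eps_T that by simp
  have "expectation (\<lambda>w. (T (p + 1) w x - fit astar (p + 1) w x) * (fit astar (p + 1) w x - fit a (p + 1) w x))
      = expectation (\<lambda>w. ?f (w, w))"
    using T_eq[of "p + 1"] by (intro Bochner_Integration.integral_cong refl) simp
  also have "\<dots> = expectation (\<lambda>w'. expectation (\<lambda>w. ?f (w', w)))"
  proof (rule integral_decouple[OF subalgebra_past subalgebra_future[OF order_refl] indep_past_future[OF order_refl], where B = "D * D"])
    show "?f \<in> borel_measurable (past p \<Otimes>\<^sub>M future p)"
      using fm em by (intro borel_measurable_times borel_measurable_diff)
    fix w' w assume w: "w' \<in> space M" "w \<in> space M"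
    have "\<bar>eps (p + 1) w (fit astar (p + 1) w' x) - fit astar (p + 1) w' x\<bar> \<le> D"
      "\<bar>fit astar (p + 1) w' x - fit a (p + 1) w' x\<bar> \<le> D"
      using er[OF w(2) fr[OF w(1)], of astar] fr[OF w(1), of astar] fr[OF w(1), of a] by auto
    then show "\<bar>?f (w', w)\<bar> \<le> D * D"
      unfolding abs_mult fst_conv snd_conv using s12 by (intro mult_mono) auto
  qed
  also have "\<dots> = expectation (\<lambda>w'. 0)"
  proof (intro Bochner_Integration.integral_cong refl)
    fix w' assume w': "w' \<in> space M"
    let ?y = "fit astar (p + 1) w' x"
    have "eps (p + 1) \<in> measurable M FN" using eps_meas by simp
    then have "integrable M (\<lambda>w. eps (p + 1) w ?y)"
    proof (rule integrable_bounded[OF measurable_FN_component])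
      fix w assume "w \<in> space M"
      from er[OF this fr[OF w', of astar]]
      show "\<bar>eps (p + 1) w ?y\<bar> \<le> max \<bar>s1\<bar> \<bar>s2\<bar>" by auto
    qed
    moreover have "expectation (\<lambda>w. eps (p + 1) w ?y) = ?y"
      using eps_mean fr[OF w', of astar] by simp
    ultimately show "expectation (\<lambda>w. ?f (w', w)) = 0" by (simp add: prob_space)
  qed
  finally show ?thesis by simp
qed

text \<open>The difference of the two squares is
  \<open>(f - f')^2 + 2 * (T - f') * (f' - f)\<close>, with \<open>f\<close> the fit for
  \<open>a\<close> and \<open>f'\<close> the fit for \<open>astar\<close>. The cross term is the
  orthogonality just shown, at every \<open>x\<close>.\<close>

lemma mean_loss_excess: "mean_loss a - mean_loss astar = discrepancy a"
proof -
  let ?k = "p + 1"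
  let ?f = "\<lambda>w x. (T ?k w x - fit a ?k w x)\<^sup>2 - (T ?k w x - fit astar ?k w x)\<^sup>2"
  have k: "p < ?k" by simp
  have Tm: "pw_mono_map s1 s2 M (T ?k)" and Fm: "pw_mono_map s1 s2 M (fit b ?k)" for b
    by (rule T_pw, simp) (rule fit_pw, simp)
  have Tr: "T ?k w x \<in> {s1..s2}" if "w \<in> space M" "x \<in> {s1..s2}" for w x
    using homeo_range[OF T_homeo[of ?k w]] that by simp
  note Fr = fit_range[OF k]
  have b: "\<bar>T ?k w x - fit b ?k w x\<bar> \<le> D" "\<bar>fit b' ?k w x - fit b ?k w x\<bar> \<le> D"
    if "w \<in> space M" "x \<in> {s1..s2}" for w x b b'
    using Tr[OF that] Fr[OF that, of b] Fr[OF that, of b'] by auto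
  have sq: "\<bar>u\<^sup>2\<bar> \<le> D\<^sup>2" if "\<bar>u\<bar> \<le> D" for u using that s12 by (simp add: abs_le_square_iff[symmetric])
  have "mean_loss a - mean_loss astar = expectation (\<lambda>w. loss a ?k w - loss astar ?k w)"
    using loss_integrable[OF k] by (simp add: mean_loss_def)
  also have "\<dots> = expectation (\<lambda>w. LINT x:{s1..s2}|lborel. ?f w x)"
  proof (intro Bochner_Integration.integral_cong refl)
    fix w assume w: "w \<in> space M"
    have "set_integrable lborel {s1..s2} (\<lambda>x. (T ?k w x - fit b ?k w x)\<^sup>2)" for b
      using pw_mono_map_section_borel[OF Tm w] pw_mono_map_section_borel[OF Fm w, of b] sq[OF b(1)[OF w]]
      by (intro set_integrable_bounded_Icc[of _ _ _ "D\<^sup>2"]) auto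
    then show "loss a ?k w - loss astar ?k w = (LINT x:{s1..s2}|lborel. ?f w x)"
      by (simp add: loss_def set_integral_diff)
  qed
  also have "\<dots> = (LINT x:{s1..s2}|lborel. expectation (\<lambda>w. ?f w x))"
  proof (rule expectation_set_integral_swap)
    show "(\<lambda>z. ?f (fst z) (snd z)) \<in> borel_measurable (M \<Otimes>\<^sub>M borel)"
      using pw_mono_map_measurable[OF Tm] pw_mono_map_measurable[OF Fm]
      by (intro borel_measurable_diff borel_measurable_power)
    fix w x assume "w \<in> space M" "x \<in> {s1..s2}"
    from sq[OF b(1)[OF this, of a]] sq[OF b(1)[OF this, of astar]]
    show "\<bar>?f w x\<bar> \<le> 2 * D\<^sup>2" by linarith
  qed
  also have "\<dots> = discrepancy a"
    unfolding discrepancy_def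
  proof (intro set_lebesgue_integral_cong allI impI)
    fix x assume x: "x \<in> {s1..s2}"
    let ?g = "\<lambda>w. (T ?k w x - fit astar ?k w x) * (fit astar ?k w x - fit a ?k w x)"
    let ?h = "\<lambda>w. (fit a ?k w x - fit astar ?k w x)\<^sup>2"
    have m: "(\<lambda>w. T ?k w x) \<in> borel_measurable M" "(\<lambda>w. fit b ?k w x) \<in> borel_measurable M" for b
      using pw_mono_map_apply_id[OF Tm] pw_mono_map_apply_id[OF Fm] by auto
    have "\<bar>?g w\<bar> \<le> D * D" if "w \<in> space M" for w
      unfolding abs_mult using b[OF that x] s12 by (intro mult_mono) auto
    then have ig: "integrable M ?g"
      using m by (intro integrable_bounded[of _ "D * D"] borel_measurable_times borel_measurable_diff)
    have ih: "integrable M ?h"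
      using m sq[OF b(2)[OF _ x]] by (intro integrable_bounded[of _ "D\<^sup>2"] borel_measurable_power borel_measurable_diff)
    have "expectation (\<lambda>w. ?f w x) = expectation (\<lambda>w. ?h w + 2 * ?g w)"
      by (intro Bochner_Integration.integral_cong refl) (simp add: power2_eq_square algebra_simps)
    also have "\<dots> = expectation ?h + 2 * expectation ?g"
      using ig ih by simp
    finally show "expectation (\<lambda>w. ?f w x) = expectation ?h"
      using innovation_orthogonal[OF x, of a] by simp
  qed simp
  finally show ?thesis .
qed

text \<open>\<open>C\<close> is uniform in time and in the sample point, so the same modulus serves
  the empirical and the mean loss.\<close>

lemma loss_uniformly_lipschitz:
  obtains C where "0 < C" "\<And>a b h k w. (\<And>j. j \<in> {1..p} \<Longrightarrow> \<bar>a j\<bar> \<le> c) \<Longrightarrow> (\<And>j. j \<in> {1..p} \<Longrightarrow> \<bar>b j\<bar> \<le> c) \<Longrightarrow>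
    (\<And>j. j \<in> {1..p} \<Longrightarrow> \<bar>a j - b j\<bar> \<le> h) \<Longrightarrow> p < k \<Longrightarrow> w \<in> space M \<Longrightarrow> \<bar>loss a k w - loss b k w\<bar> \<le> C * h"
proof -
  define \<Lambda> where "\<Lambda> = smult_const K c"
  have \<Lambda>: "1 \<le> \<Lambda>" unfolding \<Lambda>_def by (rule smult_const_ge_1[OF K_ge_1])
  define E where "E = 2 * (real (nat \<lfloor>c\<rfloor>) + 1) * D"
  have E: "0 < E" using s12 by (simp add: E_def)
  define C where "C = 2 * D\<^sup>2 * (real p * \<Lambda> ^ p * E)"
  show thesis
  proof (rule that[of C])
    show "0 < C" using E \<Lambda> s12 p_ge_1 by (simp add: C_def)
    fix a b h k w
    assume a: "\<And>j. j \<in> {1..p} \<Longrightarrow> \<bar>a j\<bar> \<le> c" and b: "\<And>j. j \<in> {1..p} \<Longrightarrow> \<bar>b j\<bar> \<le> c"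
      and h: "\<And>j. j \<in> {1..p} \<Longrightarrow> \<bar>a j - b j\<bar> \<le> h" and k: "p < k" and w: "w \<in> space M"
    have h0: "0 \<le> h" using h[of 1] p_ge_1 by fastforce
    have B: "T (k - j) w \<in> bilip s1 s2 K" if "j \<in> {1..p}" for j using that k w by (intro T_bilip) auto
    have near: "unif_near s1 s2 (real p * \<Lambda> ^ p * (E * h)) (fit a k w) (fit b k w)"
    proof (rule conjunct1[OF ar_comp_near])
      fix j assume j: "j \<in> {1..p}"
      show "\<Lambda>-lipschitz_on {s1..s2} (smult s1 s2 (a j) (T (k - j) w))"
        unfolding \<Lambda>_def by (rule smult_lipschitz_near(1)[OF B[OF j] K_ge_1 a[OF j]])
      show "T (k - j) w \<in> homeo s1 s2" "T (k - j) w \<in> homeo s1 s2" using bilip_homeo[OF B[OF j]] by auto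
      show "unif_near s1 s2 (E * h) (smult s1 s2 (a j) (T (k - j) w)) (smult s1 s2 (b j) (T (k - j) w))"
      proof (rule unif_near_mono)
        show "unif_near s1 s2 (E * \<bar>a j - b j\<bar>) (smult s1 s2 (a j) (T (k - j) w)) (smult s1 s2 (b j) (T (k - j) w))"
          unfolding E_def by (rule smult_near_coeff[OF bilip_homeo[OF B[OF j]] a[OF j] b[OF j]])
        show "E * \<bar>a j - b j\<bar> \<le> E * h" using h[OF j] E by (intro mult_left_mono) auto
      qed
    qed (use \<Lambda> E h0 in auto)
    have hs: "T k w \<in> homeo s1 s2" "fit a k w \<in> homeo s1 s2" "fit b k w \<in> homeo s1 s2"
      using k w by (auto intro!: T_homeo fit_homeo)
    have "\<bar>loss a k w - loss b k w\<bar> \<le> 2 * D\<^sup>2 * (0 + real p * \<Lambda> ^ p * (E * h))"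
      unfolding loss_def
      by (rule integrated_square_diff_near[OF s12_le _ _ _ _ _ unif_near_refl[OF order_refl] near])
        (use hs homeo_range Tset_borel homeo_Tset in auto)
    then show "\<bar>loss a k w - loss b k w\<bar> \<le> C * h" by (simp add: C_def mult_ac)
  qed
qed

text \<open>Each coordinate is rounded down to the grid of mesh \<open>h\<close> starting at
  \<open>-c\<close>. Rounding down keeps the net inside the box, where the weak law and the
  Lipschitz bound are available.\<close>

lemma finite_net_box:
  assumes h: "0 < h"
  obtains G :: "(nat \<Rightarrow> real) set" where "finite G" "\<And>b j. b \<in> G \<Longrightarrow> j \<in> {1..p} \<Longrightarrow> \<bar>b j\<bar> \<le> c"
    "\<And>a. (\<And>j. j \<in> {1..p} \<Longrightarrow> \<bar>a j\<bar> \<le> c) \<Longrightarrow> \<exists>b\<in>G. \<forall>j\<in>{1..p}. \<bar>a j - b j\<bar> \<le> h"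
proof -
  define g where "g = (\<lambda>t. -c + h * of_int \<lfloor>(t + c) / h\<rfloor>)"
  define V where "V = (\<lambda>k. -c + h * of_int k) ` {0..\<lfloor>2 * c / h\<rfloor>}"
  have g: "\<bar>t - g t\<bar> \<le> h" "g t \<in> V" "\<bar>g t\<bar> \<le> c" if t: "\<bar>t\<bar> \<le> c" for t
  proof -
    have fl: "of_int \<lfloor>(t + c) / h\<rfloor> \<le> (t + c) / h" "(t + c) / h < of_int \<lfloor>(t + c) / h\<rfloor> + 1" by linarith+
    have hq: "h * ((t + c) / h) = t + c" using h by simp
    have f0: "0 \<le> \<lfloor>(t + c) / h\<rfloor>" using t h by simp
    have "h * of_int \<lfloor>(t + c) / h\<rfloor> \<le> t + c" "t + c < h * of_int \<lfloor>(t + c) / h\<rfloor> + h"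
      using mult_left_mono[OF fl(1), of h] mult_strict_left_mono[OF fl(2), of h] h
      by (simp_all only: hq distrib_left mult_1_right less_imp_le)
    moreover have "0 \<le> h * of_int \<lfloor>(t + c) / h\<rfloor>" using f0 h by simp
    ultimately show "\<bar>t - g t\<bar> \<le> h" "\<bar>g t\<bar> \<le> c" using t unfolding g_def by linarith+
    have "\<lfloor>(t + c) / h\<rfloor> \<le> \<lfloor>2 * c / h\<rfloor>" using t h by (intro floor_mono divide_right_mono) auto
    then show "g t \<in> V" using f0 by (auto simp: V_def g_def)
  qed
  define G where "G = PiE {1..p} (\<lambda>_. V \<inter> {-c..c})"
  show thesis
  proof (rule that[of G])
    show "finite G" unfolding G_def V_def by (intro finite_PiE) auto
    show "\<bar>b j\<bar> \<le> c" if "b \<in> G" "j \<in> {1..p}" for b j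
    proof -
      have "b j \<in> V \<inter> {-c..c}" using that unfolding G_def by (rule PiE_mem)
      then show ?thesis by auto
    qed
    show "\<exists>b\<in>G. \<forall>j\<in>{1..p}. \<bar>a j - b j\<bar> \<le> h" if a: "\<And>j. j \<in> {1..p} \<Longrightarrow> \<bar>a j\<bar> \<le> c" for a
    proof (intro bexI[of _ "restrict (\<lambda>j. g (a j)) {1..p}"] ballI)
      have "g (a j) \<in> V \<inter> {-c..c}" if "j \<in> {1..p}" for j
      proof -
        have "-c \<le> g (a j)" "g (a j) \<le> c" using g(3)[OF a[OF that]] by linarith+
        then show ?thesis using g(2)[OF a[OF that]] by simp
      qed
      then show "restrict (\<lambda>j. g (a j)) {1..p} \<in> G"
        unfolding G_def by (simp add: restrict_PiE_iff)
    qed (use g(1)[OF a] in simp)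
  qed
qed

text \<open>Off the union of finitely many bad events, the minimiser is replaced by a nearby net
  point and the empirical by the mean loss. The estimator enters only pointwise in \<open>w\<close>,
  which explains the covering event in the conclusion.\<close>

lemma least_squares_consistent:
  assumes argmin: "\<forall>n>p. \<forall>w\<in>space M.
        (\<forall>j\<in>{1..p}. -c \<le> atil n w j \<and> atil n w j \<le> c) \<and>
        (\<forall>\<beta>. (\<forall>j\<in>{1..p}. -c \<le> \<beta> j \<and> \<beta> j \<le> c) \<longrightarrow> L n w (atil n w) \<le> L n w \<beta>)"
    and e: "0 < e" and \<delta>: "0 < \<delta>"
  shows "\<exists>N. \<forall>n\<ge>N. \<exists>A\<in>events. {w\<in>space M. discrepancy (atil n w) > e} \<subseteq> A \<and> prob A < \<delta>"
proof -
  obtain C where C: "0 < C" and lip: "\<And>a b h k w. (\<And>j. j \<in> {1..p} \<Longrightarrow> \<bar>a j\<bar> \<le> c) \<Longrightarrow> (\<And>j. j \<in> {1..p} \<Longrightarrow> \<bar>b j\<bar> \<le> c) \<Longrightarrow>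
    (\<And>j. j \<in> {1..p} \<Longrightarrow> \<bar>a j - b j\<bar> \<le> h) \<Longrightarrow> p < k \<Longrightarrow> w \<in> space M \<Longrightarrow> \<bar>loss a k w - loss b k w\<bar> \<le> C * h"
    by (rule loss_uniformly_lipschitz) blast
  define h where "h = e / (8 * C)"
  have h: "0 < h" "C * h = e / 8" using C e by (auto simp: h_def)
  obtain G where G: "finite G" "\<And>b j. b \<in> G \<Longrightarrow> j \<in> {1..p} \<Longrightarrow> \<bar>b j\<bar> \<le> c"
    "\<And>a. (\<And>j. j \<in> {1..p} \<Longrightarrow> \<bar>a j\<bar> \<le> c) \<Longrightarrow> \<exists>b\<in>G. \<forall>j\<in>{1..p}. \<bar>a j - b j\<bar> \<le> h"
    by (rule finite_net_box[OF h(1)]) blast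
  \<comment> \<open>The true parameter need not be a net point, yet its empirical loss must be
    controlled as well.\<close>
  define G' where "G' = insert astar G"
  have star: "\<bar>astar j\<bar> \<le> c" if "j \<in> {1..p}" for j
    using astar_box[rule_format, OF that] by linarith
  have G': "finite G'" "\<And>b j. b \<in> G' \<Longrightarrow> j \<in> {1..p} \<Longrightarrow> \<bar>b j\<bar> \<le> c"
    using G(1) G(2) star by (auto simp: G'_def)
  define bad where "bad = (\<lambda>n b. {w \<in> space M. e / 8 \<le> \<bar>L n w b - mean_loss b\<bar>})"
  have bad_meas: "bad n b \<in> events" for n b
    unfolding bad_def using L_measurable[of n b] by measurable
  \<comment> \<open>The added 1 makes the sum of the bounds strictly smaller than
    \<open>\<delta>\<close>.\<close>
  have "0 < \<delta> / (real (card G') + 1)" using \<delta> by simp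
  then have "\<forall>\<^sub>F n in sequentially. \<forall>b\<in>G'. prob (bad n b) < \<delta> / (real (card G') + 1)"
    unfolding bad_def using G' e by (intro eventually_ball_finite ballI L_weak_law) auto
  then obtain N where N: "\<And>n b. N \<le> n \<Longrightarrow> b \<in> G' \<Longrightarrow> prob (bad n b) < \<delta> / (real (card G') + 1)"
    by (auto simp: eventually_sequentially)
  show ?thesis
  proof (intro exI[of _ "max N (Suc p)"] allI impI)
    fix n assume n: "max N (Suc p) \<le> n"
    then have pn: "p < n" and Nn: "N \<le> n" by auto
    let ?A = "\<Union>b\<in>G'. bad n b"
    have "prob ?A \<le> (\<Sum>b\<in>G'. prob (bad n b))"
      using G'(1) bad_meas by (intro finite_measure_subadditive_finite) auto
    also have "\<dots> \<le> (\<Sum>b\<in>G'. \<delta> / (real (card G') + 1))"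
      using N[OF Nn] by (intro sum_mono less_imp_le)
    also have "\<dots> < \<delta>" using \<delta> by (simp add: field_simps)
    finally have small: "prob ?A < \<delta>" .
    have "{w\<in>space M. discrepancy (atil n w) > e} \<subseteq> ?A"
    proof (rule subsetI, rule ccontr)
      fix w assume "w \<in> {w\<in>space M. discrepancy (atil n w) > e}" and nA: "w \<notin> ?A"
      then have w: "w \<in> space M" and big: "discrepancy (atil n w) > e" by auto
      let ?a = "atil n w"
      have abox: "\<bar>?a j\<bar> \<le> c" if "j \<in> {1..p}" for j
      proof -
        have "-c \<le> ?a j \<and> ?a j \<le> c" using argmin pn w that by blast
        then show ?thesis by linarith
      qed
      have amin: "L n w ?a \<le> L n w astar"
        using argmin pn w astar_box by blast
      obtain b where b: "b \<in> G" and ab: "\<And>j. j \<in> {1..p} \<Longrightarrow> \<bar>?a j - b j\<bar> \<le> h"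
        using G(3)[of ?a, OF abox] by blast
      note near = lip[of ?a b h, OF abox G(2)[OF b] ab, unfolded h(2)]
      have good: "\<bar>L n w b' - mean_loss b'\<bar> < e / 8" if "b' \<in> G'" for b'
        using nA that w by (auto simp: bad_def)
      have "\<bar>L n w ?a - L n w b\<bar> \<le> e / 8"
      proof -
        have "\<bar>\<Sum>i\<in>{p+1..n}. loss ?a i w - loss b i w\<bar> \<le> (\<Sum>i\<in>{p+1..n}. e / 8)"
          using near w by (intro order_trans[OF sum_abs] sum_mono) auto
        also have "\<dots> = real (n - p) * (e / 8)" by (simp only: sum_constant card_atLeastAtMost) simp
        finally have "1 / real (n - p) * \<bar>\<Sum>i\<in>{p+1..n}. loss ?a i w - loss b i w\<bar> \<le> 1 / real (n - p) * (real (n - p) * (e / 8))"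
          by (intro mult_left_mono) auto
        also have "\<dots> = e / 8" using pn by (simp del: of_nat_diff)
        also have "1 / real (n - p) * \<bar>\<Sum>i\<in>{p+1..n}. loss ?a i w - loss b i w\<bar> = \<bar>L n w ?a - L n w b\<bar>"
          unfolding L_eq right_diff_distrib[symmetric] sum_subtractf[symmetric] abs_mult by simp
        finally show ?thesis .
      qed
      moreover have "\<bar>mean_loss ?a - mean_loss b\<bar> \<le> e / 8"
      proof -
        let ?k = "Suc p"
        have i: "integrable M (loss a' ?k)" for a' by (rule loss_integrable) simp
        have "\<bar>mean_loss ?a - mean_loss b\<bar> = \<bar>expectation (\<lambda>w. loss ?a ?k w - loss b ?k w)\<bar>"
          using i by (simp add: mean_loss_def)
        also have "\<dots> \<le> expectation (\<lambda>w. \<bar>loss ?a ?k w - loss b ?k w\<bar>)"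
          using integral_norm_bound[of M "\<lambda>w. loss ?a ?k w - loss b ?k w"] by simp
        also have "\<dots> \<le> expectation (\<lambda>_. e / 8)"
          using i near by (intro integral_mono) auto
        finally show ?thesis by (simp add: prob_space)
      qed
      moreover have "\<bar>L n w b - mean_loss b\<bar> < e / 8" "\<bar>L n w astar - mean_loss astar\<bar> < e / 8"
        using good b by (auto simp: G'_def)
      \<comment> \<open>Four errors of at most \<open>e / 8\<close>: mean loss from the minimiser to
        \<open>b\<close>, mean to empirical at \<open>b\<close>, empirical loss from
        \<open>b\<close> back to the minimiser, and empirical to mean at \<open>astar\<close>.
        Minimality only helps, so the excess stays below \<open>e / 2\<close>.\<close>
      ultimately have "mean_loss ?a - mean_loss astar < e"
        using amin e by linarith
      then show False using big unfolding mean_loss_excess by simp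
    qed
    then show "\<exists>A\<in>events. {w\<in>space M. discrepancy (atil n w) > e} \<subseteq> A \<and> prob A < \<delta>"
      using small G'(1) bad_meas by (intro bexI[of _ ?A]) auto
  qed
qed

end

theorem theorem4:
  fixes M :: "'w measure"
    and s1 s2 c K :: real
    and p :: nat
    and astar :: "nat \<Rightarrow> real"
    and T eps :: "nat \<Rightarrow> 'w \<Rightarrow> real \<Rightarrow> real"
    and atil :: "nat \<Rightarrow> 'w \<Rightarrow> nat \<Rightarrow> real"
  assumes "prob_space M"
    and "s1 < s2" and "p \<ge> 1" and "c > 0"
    and astar_box: "\<forall>j\<in>{1..p}. -c \<le> astar j \<and> astar j \<le> c"
    \<comment> \<open>i.i.d. random distortion maps eps_i, i > p\<close>
    and eps_meas: "\<forall>i>p. eps i \<in> measurable M FN"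
    and eps_T: "\<forall>i>p. \<forall>\<omega>\<in>space M. eps i \<omega> \<in> Tset s1 s2"
    and eps_mean: "\<forall>i>p. \<forall>x\<in>{s1..s2}. integral\<^sup>L M (\<lambda>\<omega>. eps i \<omega> x) = x"
    and eps_indep: "prob_space.indep_vars M (\<lambda>_. FN) eps {p<..}"
    and eps_ident: "\<forall>i>p. distr M FN (eps i) = distr M FN (eps (Suc p))"
    \<comment> \<open>hypothesis of Theorem 3 with q = 1 (geometric moment contraction)\<close>
    and GMC: "\<exists>\<eta>>0. \<exists>S0. (\<forall>j\<in>{1..p}. S0 j \<in> Tset s1 s2) \<and> (\<exists>C>0. \<exists>r. 0 < r \<and> r < 1 \<and>
        (\<forall>R. (\<forall>j\<in>{1..p}. R j \<in> Tset s1 s2) \<longrightarrow> (\<forall>m i. i \<ge> p + m \<longrightarrow>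
          (\<integral>\<^sup>+ \<omega>. ennreal ((d1p s1 s2 p
               (upsilon_iter s1 s2 p astar (\<lambda>k. eps k \<omega>) i m S0)
               (upsilon_iter s1 s2 p astar (\<lambda>k. eps k \<omega>) i m R)) powr \<eta>) \<partial>M)
          \<le> ennreal (C * r ^ m * (d1p s1 s2 p S0 R) powr \<eta>))))"
    \<comment> \<open>the process: random maps, initial values from the stationary distribution,
        independent of the innovations, and the AR recursion\<close>
    and T_meas: "\<forall>i. T i \<in> measurable M FN"
    and T_T: "\<forall>i\<ge>1. \<forall>\<omega>\<in>space M. T i \<omega> \<in> Tset s1 s2"
    and init_indep: "prob_space.indep_var M
        (PiM {1..p} (\<lambda>_. FN)) (\<lambda>\<omega>. restrict (\<lambda>j. T j \<omega>) {1..p})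
        (PiM {p<..} (\<lambda>_. FN)) (\<lambda>\<omega>. restrict (\<lambda>i. eps i \<omega>) {p<..})"
    and init_stationary: "distr M (PiM {1..p} (\<lambda>_. FN)) (\<lambda>\<omega>. restrict (\<lambda>j. T (Suc j) \<omega>) {1..p})
        = distr M (PiM {1..p} (\<lambda>_. FN)) (\<lambda>\<omega>. restrict (\<lambda>j. T j \<omega>) {1..p})"
    and recursion: "\<forall>i>p. \<forall>\<omega>\<in>space M.
        T i \<omega> = oplus (ar_comp s1 s2 astar (\<lambda>j. T (i - j) \<omega>) p) (eps i \<omega>)"
    \<comment> \<open>regularity: strictly increasing, differentiable, bi-Lipschitz with common constant K\<close>
    and "K > 0"
    and T_reg: "\<forall>i\<ge>1. \<forall>\<omega>\<in>space M.
        strict_mono_on {s1..s2} (T i \<omega>) \<and> T i \<omega> differentiable_on {s1..s2} \<and>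
        (\<forall>x\<in>{s1..s2}. \<forall>y\<in>{s1..s2}.
           \<bar>T i \<omega> x - T i \<omega> y\<bar> \<le> K * \<bar>x - y\<bar> \<and> \<bar>x - y\<bar> \<le> K * \<bar>T i \<omega> x - T i \<omega> y\<bar>)"
    \<comment> \<open>least squares estimator over the box [-c,c]^p\<close>
    and atil_argmin: "\<forall>n>p. \<forall>\<omega>\<in>space M.
        (\<forall>j\<in>{1..p}. -c \<le> atil n \<omega> j \<and> atil n \<omega> j \<le> c) \<and>
        (\<forall>\<beta>. (\<forall>j\<in>{1..p}. -c \<le> \<beta> j \<and> \<beta> j \<le> c) \<longrightarrow>
             Ln s1 s2 p n (\<lambda>i. T i \<omega>) (atil n \<omega>) \<le> Ln s1 s2 p n (\<lambda>i. T i \<omega>) \<beta>)"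
  shows "\<forall>e>0. \<forall>\<delta>>0. \<exists>N. \<forall>n\<ge>N. \<exists>A\<in>sets M.
     {\<omega>\<in>space M.
        (let \<alpha> = atil n \<omega> in
         LINT x:{s1..s2}|lborel.
           integral\<^sup>L M (\<lambda>\<omega>'. (ar_comp s1 s2 \<alpha> (\<lambda>j. T (p + 1 - j) \<omega>') p x
                              - ar_comp s1 s2 astar (\<lambda>j. T (p + 1 - j) \<omega>') p x)\<^sup>2)) > e}
       \<subseteq> A \<and> measure M A < \<delta>"
proof -
  interpret stationary_ar M s1 s2 c K p astar T eps
    by (intro stationary_ar.intro stationary_ar_axioms.intro) (fact assms)+
  show ?thesis
    using least_squares_consistent[OF atil_argmin] unfolding discrepancy_def Let_def by blast
qed

end
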